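(* Suppose $P_1$ is a plane in $\mathbb{H}^3$ bounding a half-space $H_1$, and that $B_2$, $B_3$ and $B_4$ are horoballs respectively defined by pairwise linearly independent positive light-like vectors $\mathbf{x}_2$, $\mathbf{x}_3$ and $\mathbf{x}_4$, such that each $\mathbf{x}_i$, $i>1$, lies in the ideal boundary of $H_1$ but not of $P_1$. Let $\tilde\lambda_{12}$ be the geodesic with ideal endpoint at $\mathbf{x}_2$ that intersects $P_1$ perpendicularly, and let $\tilde\lambda_{34}$ be the geodesic with its ideal endpoints at $\mathbf{x}_3$ and $\mathbf{x}_4$. Fix parametrizations $\tilde\lambda_{12}(s)$ and $\tilde\lambda_{34}(t)$ by arclength. Then: \begin{enumerate} \item the function $D(s,t)$ that records the hyperbolic cosine of the distance from $\tilde\lambda_{12}(s)$ to $\tilde\lambda_{34}(t)$ has a unique critical point $(s_0,t_0)$ in $\mathbb{R}^2$, at which it attains an absolute minimum; \item the absolute minimum value $D(s_0,t_0)$ depends only on the signed distances $h_{1j}$ from $P_1$ to the $B_j$ ($j\in\{2,3,4\}$), and $d_{jk}$ from $B_j$ to $B_k$ ($j<k\in\{2,3,4\}$); \item the points $\tilde\lambda_{12}(s_0)$ and $\tilde\lambda_{34}(t_0)$ lie in the partially truncated tetrahedron $\Delta$ determined by $P_1$ and the $B_j$, so $D(s_0,t_0)$ is the hyperbolic cosine of a transversal length of $\Delta$; and \item written as $T_3(x,y;a,b;c,d)$, where $x=e^{h_{12}}$, $y=e^{d_{34}}$, $a=e^{h_{13}}$, $b=e^{h_{14}}$, $c=e^{d_{23}}$,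 and $d=e^{d_{24}}$, this transversal length is increasing in each of $a$, $b$, $c$, $d$ individually and invariant under the involution exchanging $a$ with $b$ and $c$ with $d$. \end{enumerate} Given explicitly, \[ \cosh T_3(x,y;a,b;c,d)=\frac{1}{\sqrt{xy}}\left[\sqrt{c\left(\frac{d}{x}+b\right)}+\sqrt{d\left(\frac{c}{x}+a\right)}\right]. \]
   Context: Hyperboloid model. On $\mathbb{R}^{4}$ put $\mathbf{x}\circ\mathbf{y}=-x_1y_1+x_2y_2+x_3y_3+x_4y_4$. A nonzero vector $\mathbf{x}$ is light-like if $\mathbf{x}\circ\mathbf{x}=0$, and time-like if $\mathbf{x}\circ\mathbf{x}<0$; such a vector is positive if its first entry is positive. $\mathbb{H}^3$ is the set of positive $\mathbf{x}$ with $\mathbf{x}\circ\mathbf{x}=-1$, with $\cosh d_H(\mathbf{u},\mathbf{v})=-\mathbf{u}\circ\mathbf{v}$. Ideal points of $\mathbb{H}^3$ are projective classes $[\mathbf{x}]$ of positive light-like vectors. A positive light-like $\mathbf{x}$ determines the horosphere $S=\{\mathbf{v}\in\mathbb{H}^3: \mathbf{v}\circ\mathbf{x}=-1\}$ and the horoball $B=\{\mathbf{v}\in\mathbb{H}^3:\mathbf{v}\circ\mathbf{x}\ge -1\}$, with ideal point $[\mathbf{x}]$. A plane is $P=V\cap\mathbb{H}^3$ for a 3-dimensional subspace $V$ containing a time-like vector; a half-space is the closure of a component of $\mathbb{H}^3-P$. The ideal boundary of $P$ (resp. of a half-space $H$ bounded by $P$) is the intersection of the set of positive light-like vectors with $V$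 (resp. with the closure of the component of $\mathbb{R}^4-V$ containing the interior of $H$). The geodesic perpendicular to $P$ in the direction of $\mathbf{x}$ is the geodesic meeting $P$ at a right angle and having $[\mathbf{x}]$ as an ideal endpoint. The signed distance from a point to a horoball $B$ is the distance to $\partial B$, positive outside $B$ and negative inside. The signed distance from a plane to $B$ is the minimum over points of the plane of the signed distance to $B$. The signed distance between two horoballs with distinct ideal points is the minimum of the signed distance to one over points of the boundary of the other (negative if they overlap). Partially truncated tetrahedron (one plane, three horoballs). With the data of the claim, let $\widehat P_1$ be the unique plane whose ideal boundary contains $\mathbf{x}_2,\mathbf{x}_3,\mathbf{x}_4$, and for $i\in\{2,3,4\}$ let $\widehat P_i$ be the unique plane meeting $P_1$ at right angles whose ideal boundary contains $\mathbf{x}_j$ for each $j\in\{2,3,4\}$, $j\neq i$. If $\widehat P_1$ does not meet $P_1$ orthogonally, then $\Delta=H_1\cap\left(\bigcap_{i=1}^4\widehat H_i\right)$, where $\widehat H_1$ is the half-space bounded by $\widehat P_1$ that contains the geodesic rays from $P_1$, perpendicular to $P_1$, in the direction of each $\mathbf{x}_j$; and for $i>1$, $\widehat H_i$ is the half-space bounded by $\widehat P_i$ that contains the geodesic perpendicular to $P_1$ in the direction of $\mathbf{x}_i$ and the geodesics joining $\mathbf{x}_i$ to $\mathbf{x}_j$ for $j>1$, $j\ne i$. If $\widehat P_1$ meets $P_1$ orthogonally, all $\widehat P_i$ equal a single plane $\widehat P$; after renumbering so that the perpendicular geodesic to $P_1$ in the direction of $\mathbf{x}_3$ separates $\mathbf{x}_2$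 from $\mathbf{x}_4$, the (degenerate) $\Delta$ is $\widehat P\cap H_1\cap h_{12}\cap h_{23}\cap h_{34}\cap h_{14}$, where $h_{12}$ is the half-plane of $\widehat P$ bounded by the perpendicular geodesic to $P_1$ in the direction of $\mathbf{x}_2$ and having $\mathbf{x}_3,\mathbf{x}_4$ in its ideal boundary, and so on (for $h_{23}$, $h_{34}$ one uses the geodesic joining the two ideal points, and the half-plane containing the other two objects among $P_1\cap\widehat P$ and the $[\mathbf{x}_j]$). Edges: for $j>1$, $\lambda_{1j}$ is the geodesic ray from $P_1$, perpendicular to $P_1$, in the direction of $\mathbf{x}_j$; for $1<i<j$, $\lambda_{ij}$ is the geodesic joining $\mathbf{x}_i$ to $\mathbf{x}_j$. The edge opposite $\lambda_{12}$ is $\lambda_{34}$. The transversal of $\Delta$ joining an edge to its opposite is the shortest geodesic arc with one endpoint on each edge, or their point of intersection if they intersect (length $0$); here the transversal length in question is that joining $\lambda_{12}$ to $\lambda_{34}$. *)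

theory Defs
  imports "HOL-Analysis.Analysis"
begin

section \<open>Hyperboloid model\<close>

definition lorentz :: "real^4 \<Rightarrow> real^4 \<Rightarrow> real" (infixl "\<odot>" 70) where
  "x \<odot> y = - (x$1 * y$1) + x$2 * y$2 + x$3 * y$3 + x$4 * y$4"

definition light_like :: "real^4 \<Rightarrow> bool" where
  "light_like x \<longleftrightarrow> x \<noteq> 0 \<and> x \<odot> x = 0"

definition time_like :: "real^4 \<Rightarrow> bool" where
  "time_like x \<longleftrightarrow> x \<odot> x < 0"

definition positive_vec :: "real^4 \<Rightarrow> bool" where
  "positive_vec x \<longleftrightarrow> 0 < x$1"

definition pos_light :: "real^4 \<Rightarrow> bool" where
  "pos_light x \<longleftrightarrow> positive_vec x \<and> light_like x"

definition H3 :: "(real^4) set" where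
  "H3 = {x. positive_vec x \<and> x \<odot> x = -1}"

definition dH :: "real^4 \<Rightarrow> real^4 \<Rightarrow> real" where
  "dH u v = arcosh (- (u \<odot> v))"

definition horosphere :: "real^4 \<Rightarrow> (real^4) set" where
  "horosphere x = {v \<in> H3. v \<odot> x = -1}"

definition horoball :: "real^4 \<Rightarrow> (real^4) set" where
  "horoball x = {v \<in> H3. v \<odot> x \<ge> -1}"

section \<open>Planes, geodesics and the pieces they cut off\<close>

definition is_plane :: "(real^4) set \<Rightarrow> bool" where
  "is_plane P \<longleftrightarrow> (\<exists>V. subspace V \<and> dim V = 3 \<and> (\<exists>v\<in>V. time_like v) \<and> P = V \<inter> H3)"

definition is_geodesic :: "(real^4) set \<Rightarrow> bool" where
  "is_geodesic L \<longleftrightarrow> (\<exists>W. subspace W \<and> dim W = 2 \<and> (\<exists>w\<in>W. time_like w) \<and> L = W \<inter> H3)"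

text \<open>The subspace that cuts out a plane or a geodesic is recovered from its set of points as the
  linear span. An ideal point is represented by any of the positive light-like vectors in its
  projective class.\<close>

definition ideal_boundary :: "(real^4) set \<Rightarrow> (real^4) set" where
  "ideal_boundary S = {x. pos_light x \<and> x \<in> span S}"

text \<open>\<open>is_half A B H\<close> says that \<open>H\<close> is one of the two closed halves into which \<open>B\<close> divides \<open>A\<close>: a
  half-space for \<open>A = H3\<close> and a plane \<open>B\<close>, a half-plane for a plane \<open>A\<close> and a geodesic \<open>B\<close> in it.
  The set \<open>A\<close> is closed in \<open>\<real>\<^sup>4\<close>, so the closure may be taken in \<open>\<real>\<^sup>4\<close>.\<close>

definition is_half :: "(real^4) set \<Rightarrow> (real^4) set \<Rightarrow> (real^4) set \<Rightarrow> bool" where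
  "is_half A B H \<longleftrightarrow> (\<exists>C \<in> components (A - B). H = closure C)"

text \<open>The interior of such a half \<open>H\<close> is \<open>H - B\<close>; note that \<open>span H3\<close> is the whole of \<open>\<real>\<^sup>4\<close>.\<close>

definition half_ideal_boundary :: "(real^4) set \<Rightarrow> (real^4) set \<Rightarrow> (real^4) set \<Rightarrow> (real^4) set" where
  "half_ideal_boundary A B H =
     {x. pos_light x \<and> (\<exists>K \<in> components (span A - span B). H - B \<subseteq> K \<and> x \<in> closure K)}"

text \<open>The dihedral angle is measured by the normals, the angle between a geodesic and a plane at a
  common point \<open>p\<close> by the tangent vectors, which are the vectors Lorentz orthogonal to \<open>p\<close>.\<close>

definition planes_orthogonal :: "(real^4) set \<Rightarrow> (real^4) set \<Rightarrow> bool" where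
  "planes_orthogonal P Q \<longleftrightarrow> P \<inter> Q \<noteq> {} \<and>
     (\<forall>m n. (\<forall>v \<in> span P. m \<odot> v = 0) \<longrightarrow> (\<forall>v \<in> span Q. n \<odot> v = 0) \<longrightarrow> m \<odot> n = 0)"

definition meets_perpendicularly :: "(real^4) set \<Rightarrow> (real^4) set \<Rightarrow> bool" where
  "meets_perpendicularly L P \<longleftrightarrow> L \<inter> P \<noteq> {} \<and>
     (\<forall>p \<in> L \<inter> P. \<forall>w \<in> span L. \<forall>v \<in> span P. w \<odot> p = 0 \<longrightarrow> v \<odot> p = 0 \<longrightarrow> w \<odot> v = 0)"

definition perp_geodesic :: "(real^4) set \<Rightarrow> real^4 \<Rightarrow> (real^4) set" where
  "perp_geodesic P x = (THE L. is_geodesic L \<and> meets_perpendicularly L P \<and> x \<in> ideal_boundary L)"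

definition geodesic_joining :: "real^4 \<Rightarrow> real^4 \<Rightarrow> (real^4) set" where
  "geodesic_joining x y = (THE L. is_geodesic L \<and> x \<in> ideal_boundary L \<and> y \<in> ideal_boundary L)"

definition geodesic_ray :: "real^4 \<Rightarrow> real^4 \<Rightarrow> (real^4) set" where
  "geodesic_ray p x = {v \<in> H3. \<exists>\<alpha> \<beta>. 0 \<le> \<alpha> \<and> 0 \<le> \<beta> \<and> v = \<alpha> *\<^sub>R p + \<beta> *\<^sub>R x}"

definition perp_ray :: "(real^4) set \<Rightarrow> real^4 \<Rightarrow> (real^4) set" where
  "perp_ray P x = (\<Union>p \<in> P \<inter> perp_geodesic P x. geodesic_ray p x)"

text \<open>For a geodesic line, arclength along the line is the hyperbolic distance.\<close>

definition arclength_param :: "(real \<Rightarrow> real^4) \<Rightarrow> (real^4) set \<Rightarrow> bool" where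
  "arclength_param \<gamma> L \<longleftrightarrow> range \<gamma> = L \<and> (\<forall>s t. dH (\<gamma> s) (\<gamma> t) = \<bar>s - t\<bar>)"

section \<open>Signed distances\<close>

text \<open>A horoball is given by its positive light-like vector. \<open>LEAST\<close> on reals is the minimum of a
  set, when it has one.\<close>

definition signed_dist_point :: "real^4 \<Rightarrow> real^4 \<Rightarrow> real" where
  "signed_dist_point v x =
     (let \<delta> = (INF u \<in> horosphere x. dH v u) in if v \<in> horoball x then - \<delta> else \<delta>)"

definition signed_dist_plane :: "(real^4) set \<Rightarrow> real^4 \<Rightarrow> real" where
  "signed_dist_plane P x = (LEAST h. \<exists>v \<in> P. h = signed_dist_point v x)"

definition signed_dist_horoballs :: "real^4 \<Rightarrow> real^4 \<Rightarrow> real" where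
  "signed_dist_horoballs x y = (LEAST h. \<exists>v \<in> horosphere x. h = signed_dist_point v y)"

section \<open>Partially truncated tetrahedra\<close>

definition lin_indep_pair :: "real^4 \<Rightarrow> real^4 \<Rightarrow> bool" where
  "lin_indep_pair x y \<longleftrightarrow> x \<noteq> y \<and> independent {x, y}"

definition truncated_data ::
    "(real^4) set \<Rightarrow> (real^4) set \<Rightarrow> real^4 \<Rightarrow> real^4 \<Rightarrow> real^4 \<Rightarrow> bool" where
  "truncated_data P1 H1 x2 x3 x4 \<longleftrightarrow>
     is_plane P1 \<and> is_half H3 P1 H1 \<and>
     pos_light x2 \<and> pos_light x3 \<and> pos_light x4 \<and>
     lin_indep_pair x2 x3 \<and> lin_indep_pair x2 x4 \<and> lin_indep_pair x3 x4 \<and>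
     {x2, x3, x4} \<subseteq> half_ideal_boundary H3 P1 H1 - ideal_boundary P1"

definition ideal_face_plane :: "real^4 \<Rightarrow> real^4 \<Rightarrow> real^4 \<Rightarrow> (real^4) set" where
  "ideal_face_plane x2 x3 x4 = (THE P. is_plane P \<and> {x2, x3, x4} \<subseteq> ideal_boundary P)"

definition ortho_face_plane :: "(real^4) set \<Rightarrow> real^4 \<Rightarrow> real^4 \<Rightarrow> (real^4) set" where
  "ortho_face_plane P1 x y =
     (THE P. is_plane P \<and> planes_orthogonal P P1 \<and> {x, y} \<subseteq> ideal_boundary P)"

definition ideal_face_half ::
    "(real^4) set \<Rightarrow> real^4 \<Rightarrow> real^4 \<Rightarrow> real^4 \<Rightarrow> (real^4) set" where
  "ideal_face_half P1 x2 x3 x4 =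
     (THE H. is_half H3 (ideal_face_plane x2 x3 x4) H \<and>
        perp_ray P1 x2 \<subseteq> H \<and> perp_ray P1 x3 \<subseteq> H \<and> perp_ray P1 x4 \<subseteq> H)"

text \<open>The half-space opposite the vertex \<open>x\<close>, where \<open>y\<close> and \<open>z\<close> are the other two ideal vertices.\<close>

definition ortho_face_half ::
    "(real^4) set \<Rightarrow> real^4 \<Rightarrow> real^4 \<Rightarrow> real^4 \<Rightarrow> (real^4) set" where
  "ortho_face_half P1 x y z =
     (THE H. is_half H3 (ortho_face_plane P1 y z) H \<and>
        perp_geodesic P1 x \<subseteq> H \<and> geodesic_joining x y \<subseteq> H \<and> geodesic_joining x z \<subseteq> H)"

text \<open>The half-plane of \<open>P\<close> bounded by the perpendicular to \<open>P1\<close> towards \<open>x\<close>, on the side of \<open>y\<close>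
  and \<open>z\<close>; and the one bounded by the geodesic joining \<open>x\<close> to \<open>y\<close>, on the side of \<open>P1 \<inter> P\<close> and
  \<open>z\<close>.\<close>

definition perp_half_plane ::
    "(real^4) set \<Rightarrow> (real^4) set \<Rightarrow> real^4 \<Rightarrow> real^4 \<Rightarrow> real^4 \<Rightarrow> (real^4) set" where
  "perp_half_plane P P1 x y z =
     (THE h. is_half P (perp_geodesic P1 x) h \<and>
        {y, z} \<subseteq> half_ideal_boundary P (perp_geodesic P1 x) h)"

definition joining_half_plane ::
    "(real^4) set \<Rightarrow> (real^4) set \<Rightarrow> real^4 \<Rightarrow> real^4 \<Rightarrow> real^4 \<Rightarrow> (real^4) set" where
  "joining_half_plane P P1 x y z =
     (THE h. is_half P (geodesic_joining x y) h \<and> P1 \<inter> P \<subseteq> h \<and>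
        z \<in> half_ideal_boundary P (geodesic_joining x y) h)"

definition separates ::
    "(real^4) set \<Rightarrow> (real^4) set \<Rightarrow> real^4 \<Rightarrow> real^4 \<Rightarrow> bool" where
  "separates P L x y \<longleftrightarrow>
     (\<exists>h h'. is_half P L h \<and> is_half P L h' \<and> h \<noteq> h' \<and>
        x \<in> half_ideal_boundary P L h - ideal_boundary L \<and>
        y \<in> half_ideal_boundary P L h' - ideal_boundary L)"

text \<open>The degenerate case, numbered such that the perpendicular towards \<open>x3\<close> separates \<open>x2\<close> from
  \<open>x4\<close>.\<close>

definition degenerate_tetrahedron ::
    "(real^4) set \<Rightarrow> (real^4) set \<Rightarrow> real^4 \<Rightarrow> real^4 \<Rightarrow> real^4 \<Rightarrow> (real^4) set" where
  "degenerate_tetrahedron P1 H1 x2 x3 x4 =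
     (let P = ideal_face_plane x2 x3 x4 in
        P \<inter> H1 \<inter> perp_half_plane P P1 x2 x3 x4 \<inter> joining_half_plane P P1 x2 x3 x4
          \<inter> joining_half_plane P P1 x3 x4 x2 \<inter> perp_half_plane P P1 x4 x2 x3)"

text \<open>In the degenerate case exactly one of the three ideal vertices is the middle one, and
  exchanging the other two does not change \<open>degenerate_tetrahedron\<close>; the three branches are the
  possible renumberings.\<close>

definition truncated_tetrahedron ::
    "(real^4) set \<Rightarrow> (real^4) set \<Rightarrow> real^4 \<Rightarrow> real^4 \<Rightarrow> real^4 \<Rightarrow> (real^4) set" where
  "truncated_tetrahedron P1 H1 x2 x3 x4 =
     (let P = ideal_face_plane x2 x3 x4 in
      if \<not> planes_orthogonal P P1 then
        H1 \<inter> ideal_face_half P1 x2 x3 x4 \<inter> ortho_face_half P1 x2 x3 x4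
          \<inter> ortho_face_half P1 x3 x2 x4 \<inter> ortho_face_half P1 x4 x2 x3
      else if separates P (perp_geodesic P1 x3) x2 x4 then degenerate_tetrahedron P1 H1 x2 x3 x4
      else if separates P (perp_geodesic P1 x2) x3 x4 then degenerate_tetrahedron P1 H1 x3 x2 x4
      else degenerate_tetrahedron P1 H1 x2 x4 x3)"

section \<open>Transversals\<close>

text \<open>A geodesic arc is determined by its endpoints \<open>p\<close>, \<open>q\<close> and has length \<open>dH p q\<close>; the arc
  degenerates to a point when the edges intersect.\<close>

definition is_transversal ::
    "(real^4) set \<Rightarrow> (real^4) set \<Rightarrow> real^4 \<Rightarrow> real^4 \<Rightarrow> bool" where
  "is_transversal E F p q \<longleftrightarrow> p \<in> E \<and> q \<in> F \<and> (\<forall>p' \<in> E. \<forall>q' \<in> F. dH p q \<le> dH p' q')"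

definition transversal_length :: "(real^4) set \<Rightarrow> (real^4) set \<Rightarrow> real" where
  "transversal_length E F = (THE l. \<exists>p q. is_transversal E F p q \<and> l = dH p q)"

definition dist_cosh :: "(real \<Rightarrow> real^4) \<Rightarrow> (real \<Rightarrow> real^4) \<Rightarrow> real \<times> real \<Rightarrow> real" where
  "dist_cosh \<gamma> \<gamma>' = (\<lambda>(s, t). cosh (dH (\<gamma> s) (\<gamma>' t)))"

definition critical_point :: "(real \<times> real \<Rightarrow> real) \<Rightarrow> real \<times> real \<Rightarrow> bool" where
  "critical_point f z \<longleftrightarrow> (f has_derivative (\<lambda>_. 0)) (at z)"

text \<open>The exponentiated signed distances \<open>x, y, a, b, c, d\<close>, and the set of the tuples of parameters
  that arise: this is the domain of the transversal length as a function of them. It is a proper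
  subset of the tuples of positive reals.\<close>

definition has_params ::
    "(real^4) set \<Rightarrow> real^4 \<Rightarrow> real^4 \<Rightarrow> real^4 \<Rightarrow> real \<Rightarrow> real \<Rightarrow> real \<Rightarrow> real \<Rightarrow> real \<Rightarrow> real \<Rightarrow> bool" where
  "has_params P1 x2 x3 x4 x y a b c d \<longleftrightarrow>
     x = exp (signed_dist_plane P1 x2) \<and> y = exp (signed_dist_horoballs x3 x4) \<and>
     a = exp (signed_dist_plane P1 x3) \<and> b = exp (signed_dist_plane P1 x4) \<and>
     c = exp (signed_dist_horoballs x2 x3) \<and> d = exp (signed_dist_horoballs x2 x4)"

definition realizable :: "real \<Rightarrow> real \<Rightarrow> real \<Rightarrow> real \<Rightarrow> real \<Rightarrow> real \<Rightarrow> bool" where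
  "realizable x y a b c d \<longleftrightarrow>
     (\<exists>P1 H1 x2 x3 x4. truncated_data P1 H1 x2 x3 x4 \<and> has_params P1 x2 x3 x4 x y a b c d)"

end

theory Submission imports Defs begin

text \<open>Write \<open>P1\<close> as the orthogonal complement of a unit normal \<open>n\<close> with \<open>n \<odot> xj > 0\<close>; the exponentiated
  signed distances are then \<open>n \<odot> xj\<close> and \<open>- (xi \<odot> xj) / 2\<close>. A geodesic with null endpoints \<open>u\<close>, \<open>w\<close>
  normalized by \<open>u \<odot> w = - 1 / 2\<close> is \<open>t \<mapsto> exp t u + exp (- t) w\<close>, so \<open>D(s,t)\<close> is a positive combination
  of \<open>exp (\<plusminus>(s + t))\<close> and \<open>exp (\<plusminus>(s - t))\<close>. AM-GM in the independent variables \<open>s + t\<close> and \<open>s - t\<close> gives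
  the unique critical point, the minimum and the formula. At the minimum the point on the edge from \<open>P1\<close> lies on
  the side of \<open>x2\<close>, so both endpoints of the transversal lie in \<open>H1\<close>
  and are combinations of \<open>x2, x3, x4, - n\<close> with nonnegative coefficients; every other half-space in the
  definition of the tetrahedron is cut out by a linear form that is nonnegative on these four vectors.\<close>

section \<open>The Lorentz form\<close>

text \<open>Most of the work comes from the definitions: planes, geodesics, halves and faces are
  given by \<open>THE\<close>, \<open>LEAST\<close>, components and closures, and each has to become
  a linear equation or inequality. The tool is the radial projection of the convex future cone onto
  \<open>H3\<close>: it keeps the sign of a linear form, so each side of a cut is connected, there
  are exactly two halves, and a point strictly on one side decides between them. If the plane
  through the ideal vertices is orthogonal to \<open>P1\<close>, the span of x2, x3, x4 contains n
  and no face form separates a vertex from the others; the degenerate tetrahedron therefore needs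
  forms inside that plane. The minimizing point of the perpendicular is on the side of x2 because
  the other endpoint is the mirror image of x2 in \<open>P1\<close>, which pairs more negatively
  with x3 and x4. Hence the minimum over the whole perpendicular is also the minimum over the ray,
  which is the actual edge. Comparing values of \<open>arcosh\<close> needs arguments at least 1.
  The formula does not show this bound; a configuration realizing the parameters does.\<close>

lemma lorentz_commute: "x \<odot> y = y \<odot> x"
  by (simp add: lorentz_def)

lemma lorentz_simps [simp]:
  "(x + y) \<odot> z = x \<odot> z + y \<odot> z" "z \<odot> (x + y) = z \<odot> x + z \<odot> y"
  "(x - y) \<odot> z = x \<odot> z - y \<odot> z" "z \<odot> (x - y) = z \<odot> x - z \<odot> y"
  "(r *\<^sub>R x) \<odot> z = r * (x \<odot> z)" "z \<odot> (r *\<^sub>R x) = r * (z \<odot> x)"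
  "(- x) \<odot> z = - (x \<odot> z)" "z \<odot> (- x) = - (z \<odot> x)"
  "0 \<odot> z = 0" "z \<odot> 0 = 0"
  by (simp_all add: lorentz_def algebra_simps)

lemma linear_lorentz: "linear (\<lambda>v. m \<odot> v)"
  by (rule linearI) simp_all

text \<open>The reflection that turns the Lorentz form into the Euclidean inner product; through it
  the dimension of hyperplanes and the existence of normals come from the Euclidean theory.\<close>

definition time_reversal :: "real^4 \<Rightarrow> real^4" where
  "time_reversal x = x - (2 * x$1) *\<^sub>R axis 1 1"

lemma lorentz_inner: "x \<odot> y = time_reversal x \<bullet> y"
  by (simp add: lorentz_def time_reversal_def inner_vec_def sum_4 axis_def)

lemma time_reversal_0_iff: "time_reversal x = 0 \<longleftrightarrow> x = 0"
  by (auto simp: time_reversal_def vec_eq_iff forall_4 axis_def)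

lemma time_reversal_involution: "time_reversal (time_reversal x) = x"
  by (simp add: time_reversal_def vec_eq_iff forall_4 axis_def)

lemma inner_lorentz: "x \<bullet> y = time_reversal x \<odot> y"
  by (simp add: lorentz_inner time_reversal_involution)

lemma continuous_on_lorentz [continuous_intros]:
  "continuous_on S f \<Longrightarrow> continuous_on S g \<Longrightarrow> continuous_on S (\<lambda>x. f x \<odot> g x)"
  unfolding lorentz_def by (intro continuous_intros)

text \<open>Lagrange's identity: the defect is the squared length of the cross product of the
  spatial parts.\<close>

lemma spatial_Cauchy_Schwarz:
  fixes u w :: "real^4"
  shows "(u$2 * w$2 + u$3 * w$3 + u$4 * w$4)\<^sup>2 \<le>
     ((u$2)\<^sup>2 + (u$3)\<^sup>2 + (u$4)\<^sup>2) * ((w$2)\<^sup>2 + (w$3)\<^sup>2 + (w$4)\<^sup>2)"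
proof -
  have "((u$2)\<^sup>2 + (u$3)\<^sup>2 + (u$4)\<^sup>2) * ((w$2)\<^sup>2 + (w$3)\<^sup>2 + (w$4)\<^sup>2) -
      (u$2 * w$2 + u$3 * w$3 + u$4 * w$4)\<^sup>2 =
      (u$2 * w$3 - u$3 * w$2)\<^sup>2 + (u$2 * w$4 - u$4 * w$2)\<^sup>2 + (u$3 * w$4 - u$4 * w$3)\<^sup>2"
    by (simp add: power2_eq_square algebra_simps)
  then show ?thesis
    by (smt (verit) zero_le_power2)
qed

lemma lorentz_self: "x \<odot> x = (x$2)\<^sup>2 + (x$3)\<^sup>2 + (x$4)\<^sup>2 - (x$1)\<^sup>2"
  by (simp add: lorentz_def power2_eq_square)

lemma first_entry_nonzero:
  assumes "x \<odot> x \<le> 0" "x \<noteq> 0" shows "x$1 \<noteq> 0"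
proof
  assume "x$1 = 0"
  with assms(1) have "(x$2)\<^sup>2 + (x$3)\<^sup>2 + (x$4)\<^sup>2 \<le> 0" by (simp add: lorentz_self)
  then have "(x$2)\<^sup>2 = 0 \<and> (x$3)\<^sup>2 = 0 \<and> (x$4)\<^sup>2 = 0"
    using zero_le_power2[of "x$2"] zero_le_power2[of "x$3"] zero_le_power2[of "x$4"] by linarith
  with \<open>x$1 = 0\<close> assms(2) show False by (simp add: vec_eq_iff forall_4)
qed

text \<open>Orthogonality turns the product of the first entries into the spatial product, and
  Cauchy-Schwarz then bounds the first entry of w. The distance estimates below rest on this: a
  vector orthogonal to a point or to a light-like vector has nonnegative square.\<close>

lemma orthogonal_to_causal:
  assumes "x \<odot> x \<le> 0" "x \<noteq> 0" "x \<odot> w = 0"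
  shows "w \<odot> w \<ge> 0"
proof -
  let ?X = "(x$2)\<^sup>2 + (x$3)\<^sup>2 + (x$4)\<^sup>2" and ?W = "(w$2)\<^sup>2 + (w$3)\<^sup>2 + (w$4)\<^sup>2"
  have "x$1 * w$1 = x$2 * w$2 + x$3 * w$3 + x$4 * w$4"
    using assms(3) by (simp add: lorentz_def)
  then have "(x$1)\<^sup>2 * (w$1)\<^sup>2 \<le> ?X * ?W"
    using spatial_Cauchy_Schwarz[of x w] by (metis power_mult_distrib)
  also have "\<dots> \<le> (x$1)\<^sup>2 * ?W"
    using assms(1) by (intro mult_right_mono) (auto simp: lorentz_self)
  finally have "(w$1)\<^sup>2 \<le> ?W"
    using first_entry_nonzero[OF assms(1,2)] by simp
  then show ?thesis by (simp add: lorentz_self)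
qed

lemma orthogonal_to_timelike:
  assumes "x \<odot> x < 0" "x \<odot> w = 0" "w \<noteq> 0"
  shows "w \<odot> w > 0"
proof (rule ccontr)
  assume "\<not> w \<odot> w > 0"
  then have "w \<odot> w \<le> 0" by simp
  then have "x \<odot> x \<ge> 0"
    using orthogonal_to_causal[of w x] assms(2,3) by (simp add: lorentz_commute)
  with assms(1) show False by simp
qed

lemma lorentz_neg_of_positive:
  assumes "u \<odot> u \<le> 0" "v \<odot> v < 0" "0 < u$1" "0 < v$1"
  shows "u \<odot> v < 0"
proof -
  let ?U = "(u$2)\<^sup>2 + (u$3)\<^sup>2 + (u$4)\<^sup>2" and ?V = "(v$2)\<^sup>2 + (v$3)\<^sup>2 + (v$4)\<^sup>2"
  have "(u$2 * v$2 + u$3 * v$3 + u$4 * v$4)\<^sup>2 \<le> ?U * ?V"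
    by (rule spatial_Cauchy_Schwarz)
  also have "\<dots> \<le> (u$1)\<^sup>2 * ?V"
    using assms(1) by (intro mult_right_mono) (auto simp: lorentz_self)
  also have "\<dots> < (u$1)\<^sup>2 * (v$1)\<^sup>2"
    using assms(2,3) by (intro mult_strict_left_mono) (auto simp: lorentz_self)
  finally have "(u$2 * v$2 + u$3 * v$3 + u$4 * v$4)\<^sup>2 < (u$1 * v$1)\<^sup>2"
    by (simp add: power_mult_distrib)
  then have "u$2 * v$2 + u$3 * v$3 + u$4 * v$4 < u$1 * v$1"
    by (rule power2_less_imp_less) (use assms in simp)
  then show ?thesis by (simp add: lorentz_def)
qed

lemma pos_lightD:
  assumes "pos_light x" shows "0 < x$1" "x \<odot> x = 0" "x \<noteq> 0"
  using assms by (auto simp: pos_light_def light_like_def positive_vec_def)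

lemma pos_lightI: "0 < x$1 \<Longrightarrow> x \<odot> x = 0 \<Longrightarrow> pos_light x"
  by (auto simp: pos_light_def light_like_def positive_vec_def)

lemma H3D:
  assumes "v \<in> H3" shows "0 < v$1" "v \<odot> v = - 1" "v \<noteq> 0"
  using assms by (auto simp: H3_def positive_vec_def)

lemma H3I: "0 < v$1 \<Longrightarrow> v \<odot> v = - 1 \<Longrightarrow> v \<in> H3"
  by (auto simp: H3_def positive_vec_def)

lemma lorentz_H3_light_neg: "v \<in> H3 \<Longrightarrow> pos_light x \<Longrightarrow> v \<odot> x < 0"
  using lorentz_neg_of_positive[of x v] pos_lightD[of x] H3D[of v] by (simp add: lorentz_commute)

lemma lorentz_H3_le:
  assumes "u \<in> H3" "v \<in> H3" shows "u \<odot> v \<le> - 1"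
proof -
  \<comment> \<open>The component of v orthogonal to u; the sign is plus because
    \<open>u \<odot> u = - 1\<close>.\<close>
  define w where "w = v + (u \<odot> v) *\<^sub>R u"
  have neg: "u \<odot> v < 0"
    using lorentz_neg_of_positive[of u v] H3D assms by simp
  have "w \<odot> w \<ge> 0"
    by (rule orthogonal_to_causal[of u]) (use H3D assms in \<open>auto simp: w_def\<close>)
  moreover have "w \<odot> w = (u \<odot> v)\<^sup>2 - 1"
    using H3D assms by (simp add: w_def lorentz_commute power2_eq_square algebra_simps)
  ultimately have "1\<^sup>2 \<le> (- (u \<odot> v))\<^sup>2" by simp
  then have "1 \<le> - (u \<odot> v)"
    by (rule power2_le_imp_le) (use neg in simp)
  then show ?thesis by simp
qed

lemma cosh_dH: "u \<in> H3 \<Longrightarrow> v \<in> H3 \<Longrightarrow> cosh (dH u v) = - (u \<odot> v)"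
  unfolding dH_def using lorentz_H3_le[of u v] by (simp add: cosh_arcosh_real)

lemma positive_if_lorentz_neg:
  assumes "v \<odot> v \<le> 0" "v \<noteq> 0" "w \<in> H3" "w \<odot> v < 0"
  shows "0 < v$1"
proof (rule ccontr)
  assume "\<not> 0 < v$1"
  then have "0 < (- v)$1" using first_entry_nonzero[OF assms(1,2)] by simp
  then have "(- v) \<odot> w < 0"
    using lorentz_neg_of_positive[of "- v" w] H3D[OF assms(3)] assms(1) by simp
  with assms(4) show False by (simp add: lorentz_commute)
qed

text \<open>One of v and - v lies in \<open>H3\<close>, and points of \<open>H3\<close> pair
  negatively with x; so the pairing fixes the sign without a look at the first entry.\<close>

lemma H3_if_lorentz_light_neg:
  assumes "v \<odot> v = - 1" "pos_light x" "v \<odot> x < 0"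
  shows "v \<in> H3"
proof -
  have "v \<noteq> 0" using assms(1) by auto
  have "\<not> v$1 < 0"
  proof
    assume "v$1 < 0"
    then have "- v \<in> H3" using assms(1) by (intro H3I) auto
    from lorentz_H3_light_neg[OF this assms(2)] assms(3) show False by simp
  qed
  with first_entry_nonzero[of v] \<open>v \<noteq> 0\<close> assms(1) show ?thesis
    by (intro H3I) auto
qed

lemma lorentz_light_light_nonpos:
  assumes "pos_light x" "pos_light y" shows "x \<odot> y \<le> 0"
proof -
  let ?X = "(x$2)\<^sup>2 + (x$3)\<^sup>2 + (x$4)\<^sup>2" and ?Y = "(y$2)\<^sup>2 + (y$3)\<^sup>2 + (y$4)\<^sup>2"
  have "(x$2 * y$2 + x$3 * y$3 + x$4 * y$4)\<^sup>2 \<le> ?X * ?Y"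
    by (rule spatial_Cauchy_Schwarz)
  also have "\<dots> = (x$1 * y$1)\<^sup>2"
    using pos_lightD[OF assms(1)] pos_lightD[OF assms(2)] by (simp add: lorentz_self power_mult_distrib)
  finally have "x$2 * y$2 + x$3 * y$3 + x$4 * y$4 \<le> x$1 * y$1"
    by (rule power2_le_imp_le) (use pos_lightD assms in \<open>simp add: less_imp_le\<close>)
  then show ?thesis by (simp add: lorentz_def)
qed

lemma lorentz_light_light_neg:
  assumes "pos_light x" "pos_light y" "lin_indep_pair x y"
  shows "x \<odot> y < 0"
proof (rule ccontr)
  assume "\<not> x \<odot> y < 0"
  with lorentz_light_light_nonpos[OF assms(1,2)] have 0: "x \<odot> y = 0" by simp
  \<comment> \<open>Equality case: subtracting a multiple of x removes the first entry, and a null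
    vector with first entry 0 vanishes, so y would be a multiple of x.\<close>
  define w where "w = y - (y$1 / x$1) *\<^sub>R x"
  have "w$1 = 0" using pos_lightD[OF assms(1)] by (simp add: w_def)
  moreover have "w \<odot> w = 0"
    using pos_lightD[OF assms(1)] pos_lightD[OF assms(2)] 0 by (simp add: w_def lorentz_commute)
  ultimately have "w = 0" using first_entry_nonzero[of w] by auto
  then have "y = (y$1 / x$1) *\<^sub>R x" by (simp add: w_def)
  then have "y \<in> span {x}" by (metis span_base span_scale singletonI)
  with assms(3) show False
    unfolding lin_indep_pair_def by (metis insert_commute independent_insert singletonD)
qed

section \<open>The future cone and its radial projection onto the hyperboloid\<close>

definition future_cone :: "(real^4) set" where
  "future_cone = {v. 0 < v$1 \<and> v \<odot> v < 0}"

definition normalize_H3 :: "real^4 \<Rightarrow> real^4" where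
  "normalize_H3 v = (1 / sqrt (- (v \<odot> v))) *\<^sub>R v"

lemma H3_subset_future_cone: "H3 \<subseteq> future_cone"
  by (auto simp: H3_def future_cone_def positive_vec_def)

lemma normalize_H3_in: "v \<in> future_cone \<Longrightarrow> normalize_H3 v \<in> H3"
  by (intro H3I) (auto simp: normalize_H3_def future_cone_def real_sqrt_mult[symmetric] divide_simps)

lemma normalize_H3_id: "v \<in> H3 \<Longrightarrow> normalize_H3 v = v"
  using H3D[of v] by (simp add: normalize_H3_def)

lemma normalize_H3_cone:
  assumes "v \<in> future_cone" obtains r where "0 < r" "normalize_H3 v = r *\<^sub>R v"
  by (rule that[of "1 / sqrt (- (v \<odot> v))"])
    (use assms in \<open>auto simp: normalize_H3_def future_cone_def\<close>)

lemma continuous_on_normalize_H3: "continuous_on future_cone normalize_H3"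
  unfolding normalize_H3_def by (intro continuous_intros) (auto simp: future_cone_def)

lemma open_future_cone: "open future_cone"
  unfolding future_cone_def
  by (intro open_Collect_conj open_Collect_less continuous_intros)

text \<open>The mixed product is negative by \<open>lorentz_neg_of_positive\<close>, so all three
  terms of the square are nonpositive, and one is strictly negative because a and b are not both
  0.\<close>

lemma convex_future_cone: "convex future_cone"
proof (rule convexI)
  fix u v :: "real^4" and a b :: real
  assume uv: "u \<in> future_cone" "v \<in> future_cone" and ab: "0 \<le> a" "0 \<le> b" "a + b = 1"
  have *: "u \<odot> v < 0"
    using lorentz_neg_of_positive[of u v] uv by (simp add: future_cone_def)
  have "0 < (a *\<^sub>R u + b *\<^sub>R v)$1"
    using convexD_alt[OF convex_halfspace_gt[of 0 "axis 1 1 :: real^4"], of u v b] uv ab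
    by (simp add: future_cone_def inner_axis' inner_add_right) (metis add_diff_cancel_right')
  moreover have "(a *\<^sub>R u + b *\<^sub>R v) \<odot> (a *\<^sub>R u + b *\<^sub>R v) =
      a * a * (u \<odot> u) + 2 * (a * b) * (u \<odot> v) + b * b * (v \<odot> v)"
    by (simp add: lorentz_commute[of v u] algebra_simps)
  moreover have "a * a * (u \<odot> u) \<le> 0" "2 * (a * b) * (u \<odot> v) \<le> 0" "b * b * (v \<odot> v) \<le> 0"
    using uv ab * by (auto simp: future_cone_def mult_nonneg_nonpos)
  moreover have "a * a * (u \<odot> u) < 0 \<or> b * b * (v \<odot> v) < 0"
    using uv ab by (cases "a = 0") (auto simp: future_cone_def mult_pos_neg)
  ultimately show "a *\<^sub>R u + b *\<^sub>R v \<in> future_cone"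
    by (auto simp: future_cone_def)
qed

lemma perturb_future_cone:
  assumes "v \<in> H3"
  shows "\<forall>\<^sub>F e in at_right 0. v + e *\<^sub>R w \<in> future_cone"
proof -
  have "((\<lambda>e. v + e *\<^sub>R w) \<longlongrightarrow> v + 0 *\<^sub>R w) (at_right 0)"
    by (intro tendsto_intros)
  then have "((\<lambda>e. v + e *\<^sub>R w) \<longlongrightarrow> v) (at_right 0)" by simp
  then show ?thesis
    using open_future_cone assms H3_subset_future_cone by (auto dest: topological_tendstoD)
qed

text \<open>The cone is open, so v + e w stays in it for some e > 0 and its normalization lies in
  \<open>W \<inter> H3\<close>; w is a multiple of the difference from v. This is why the subspace
  of a plane or geodesic can be recovered as a span.\<close>

lemma span_subspace_H3:
  assumes W: "subspace W" and v: "v \<in> W" "v \<in> H3"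
  shows "span (W \<inter> H3) = W"
proof
  show "span (W \<inter> H3) \<subseteq> W" by (rule span_minimal) (use W in auto)
  show "W \<subseteq> span (W \<inter> H3)"
  proof
    fix w assume w: "w \<in> W"
    have "\<forall>\<^sub>F e in at_right (0::real). 0 < e \<and> v + e *\<^sub>R w \<in> future_cone"
      by (intro eventually_conj perturb_future_cone v) (simp add: eventually_at_right_less)
    then obtain e where e: "0 < e" "v + e *\<^sub>R w \<in> future_cone"
      using eventually_happens'[OF trivial_limit_at_right_real] by blast
    let ?u = "v + e *\<^sub>R w"
    obtain r where r: "0 < r" "normalize_H3 ?u = r *\<^sub>R ?u"
      using normalize_H3_cone[OF e(2)] .
    have "r *\<^sub>R ?u \<in> W" using W v w by (simp add: subspace_add subspace_scale)
    then have "r *\<^sub>R ?u \<in> W \<inter> H3" using normalize_H3_in[OF e(2)] r by simp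
    then have "(1 / r) *\<^sub>R r *\<^sub>R ?u \<in> span (W \<inter> H3)" by (intro span_scale span_base)
    then have "?u \<in> span (W \<inter> H3)" using r by simp
    moreover have "v \<in> span (W \<inter> H3)" using v by (simp add: span_base)
    ultimately have "?u - v \<in> span (W \<inter> H3)" by (rule span_diff)
    then have "(1 / e) *\<^sub>R (?u - v) \<in> span (W \<inter> H3)" by (rule span_scale)
    then show "w \<in> span (W \<inter> H3)" using e by simp
  qed
qed

lemma timelike_subspace_H3:
  assumes "subspace W" "w \<in> W" "time_like w"
  obtains v where "v \<in> W" "v \<in> H3"
proof -
  have "w \<noteq> 0" using assms(3) by (auto simp: time_like_def)
  have "w \<in> future_cone \<or> - w \<in> future_cone"
    using assms(3) first_entry_nonzero[of w] \<open>w \<noteq> 0\<close>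
    by (auto simp: time_like_def future_cone_def)
  then obtain u where u: "u \<in> W" "u \<in> future_cone"
    using assms subspace_neg[of W w] by blast
  show ?thesis
    using that[of "normalize_H3 u"] normalize_H3_in[OF u(2)] normalize_H3_cone[OF u(2)] u(1) assms(1)
    by (metis subspace_scale)
qed

lemma H3_time_like: "v \<in> H3 \<Longrightarrow> time_like v"
  by (simp add: time_like_def H3D)

section \<open>Halves cut off by a linear form\<close>

text \<open>Each piece is relatively open with relatively open complement, hence clopen in every
  connected set between it and S; so both pieces are maximal connected sets.\<close>

lemma components_two:
  assumes "X \<union> Y = S" "X \<inter> Y = {}" "connected X" "connected Y" "X \<noteq> {}" "Y \<noteq> {}"
    "openin (top_of_set S) X" "openin (top_of_set S) Y"
  shows "components S = {X, Y}"
proof -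
  have *: "X \<in> components S" if "X \<union> Y = S" "X \<inter> Y = {}" "connected X" "X \<noteq> {}"
    "openin (top_of_set S) X" "openin (top_of_set S) Y" for X Y
    unfolding in_components_maximal
  proof (intro conjI allI impI)
    fix d assume d: "d \<noteq> {} \<and> X \<subseteq> d \<and> d \<subseteq> S \<and> connected d"
    have X: "X = S - Y" using that by blast
    then have "closedin (top_of_set S) X"
      using that(6) by (simp add: closedin_def Diff_Diff_Int Int_absorb1 openin_imp_subset)
    then have "closedin (top_of_set d) X" "openin (top_of_set d) X"
      using d that(5) by (auto intro: closedin_subset_trans openin_subset_trans)
    then have "X = {} \<or> X = d" using d connected_clopen by blast
    then show "d = X" using that(4) by simp
  qed (use that in auto)
  have X: "X \<in> components S" using * assms by metis
  have Y: "Y \<in> components S" by (rule *[of Y X]) (use assms in auto)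
  have "C = X \<or> C = Y" if C: "C \<in> components S" for C
  proof -
    have "C \<noteq> {}" "C \<subseteq> X \<union> Y"
      using C in_components_nonempty in_components_subset assms(1) by blast+
    then have "C \<inter> X \<noteq> {} \<or> C \<inter> Y \<noteq> {}" by blast
    then show ?thesis using components_eq C X Y by metis
  qed
  with X Y show ?thesis by blast
qed

text \<open>The condition \<open>0 < v$1\<close> may be weakened to \<open>0 \<le> v$1\<close>,
  because a vector of square - 1 cannot have first entry 0; the weakened conditions are
  closed.\<close>

lemma closed_H3: "closed H3"
proof -
  have eq: "H3 = {v. 0 \<le> v$1} \<inter> {v. v \<odot> v = - 1}"
  proof (intro set_eqI iffI)
    fix v assume "v \<in> {v. 0 \<le> v$1} \<inter> {v. v \<odot> v = - 1}"
    moreover from this have "v$1 \<noteq> 0" by (intro first_entry_nonzero) auto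
    ultimately show "v \<in> H3" by (intro H3I) auto
  qed (auto dest: H3D)
  show ?thesis
    unfolding eq by (intro closed_Int closed_Collect_le closed_Collect_eq continuous_intros)
qed

text \<open>One setting for both kinds of halves: \<open>W = UNIV\<close> gives half-spaces, a
  3-dimensional W gives half-planes of \<open>W \<inter> H3\<close>. The point p keeps the zero set
  nonempty, w is a direction in which g grows, and \<open>opposite\<close> carries each fact to the
  negative side.\<close>

locale linear_cut =
  fixes W :: "(real^4) set" and g :: "real^4 \<Rightarrow> real" and p w :: "real^4"
  assumes W: "subspace W" and g: "linear g"
    and p: "p \<in> W" "p \<in> H3" "g p = 0" and w: "w \<in> W" "0 < g w"
begin

lemma opposite: "linear_cut W (\<lambda>v. - g v) p (- w)"
  using W p w linear_compose_neg[OF g] by (intro linear_cut.intro) (simp_all add: subspace_neg linear_neg[OF g])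

lemma cont: "continuous_on S g"
  using g by (simp add: linear_continuous_on linear_linear)

lemma closed_W: "closed W"
  using W by (rule closed_subspace)

lemma convex_positive: "convex {v. 0 < g v}"
proof -
  have "{v. 0 < g v} = g -` {0<..}" by auto
  then show ?thesis using convex_linear_vimage[OF g, of "{0<..}"] by simp
qed

text \<open>Normalization multiplies by a positive number and so preserves the sign of g; the set is
  thus a continuous image of an intersection of convex sets.\<close>

lemma connected_positive: "connected {v \<in> W \<inter> H3. 0 < g v}"
proof -
  let ?C = "W \<inter> future_cone \<inter> {v. 0 < g v}"
  have "normalize_H3 v \<in> {v \<in> W \<inter> H3. 0 < g v}" if v: "v \<in> ?C" for v
  proof -
    have vf: "v \<in> future_cone" using v by simp
    obtain r where r: "0 < r" "normalize_H3 v = r *\<^sub>R v" using normalize_H3_cone[OF vf] .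
    then have "normalize_H3 v \<in> W" "0 < g (normalize_H3 v)"
      using v W g by (auto simp: subspace_scale linear_cmul)
    then show ?thesis using normalize_H3_in[OF vf] by simp
  qed
  moreover have "v \<in> normalize_H3 ` ?C" if "v \<in> {v \<in> W \<inter> H3. 0 < g v}" for v
    using that H3_subset_future_cone normalize_H3_id[of v] by (intro image_eqI[of _ _ v]) auto
  ultimately have "{v \<in> W \<inter> H3. 0 < g v} = normalize_H3 ` ?C" by blast
  moreover have "connected (normalize_H3 ` ?C)"
    by (intro connected_continuous_image convex_connected convex_Int subspace_imp_convex W
        convex_future_cone convex_positive continuous_on_subset[OF continuous_on_normalize_H3]) auto
  ultimately show ?thesis by simp
qed

lemma closure_positive_H3: "closure {v \<in> W \<inter> H3. 0 < g v} = {v \<in> W \<inter> H3. 0 \<le> g v}"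
proof
  have "closed ((W \<inter> H3) \<inter> {v. 0 \<le> g v})"
    by (intro closed_Int closed_W closed_H3 closed_Collect_le cont continuous_on_const)
  then show "closure {v \<in> W \<inter> H3. 0 < g v} \<subseteq> {v \<in> W \<inter> H3. 0 \<le> g v}"
    by (intro closure_minimal) (auto simp: Int_def)
  show "{v \<in> W \<inter> H3. 0 \<le> g v} \<subseteq> closure {v \<in> W \<inter> H3. 0 < g v}"
  proof
    fix v assume v: "v \<in> {v \<in> W \<inter> H3. 0 \<le> g v}"
    show "v \<in> closure {v \<in> W \<inter> H3. 0 < g v}"
    proof (cases "g v = 0")
      case False
      then show ?thesis using v closure_subset by fastforce
    next
      case True
      \<comment> \<open>A boundary point is approached by the normalizations of v + e w, on which g
        is a positive multiple of \<open>e * g w\<close>.\<close>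
      have "((\<lambda>e. v + e *\<^sub>R w) \<longlongrightarrow> v + 0 *\<^sub>R w) (at_right 0)" by (intro tendsto_intros)
      moreover have "isCont normalize_H3 v"
        using continuous_on_normalize_H3 open_future_cone v H3_subset_future_cone
        by (auto simp: continuous_on_eq_continuous_at)
      ultimately have lim: "((\<lambda>e. normalize_H3 (v + e *\<^sub>R w)) \<longlongrightarrow> v) (at_right 0)"
        using isCont_tendsto_compose[of v normalize_H3] v normalize_H3_id[of v] by simp
      have "\<forall>\<^sub>F e in at_right (0::real). 0 < e \<and> v + e *\<^sub>R w \<in> future_cone"
        using v by (intro eventually_conj perturb_future_cone) (auto simp: eventually_at_right_less)
      then have "\<forall>\<^sub>F e in at_right 0. normalize_H3 (v + e *\<^sub>R w) \<in> {v \<in> W \<inter> H3. 0 < g v}"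
      proof eventually_elim
        case (elim e)
        then obtain r where r: "0 < r" "normalize_H3 (v + e *\<^sub>R w) = r *\<^sub>R (v + e *\<^sub>R w)"
          using normalize_H3_cone by blast
        have "normalize_H3 (v + e *\<^sub>R w) \<in> W"
          using r(2) v w W by (auto intro!: subspace_scale subspace_add)
        moreover have "0 < g (normalize_H3 (v + e *\<^sub>R w))"
          using r v w True elim by (simp add: linear_cmul[OF g] linear_add[OF g])
        ultimately show ?case using normalize_H3_in elim by blast
      qed
      then have "\<forall>\<^sub>F e in at_right 0. normalize_H3 (v + e *\<^sub>R w) \<in> closure {v \<in> W \<inter> H3. 0 < g v}"
        by (rule eventually_mono) (rule subsetD[OF closure_subset])
      from Lim_in_closed_set[OF closed_closure this trivial_limit_at_right_real lim]
      show ?thesis .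
    qed
  qed
qed

lemma closure_positive: "closure {v \<in> W. 0 < g v} = {v \<in> W. 0 \<le> g v}"
proof
  have "closed (W \<inter> {v. 0 \<le> g v})"
    by (intro closed_Int closed_W closed_Collect_le cont continuous_on_const)
  then show "closure {v \<in> W. 0 < g v} \<subseteq> {v \<in> W. 0 \<le> g v}"
    by (intro closure_minimal) (auto simp: Int_def)
  show "{v \<in> W. 0 \<le> g v} \<subseteq> closure {v \<in> W. 0 < g v}"
  proof
    fix v assume v: "v \<in> {v \<in> W. 0 \<le> g v}"
    have "((\<lambda>e. v + e *\<^sub>R w) \<longlongrightarrow> v + 0 *\<^sub>R w) (at_right 0)" by (intro tendsto_intros)
    then have lim: "((\<lambda>e. v + e *\<^sub>R w) \<longlongrightarrow> v) (at_right 0)" by simp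
    have "v + e *\<^sub>R w \<in> closure {v \<in> W. 0 < g v}" if "0 < e" for e
    proof -
      have "0 < g (v + e *\<^sub>R w)"
        using that v w by (simp add: linear_cmul[OF g] linear_add[OF g] add_nonneg_pos)
      then show ?thesis
        using v w W by (intro subsetD[OF closure_subset]) (auto intro: subspace_add subspace_scale)
    qed
    then have "\<forall>\<^sub>F e in at_right 0. v + e *\<^sub>R w \<in> closure {v \<in> W. 0 < g v}"
      by (auto intro: eventually_mono[OF eventually_at_right_less])
    from Lim_in_closed_set[OF closed_closure this trivial_limit_at_right_real lim]
    show "v \<in> closure {v \<in> W. 0 < g v}" .
  qed
qed

text \<open>Otherwise its closure would be empty too, although \<open>closure_positive_H3\<close>
  puts p into it.\<close>

lemma positive_H3_nonempty: "{v \<in> W \<inter> H3. 0 < g v} \<noteq> {}"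
proof
  assume "{v \<in> W \<inter> H3. 0 < g v} = {}"
  then have "{v \<in> W \<inter> H3. 0 \<le> g v} = {}" using closure_positive_H3 by (metis closure_empty)
  then show False using p by auto
qed

text \<open>Stated for a subset S because it serves twice: with \<open>S = W \<inter> H3\<close> it
  finds the halves, with \<open>S = W\<close> their ideal boundaries.\<close>

lemma components_of_cut:
  assumes "S \<subseteq> W" "connected {v \<in> S. 0 < g v}" "connected {v \<in> S. g v < 0}"
    "{v \<in> S. 0 < g v} \<noteq> {}" "{v \<in> S. g v < 0} \<noteq> {}"
  shows "components (S - {v \<in> W. g v = 0}) = {{v \<in> S. 0 < g v}, {v \<in> S. g v < 0}}"
proof (rule components_two)
  let ?S = "S - {v \<in> W. g v = 0}"
  have eq: "{v \<in> S. 0 < g v} = ?S \<inter> {v. 0 < g v}" "{v \<in> S. g v < 0} = ?S \<inter> {v. g v < 0}"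
    by auto
  show "openin (top_of_set ?S) {v \<in> S. 0 < g v}" "openin (top_of_set ?S) {v \<in> S. g v < 0}"
    unfolding eq by (intro openin_open_Int open_Collect_less cont continuous_on_const)+
qed (use assms in auto)

lemma components_H3:
  "components (W \<inter> H3 - {v \<in> W \<inter> H3. g v = 0}) =
    {{v \<in> W \<inter> H3. 0 < g v}, {v \<in> W \<inter> H3. g v < 0}}"
proof -
  have "W \<inter> H3 - {v \<in> W \<inter> H3. g v = 0} = W \<inter> H3 - {v \<in> W. g v = 0}" by auto
  then show ?thesis
    using components_of_cut[of "W \<inter> H3"] connected_positive positive_H3_nonempty
      linear_cut.connected_positive[OF opposite] linear_cut.positive_H3_nonempty[OF opposite]
    by simp
qed

lemma connected_positive_W: "connected {v \<in> W. 0 < g v}"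
proof -
  have "{v \<in> W. 0 < g v} = W \<inter> {v. 0 < g v}" by auto
  then show ?thesis using convex_positive W
    by (simp add: convex_connected convex_Int subspace_imp_convex)
qed

lemma components_W:
  "components (W - {v \<in> W. g v = 0}) = {{v \<in> W. 0 < g v}, {v \<in> W. g v < 0}}"
proof (rule components_of_cut)
  show "connected {v \<in> W. g v < 0}"
    using linear_cut.connected_positive_W[OF opposite] by simp
  show "{v \<in> W. g v < 0} \<noteq> {}"
    using linear_cut.w[OF opposite] by auto
qed (use connected_positive_W w in auto)

lemma is_half_iff:
  "is_half (W \<inter> H3) {v \<in> W \<inter> H3. g v = 0} H \<longleftrightarrow>
    H = {v \<in> W \<inter> H3. 0 \<le> g v} \<or> H = {v \<in> W \<inter> H3. g v \<le> 0}"
proof -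
  have "closure {v \<in> W \<inter> H3. g v < 0} = {v \<in> W \<inter> H3. g v \<le> 0}"
    using linear_cut.closure_positive_H3[OF opposite] by simp
  then show ?thesis
    unfolding is_half_def components_H3 by (simp only: bex_simps closure_positive_H3) simp
qed

text \<open>Only two halves exist, so a property Q that holds for one and fails for the other
  evaluates the definite description.\<close>

lemma half_eqI:
  assumes "Q {v \<in> W \<inter> H3. 0 \<le> g v}" "\<not> Q {v \<in> W \<inter> H3. g v \<le> 0}"
  shows "(THE H. is_half (W \<inter> H3) {v \<in> W \<inter> H3. g v = 0} H \<and> Q H) = {v \<in> W \<inter> H3. 0 \<le> g v}"
  by (rule the_equality) (use assms is_half_iff in auto)

lemma span_W: "span (W \<inter> H3) = W"
  by (rule span_subspace_H3[OF W p(1,2)])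

lemma span_zero: "span {v \<in> W \<inter> H3. g v = 0} = {v \<in> W. g v = 0}"
proof -
  have "subspace {v \<in> W. g v = 0}"
    using W by (auto simp: subspace_def linear_add[OF g] linear_cmul[OF g] linear_0[OF g])
  then have "span ({v \<in> W. g v = 0} \<inter> H3) = {v \<in> W. g v = 0}"
    using p by (intro span_subspace_H3[of _ p]) auto
  moreover have "{v \<in> W. g v = 0} \<inter> H3 = {v \<in> W \<inter> H3. g v = 0}" by auto
  ultimately show ?thesis by simp
qed

lemma ideal_boundary_zero:
  "ideal_boundary {v \<in> W \<inter> H3. g v = 0} = {x. pos_light x \<and> x \<in> W \<and> g x = 0}"
  unfolding ideal_boundary_def span_zero by simp

lemma half_ideal_boundary_positive:
  "half_ideal_boundary (W \<inter> H3) {v \<in> W \<inter> H3. g v = 0} {v \<in> W \<inter> H3. 0 \<le> g v} =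
    {x. pos_light x \<and> x \<in> W \<and> 0 \<le> g x}"
proof -
  have eq: "{v \<in> W \<inter> H3. 0 \<le> g v} - {v \<in> W \<inter> H3. g v = 0} = {v \<in> W \<inter> H3. 0 < g v}" by auto
  have "\<not> {v \<in> W \<inter> H3. 0 < g v} \<subseteq> {v \<in> W. g v < 0}" using positive_H3_nonempty by fastforce
  then show ?thesis
    unfolding half_ideal_boundary_def span_W span_zero components_W eq
    by (auto simp: closure_positive)
qed

lemma half_ideal_boundary_negative:
  "half_ideal_boundary (W \<inter> H3) {v \<in> W \<inter> H3. g v = 0} {v \<in> W \<inter> H3. g v \<le> 0} =
    {x. pos_light x \<and> x \<in> W \<and> g x \<le> 0}"
  using linear_cut.half_ideal_boundary_positive[OF opposite] by simp

lemma separates_iff: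
  assumes "pos_light x" "x \<in> W" "pos_light y" "y \<in> W"
  shows "separates (W \<inter> H3) {v \<in> W \<inter> H3. g v = 0} x y \<longleftrightarrow> g x * g y < 0"
proof
  assume "separates (W \<inter> H3) {v \<in> W \<inter> H3. g v = 0} x y"
  then show "g x * g y < 0"
    unfolding separates_def is_half_iff ideal_boundary_zero
    using half_ideal_boundary_positive half_ideal_boundary_negative assms
    by (auto simp: mult_less_0_iff)
next
  assume *: "g x * g y < 0"
  let ?p = "{v \<in> W \<inter> H3. 0 \<le> g v}" and ?n = "{v \<in> W \<inter> H3. g v \<le> 0}"
  obtain v where "v \<in> W \<inter> H3" "0 < g v" using positive_H3_nonempty by blast
  then have "v \<in> ?p" "v \<notin> ?n" by auto
  then have ne: "?p \<noteq> ?n" by blast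
  from * consider "0 < g x" "g y < 0" | "g x < 0" "0 < g y" by (auto simp: mult_less_0_iff)
  then show "separates (W \<inter> H3) {v \<in> W \<inter> H3. g v = 0} x y"
  proof cases
    case 1
    then show ?thesis unfolding separates_def is_half_iff ideal_boundary_zero
      using half_ideal_boundary_positive half_ideal_boundary_negative assms ne
      by (intro exI[of _ ?p] exI[of _ ?n]) auto
  next
    case 2
    then show ?thesis unfolding separates_def is_half_iff ideal_boundary_zero
      using half_ideal_boundary_positive half_ideal_boundary_negative assms ne
      by (intro exI[of _ ?n] exI[of _ ?p]) auto
  qed
qed

end

section \<open>Planes and geodesics\<close>

lemma span_pair_iff: "v \<in> span {a, b} \<longleftrightarrow> (\<exists>\<alpha> \<beta>. v = \<alpha> *\<^sub>R a + \<beta> *\<^sub>R b)"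
  by (auto simp: span_insert span_singleton algebra_simps)

lemma span_triple_iff:
  "v \<in> span {a, b, c} \<longleftrightarrow> (\<exists>\<alpha> \<beta> \<gamma>. v = \<alpha> *\<^sub>R a + \<beta> *\<^sub>R b + \<gamma> *\<^sub>R c)"
proof
  assume "v \<in> span {a, b, c}"
  then obtain \<alpha> where "v - \<alpha> *\<^sub>R a \<in> span {b, c}" by (auto simp: span_insert[of a])
  then obtain \<beta> \<gamma> where "v - \<alpha> *\<^sub>R a = \<beta> *\<^sub>R b + \<gamma> *\<^sub>R c" by (auto simp: span_pair_iff)
  then have "v = \<alpha> *\<^sub>R a + \<beta> *\<^sub>R b + \<gamma> *\<^sub>R c" by (simp add: algebra_simps)
  then show "\<exists>\<alpha> \<beta> \<gamma>. v = \<alpha> *\<^sub>R a + \<beta> *\<^sub>R b + \<gamma> *\<^sub>R c" by blast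
next
  assume "\<exists>\<alpha> \<beta> \<gamma>. v = \<alpha> *\<^sub>R a + \<beta> *\<^sub>R b + \<gamma> *\<^sub>R c"
  then show "v \<in> span {a, b, c}" by (auto intro!: span_add span_scale intro: span_base)
qed

lemma subspace_eq_span:
  fixes W :: "'a::euclidean_space set"
  assumes "subspace W" "B \<subseteq> W" "independent B" "card B = dim W"
  shows "W = span B"
  using assms by (metis dim_eq_card_independent dim_span order_refl span_minimal subspace_dim_equal subspace_span)

lemma independent_pair:
  assumes "b \<noteq> 0" "\<And>r. a \<noteq> r *\<^sub>R b"
  shows "independent {a, b}" "card {a, b} = 2"
  using assms assms(2)[of 1] by (auto simp: independent_insert span_singleton)

lemma independent_triple:
  assumes "c \<noteq> 0" "\<And>r. b \<noteq> r *\<^sub>R c" "\<And>r s. a \<noteq> r *\<^sub>R b + s *\<^sub>R c"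
  shows "independent {a, b, c}" "card {a, b, c} = 3"
proof -
  have *: "a \<notin> span {b, c}" using assms(3) by (auto simp: span_pair_iff)
  show "independent {a, b, c}"
    using * independent_pair(1)[OF assms(1,2)] by (rule independent_insertI)
  have "a \<noteq> b" "a \<noteq> c" using assms(3)[of 1 0] assms(3)[of 0 1] by auto
  then show "card {a, b, c} = 3"
    using independent_pair(2)[OF assms(1,2)] by simp
qed

lemma lorentz_nondegenerate: "(\<And>v. m \<odot> v = 0) \<Longrightarrow> m = 0"
  using inner_lorentz[of m m] by (metis inner_eq_zero_iff lorentz_commute)

lemma subspace_normal: "subspace {v. m \<odot> v = 0}"
  by (auto simp: subspace_def)

lemma dim_normal: "m \<noteq> 0 \<Longrightarrow> dim {v. m \<odot> v = 0} = 3"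
  using dim_hyperplane[of "time_reversal m"] by (simp add: lorentz_inner time_reversal_0_iff)

lemma exists_normal:
  assumes "dim S < 4" obtains m where "m \<noteq> 0" "\<And>v. v \<in> span S \<Longrightarrow> m \<odot> v = 0"
proof -
  have "dim S < DIM(real^4)" using assms by simp
  then obtain a where a: "a \<noteq> 0" "span S \<subseteq> {x. a \<bullet> x = 0}" using lowdim_subset_hyperplane by blast
  show ?thesis
    by (rule that[of "time_reversal a"]) (use a time_reversal_0_iff inner_lorentz in auto)
qed

lemma span_triple_eq_normal:
  assumes "independent {a, b, c}" "card {a, b, c} = 3" "m \<noteq> 0" "m \<odot> a = 0" "m \<odot> b = 0" "m \<odot> c = 0"
  shows "{v. m \<odot> v = 0} = span {a, b, c}"
  by (rule subspace_eq_span[OF subspace_normal]) (use assms dim_normal in auto)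

definition plane_of :: "real^4 \<Rightarrow> (real^4) set" where
  "plane_of m = {v \<in> H3. m \<odot> v = 0}"

lemma timelike_exists: "\<exists>e. time_like e"
  by (rule exI[of _ "axis 1 1"]) (simp add: time_like_def lorentz_def axis_def)

text \<open>Removing from a time-like vector its components along orthogonal space-like vectors can
  only lower its square, so it stays time-like.\<close>

lemma timelike_orthogonal:
  assumes "0 < m \<odot> m" "0 < n \<odot> n" "m \<odot> n = 0"
  obtains p where "p \<in> H3" "m \<odot> p = 0" "n \<odot> p = 0"
proof -
  obtain e where e: "e \<odot> e < 0" using timelike_exists by (auto simp: time_like_def)
  define v where "v = e - ((m \<odot> e) / (m \<odot> m)) *\<^sub>R m - ((n \<odot> e) / (n \<odot> n)) *\<^sub>R n"
  have mv: "m \<odot> v = 0" and nv: "n \<odot> v = 0"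
    using assms by (auto simp: v_def lorentz_commute[of n m])
  have "v \<odot> v = v \<odot> e"
    using mv nv by (subst (2) v_def) (simp add: lorentz_commute[of v])
  also have "\<dots> = e \<odot> e - (m \<odot> e)\<^sup>2 / (m \<odot> m) - (n \<odot> e)\<^sup>2 / (n \<odot> n)"
    by (simp add: v_def power2_eq_square)
  also have "\<dots> < 0" using e assms by (smt (verit) divide_nonneg_pos zero_le_power2)
  finally have "time_like v" by (simp add: time_like_def)
  moreover have "subspace ({v. m \<odot> v = 0} \<inter> {v. n \<odot> v = 0})"
    by (intro subspace_inter subspace_normal)
  ultimately obtain p where "p \<in> {v. m \<odot> v = 0} \<inter> {v. n \<odot> v = 0}" "p \<in> H3"
    using timelike_subspace_H3 mv nv by blast
  then show ?thesis using that by blast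
qed

lemma point_of_plane:
  assumes "0 < m \<odot> m" obtains p where "p \<in> H3" "m \<odot> p = 0"
proof -
  obtain e where e: "e \<odot> e < 0" using timelike_exists by (auto simp: time_like_def)
  define v where "v = e - ((m \<odot> e) / (m \<odot> m)) *\<^sub>R m"
  have mv: "m \<odot> v = 0" using assms by (auto simp: v_def)
  have "v \<odot> v = v \<odot> e"
    using mv by (subst (2) v_def) (simp add: lorentz_commute[of v])
  also have "\<dots> = e \<odot> e - (m \<odot> e)\<^sup>2 / (m \<odot> m)"
    by (simp add: v_def power2_eq_square)
  also have "\<dots> < 0" using e assms by (smt (verit) divide_nonneg_pos zero_le_power2)
  finally have "time_like v" by (simp add: time_like_def)
  then obtain p where "p \<in> {v. m \<odot> v = 0}" "p \<in> H3"
    using timelike_subspace_H3[OF subspace_normal] mv by blast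
  then show ?thesis using that by blast
qed

lemma linear_cut_normal:
  assumes "0 < m \<odot> m" obtains p where "linear_cut UNIV (\<lambda>v. m \<odot> v) p m"
proof -
  obtain p where "p \<in> H3" "m \<odot> p = 0" using point_of_plane[OF assms] .
  then have "linear_cut UNIV (\<lambda>v. m \<odot> v) p m"
    using assms by (intro linear_cut.intro linear_lorentz) auto
  then show ?thesis by (rule that)
qed

lemma span_plane_of: "0 < m \<odot> m \<Longrightarrow> span (plane_of m) = {v. m \<odot> v = 0}"
  using linear_cut.span_zero[of UNIV "\<lambda>v. m \<odot> v"] linear_cut_normal[of m]
  by (metis (no_types, lifting) plane_of_def Collect_cong Int_UNIV_left UNIV_I)

lemma is_plane_iff: "is_plane P \<longleftrightarrow> (\<exists>m. 0 < m \<odot> m \<and> P = plane_of m)"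
proof
  assume "is_plane P"
  then obtain V v where V: "subspace V" "dim V = 3" "v \<in> V" "time_like v" "P = V \<inter> H3"
    by (auto simp: is_plane_def)
  have "dim V < 4" using V(2) by simp
  then obtain m where m: "m \<noteq> 0" "\<And>v. v \<in> span V \<Longrightarrow> m \<odot> v = 0" by (rule exists_normal) blast
  have "V \<subseteq> {v. m \<odot> v = 0}" using m(2) by (auto intro: span_base)
  then have eq: "V = {v. m \<odot> v = 0}"
    by (intro subspace_dim_equal V subspace_normal) (use V dim_normal m(1) in auto)
  have "0 < m \<odot> m"
    by (rule orthogonal_to_timelike[of v]) (use V m(1) eq in \<open>auto simp: time_like_def lorentz_commute\<close>)
  then show "\<exists>m. 0 < m \<odot> m \<and> P = plane_of m"
    using V(5) eq by (auto simp: plane_of_def)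
next
  assume "\<exists>m. 0 < m \<odot> m \<and> P = plane_of m"
  then obtain m where m: "0 < m \<odot> m" "P = plane_of m" by blast
  obtain p where p: "p \<in> H3" "m \<odot> p = 0" using point_of_plane[OF m(1)] .
  have "m \<noteq> 0" using m(1) by auto
  then show "is_plane P" unfolding is_plane_def
    by (intro exI[of _ "{v. m \<odot> v = 0}"])
      (use m p dim_normal[of m] subspace_normal[of m] H3_time_like[of p] in \<open>auto simp: plane_of_def\<close>)
qed

lemma ideal_boundary_subspace:
  "subspace W \<Longrightarrow> v \<in> W \<Longrightarrow> v \<in> H3 \<Longrightarrow> ideal_boundary (W \<inter> H3) = {x. pos_light x \<and> x \<in> W}"
  by (simp add: ideal_boundary_def span_subspace_H3)

lemma ideal_boundary_plane_of:
  "0 < m \<odot> m \<Longrightarrow> ideal_boundary (plane_of m) = {x. pos_light x \<and> m \<odot> x = 0}"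
  by (simp add: ideal_boundary_def span_plane_of)

text \<open>The component of n orthogonal to m is orthogonal to m and to everything orthogonal to m,
  hence zero by nondegeneracy.\<close>

lemma normal_unique:
  assumes "0 < m \<odot> m" "\<And>v. m \<odot> v = 0 \<Longrightarrow> n \<odot> v = 0"
  obtains r where "n = r *\<^sub>R m"
proof -
  define v where "v = n - ((n \<odot> m) / (m \<odot> m)) *\<^sub>R m"
  have mv: "m \<odot> v = 0" using assms(1) by (simp add: v_def lorentz_commute)
  have "v \<odot> u = 0" for u
  proof -
    define w where "w = u - ((m \<odot> u) / (m \<odot> m)) *\<^sub>R m"
    have "m \<odot> w = 0" using assms(1) by (simp add: w_def)
    then have "v \<odot> w = 0" using assms(2) by (simp add: v_def)
    then show ?thesis using mv by (simp add: w_def lorentz_commute[of v m])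
  qed
  then have "v = 0" by (rule lorentz_nondegenerate)
  then show ?thesis using that[of "(n \<odot> m) / (m \<odot> m)"] by (simp add: v_def)
qed

text \<open>The definition also demands a common point; for orthogonal space-like normals
  \<open>timelike_orthogonal\<close> supplies one.\<close>

lemma planes_orthogonal_iff:
  assumes "0 < m \<odot> m" "0 < n \<odot> n"
  shows "planes_orthogonal (plane_of m) (plane_of n) \<longleftrightarrow> m \<odot> n = 0"
proof
  assume "planes_orthogonal (plane_of m) (plane_of n)"
  then have "(\<forall>v \<in> span (plane_of m). m \<odot> v = 0) \<longrightarrow> (\<forall>v \<in> span (plane_of n). n \<odot> v = 0) \<longrightarrow>
      m \<odot> n = 0"
    unfolding planes_orthogonal_def by (elim conjE allE)
  then show "m \<odot> n = 0" using assms by (simp add: span_plane_of)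
next
  assume mn: "m \<odot> n = 0"
  obtain p where "p \<in> H3" "m \<odot> p = 0" "n \<odot> p = 0" using timelike_orthogonal[OF assms mn] .
  then have "plane_of m \<inter> plane_of n \<noteq> {}" by (auto simp: plane_of_def)
  moreover have "m' \<odot> n' = 0"
    if *: "\<forall>v \<in> span (plane_of m). m' \<odot> v = 0" "\<forall>v \<in> span (plane_of n). n' \<odot> v = 0" for m' n'
  proof -
    have **: "m' \<odot> v = 0" if "m \<odot> v = 0" for v
      using *(1) that by (simp add: span_plane_of[OF assms(1)])
    have ***: "n' \<odot> v = 0" if "n \<odot> v = 0" for v
      using *(2) that by (simp add: span_plane_of[OF assms(2)])
    obtain r where "m' = r *\<^sub>R m" using normal_unique[OF assms(1) **] .
    moreover obtain s where "n' = s *\<^sub>R n" using normal_unique[OF assms(2) ***] .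
    ultimately show ?thesis using mn by simp
  qed
  ultimately show "planes_orthogonal (plane_of m) (plane_of n)"
    unfolding planes_orthogonal_def by (intro conjI allI impI)
qed

section \<open>Geodesics and faces as spans of explicit vectors\<close>

lemma geodesic_spanI:
  assumes "independent {a, b}" "card {a, b} = 2" "v \<in> span {a, b}" "time_like v"
  shows "is_geodesic (span {a, b} \<inter> H3)"
proof -
  have "dim {a, b} = 2" using dim_eq_card_independent[OF assms(1)] assms(2) by simp
  then show ?thesis
    unfolding is_geodesic_def using assms(3,4) by (intro exI[of _ "span {a, b}"]) auto
qed

lemma geodesic_eq_span:
  assumes "is_geodesic L" "a \<in> span L" "b \<in> span L" "independent {a, b}" "card {a, b} = 2"
  shows "L = span {a, b} \<inter> H3"
proof -
  obtain W w where W: "subspace W" "dim W = 2" "w \<in> W" "time_like w" "L = W \<inter> H3"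
    using assms(1) by (auto simp: is_geodesic_def)
  obtain v where "v \<in> W" "v \<in> H3" using timelike_subspace_H3[OF W(1,3,4)] .
  then have "span L = W" using W by (simp add: span_subspace_H3)
  then have "W = span {a, b}"
    using assms W by (intro subspace_eq_span) auto
  then show ?thesis using W(5) by simp
qed

lemma light_pair_independent:
  assumes "pos_light x" "pos_light y" "x \<odot> y < 0"
  shows "independent {x, y}" "card {x, y} = 2"
  using assms by (intro independent_pair; auto simp: pos_lightD)+

lemma light_triple_independent:
  assumes "pos_light x" "pos_light y" "pos_light z" "x \<odot> y < 0" "x \<odot> z < 0" "y \<odot> z < 0"
  shows "independent {x, y, z}" "card {x, y, z} = 3"
proof -
  have 1: "z \<noteq> 0" using assms pos_lightD by blast
  have 2: "y \<noteq> r *\<^sub>R z" for r using assms pos_lightD(2)[of z] by auto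
  have 3: "x \<noteq> r *\<^sub>R y + s *\<^sub>R z" for r s
  proof
    assume x: "x = r *\<^sub>R y + s *\<^sub>R z"
    have "x \<odot> x = 2 * r * s * (y \<odot> z)"
      using assms pos_lightD by (simp add: x lorentz_commute[of z y])
    \<comment> \<open>Since y and z are null, only the mixed term survives in the square of x; with
      r or s zero, x would be a multiple of y or z and pair with it to 0.\<close>
    then have "r = 0 \<or> s = 0" using assms pos_lightD by simp
    then show False using x assms(4,5) pos_lightD(2)[of y] pos_lightD(2)[of z] assms(2,3) by auto
  qed
  show "independent {x, y, z}" "card {x, y, z} = 3"
    using independent_triple[OF 1 2 3] by auto
qed

lemma light_sum_timelike:
  "pos_light x \<Longrightarrow> pos_light y \<Longrightarrow> x \<odot> y < 0 \<Longrightarrow> time_like (x + y)"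
  by (simp add: time_like_def pos_lightD lorentz_commute[of y x])

lemma geodesic_joining_eq:
  assumes "pos_light x" "pos_light y" "x \<odot> y < 0"
  shows "geodesic_joining x y = span {x, y} \<inter> H3"
  unfolding geodesic_joining_def
proof (rule the_equality)
  note ind = light_pair_independent[OF assms]
  have tl: "x + y \<in> span {x, y}" by (intro span_add span_base) auto
  obtain v where v: "v \<in> span {x, y}" "v \<in> H3"
    using timelike_subspace_H3[OF subspace_span tl light_sum_timelike[OF assms]] .
  show "is_geodesic (span {x, y} \<inter> H3) \<and> x \<in> ideal_boundary (span {x, y} \<inter> H3) \<and>
      y \<in> ideal_boundary (span {x, y} \<inter> H3)"
    using geodesic_spanI[OF ind tl light_sum_timelike[OF assms]]
      ideal_boundary_subspace[OF subspace_span v] assms by (auto intro: span_base)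
  fix L assume "is_geodesic L \<and> x \<in> ideal_boundary L \<and> y \<in> ideal_boundary L"
  then show "L = span {x, y} \<inter> H3"
    using geodesic_eq_span[OF _ _ _ ind] by (auto simp: ideal_boundary_def)
qed

text \<open>For a unit normal n, the point where the perpendicular towards x meets
  \<open>plane_of n\<close>: x is scaled to pair to 1 with n, and then n is subtracted.\<close>

definition foot :: "real^4 \<Rightarrow> real^4 \<Rightarrow> real^4" where
  "foot n x = (1 / (n \<odot> x)) *\<^sub>R x - n"

lemma foot_props:
  assumes "n \<odot> n = 1" "pos_light x" "0 < n \<odot> x"
  shows "foot n x \<in> H3" "n \<odot> foot n x = 0" "foot n x \<in> span {n, x}"
proof -
  show "n \<odot> foot n x = 0" using assms by (simp add: foot_def)
  have "foot n x \<odot> foot n x = - 1"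
    using assms pos_lightD(2)[of x] by (simp add: foot_def lorentz_commute[of x n])
  moreover have "foot n x \<odot> x < 0"
    using assms pos_lightD(2)[of x] by (simp add: foot_def)
  ultimately show "foot n x \<in> H3" using assms by (metis H3_if_lorentz_light_neg)
  show "foot n x \<in> span {n, x}" unfolding foot_def
    by (intro span_diff span_scale span_base) auto
qed

lemma normal_light_independent:
  assumes "n \<odot> n = 1" "pos_light x" "0 < n \<odot> x"
  shows "independent {n, x}" "card {n, x} = 2"
  using assms by (intro independent_pair; auto simp: pos_lightD)+

lemma plane_inter_perp:
  assumes "n \<odot> n = 1" "pos_light x" "0 < n \<odot> x"
  shows "plane_of n \<inter> (span {n, x} \<inter> H3) = {foot n x}"
proof
  show "{foot n x} \<subseteq> plane_of n \<inter> (span {n, x} \<inter> H3)"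
    using foot_props[OF assms] by (auto simp: plane_of_def)
  show "plane_of n \<inter> (span {n, x} \<inter> H3) \<subseteq> {foot n x}"
  proof
    fix p assume p: "p \<in> plane_of n \<inter> (span {n, x} \<inter> H3)"
    then obtain \<alpha> \<beta> where ab: "p = \<alpha> *\<^sub>R n + \<beta> *\<^sub>R x" by (auto simp: span_pair_iff)
    have "n \<odot> p = 0" "p \<in> H3" using p by (auto simp: plane_of_def)
    then have a: "\<alpha> = - (\<beta> * (n \<odot> x))" using ab assms by simp
    then have pf: "p = (\<beta> * (n \<odot> x)) *\<^sub>R foot n x"
      using ab assms by (simp add: foot_def algebra_simps)
    then have "(\<beta> * (n \<odot> x))\<^sup>2 = 1"
      using H3D(2)[OF foot_props(1)[OF assms]] H3D(2)[OF \<open>p \<in> H3\<close>] by (simp add: power2_eq_square)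
    then have "\<beta> * (n \<odot> x) = 1 \<or> \<beta> * (n \<odot> x) = - 1" by (simp add: power2_eq_1_iff)
    moreover have "\<beta> * (n \<odot> x) \<noteq> - 1"
      using pf H3D(1)[OF foot_props(1)[OF assms]] H3D(1)[OF \<open>p \<in> H3\<close>] by auto
    ultimately show "p \<in> {foot n x}" using pf by simp
  qed
qed

lemma perp_geodesic_eq:
  assumes n: "n \<odot> n = 1" and x: "pos_light x" "0 < n \<odot> x"
  shows "perp_geodesic (plane_of n) x = span {n, x} \<inter> H3"
  unfolding perp_geodesic_def
proof (rule the_equality)
  let ?L = "span {n, x} \<inter> H3"
  note ind = normal_light_independent[OF assms] and f = foot_props[OF assms]
  have n0: "0 < n \<odot> n" using n by simp
  have sL: "span ?L = span {n, x}" using span_subspace_H3[OF subspace_span f(3,1)] .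
  have "w \<odot> v = 0"
    if pwv: "p \<in> ?L \<inter> plane_of n" "w \<in> span {n, x}" "n \<odot> v = 0" "w \<odot> p = 0" for p w v
  proof -
    have p: "p = foot n x" using pwv(1) plane_inter_perp[OF assms] by blast
    obtain \<alpha> \<beta> where w: "w = \<alpha> *\<^sub>R n + \<beta> *\<^sub>R x" using pwv(2) by (auto simp: span_pair_iff)
    have "w \<odot> foot n x = \<beta> * (x \<odot> foot n x)" using f(2) by (simp add: w)
    moreover have "x \<odot> foot n x \<noteq> 0"
      using lorentz_H3_light_neg[OF f(1) x(1)] by (simp add: lorentz_commute)
    ultimately have "\<beta> = 0" using pwv(4) p by simp
    then show ?thesis using w pwv(3) by simp
  qed
  then have "meets_perpendicularly ?L (plane_of n)"
    unfolding meets_perpendicularly_def sL span_plane_of[OF n0]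
    using plane_inter_perp[OF assms] by (auto simp: Int_commute)
  then show "is_geodesic ?L \<and> meets_perpendicularly ?L (plane_of n) \<and> x \<in> ideal_boundary ?L"
    using geodesic_spanI[OF ind f(3) H3_time_like[OF f(1)]] x
      ideal_boundary_subspace[OF subspace_span f(3,1)] by (auto intro: span_base)
  fix L assume L: "is_geodesic L \<and> meets_perpendicularly L (plane_of n) \<and> x \<in> ideal_boundary L"
  then obtain p where p: "p \<in> L" "p \<in> plane_of n" by (auto simp: meets_perpendicularly_def)
  have pH: "p \<in> H3" "n \<odot> p = 0" using p by (auto simp: plane_of_def)
  have xL: "x \<in> span L" using L by (simp add: ideal_boundary_def)
  \<comment> \<open>The tangent vector of L at p towards x. Perpendicularity makes it orthogonal to
    the whole subspace of the plane, hence a multiple of n, so that \<open>span L\<close> contains n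
    as well as x.\<close>
  define w where "w = x + (x \<odot> p) *\<^sub>R p"
  have wL: "w \<in> span L" unfolding w_def using p xL by (intro span_add span_scale) (auto intro: span_base)
  have wp: "w \<odot> p = 0" using H3D(2)[OF pH(1)] by (simp add: w_def)
  have "w \<odot> v = 0" if v: "n \<odot> v = 0" for v
  proof -
    \<comment> \<open>Perpendicularity speaks only of tangent vectors at p, so v is replaced by its
      tangential part; the difference is a multiple of p and orthogonal to w.\<close>
    define v' where "v' = v + (v \<odot> p) *\<^sub>R p"
    have "v' \<odot> p = 0" using H3D(2)[OF pH(1)] by (simp add: v'_def)
    moreover have "v' \<in> span (plane_of n)" using v pH by (simp add: span_plane_of n v'_def)
    ultimately have "w \<odot> v' = 0"
      using L p wL wp unfolding meets_perpendicularly_def by blast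
    then show ?thesis using wp by (simp add: v'_def)
  qed
  then obtain r where r: "w = r *\<^sub>R n" using normal_unique[OF n0] by blast
  have "r \<noteq> 0"
  proof
    assume "r = 0"
    then have "x = - (x \<odot> p) *\<^sub>R p" using r by (simp add: w_def eq_neg_iff_add_eq_0)
    then have "n \<odot> x = 0" using pH(2) by (metis lorentz_simps(6) mult_zero_right)
    then show False using x by simp
  qed
  then have "n = (1 / r) *\<^sub>R w" using r by simp
  then have "n \<in> span L" using wL by (metis span_scale)
  then show "L = ?L" using geodesic_eq_span[OF _ _ xL ind] L by blast
qed

lemma ideal_face_plane_eq:
  assumes x: "pos_light x" "pos_light y" "pos_light z" "x \<odot> y < 0" "x \<odot> z < 0" "y \<odot> z < 0"
  obtains m where "0 < m \<odot> m" "{v. m \<odot> v = 0} = span {x, y, z}" "ideal_face_plane x y z = plane_of m"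
proof -
  note ind = light_triple_independent[OF x]
  have "dim {x, y, z} = 3" using ind dim_eq_card_independent by metis
  then obtain m where m: "m \<noteq> 0" "\<And>v. v \<in> span {x, y, z} \<Longrightarrow> m \<odot> v = 0"
    using exists_normal[of "{x, y, z}"] by auto
  have sp: "{v. m \<odot> v = 0} = span {x, y, z}"
    by (rule span_triple_eq_normal[OF ind m(1)]) (use m(2) in \<open>auto intro: span_base\<close>)
  have "m \<odot> (x + y) = 0" using m(2) by (intro m(2) span_add span_base) auto
  then have mm: "0 < m \<odot> m"
    using light_sum_timelike[OF x(1,2,4)] m(1)
    by (intro orthogonal_to_timelike[of "x + y"]) (auto simp: time_like_def lorentz_commute)
  have "ideal_face_plane x y z = plane_of m"
    unfolding ideal_face_plane_def
  proof (rule the_equality)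
    show "is_plane (plane_of m) \<and> {x, y, z} \<subseteq> ideal_boundary (plane_of m)"
      using mm is_plane_iff x m(2) by (auto simp: ideal_boundary_plane_of intro: span_base)
    fix P assume P: "is_plane P \<and> {x, y, z} \<subseteq> ideal_boundary P"
    then obtain m' where m': "0 < m' \<odot> m'" "P = plane_of m'" using is_plane_iff by blast
    have "{v. m' \<odot> v = 0} = span {x, y, z}"
      by (rule span_triple_eq_normal[OF ind]) (use P m' in \<open>auto simp: ideal_boundary_plane_of\<close>)
    then show "P = plane_of m" using m' sp unfolding plane_of_def by blast
  qed
  then show ?thesis using that mm sp by blast
qed

text \<open>Orthogonality to \<open>plane_of n\<close> puts n into the subspace of the plane, which
  is therefore spanned by n, x and y; the hypothesis on n makes these three independent.\<close>

lemma ortho_face_plane_eq: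
  assumes n: "n \<odot> n = 1" and x: "pos_light x" "pos_light y" "x \<odot> y < 0"
    and nin: "n \<notin> span {x, y}"
  obtains m where "0 < m \<odot> m" "{v. m \<odot> v = 0} = span {n, x, y}"
    "ortho_face_plane (plane_of n) x y = plane_of m"
proof -
  have ind: "independent {n, x, y}" "card {n, x, y} = 3"
  proof -
    show "independent {n, x, y}"
      using nin light_pair_independent(1)[OF x] by (rule independent_insertI)
    have "n \<notin> {x, y}" using nin span_base by blast
    then show "card {n, x, y} = 3" using light_pair_independent(2)[OF x] by simp
  qed
  have "dim {n, x, y} = 3" using ind dim_eq_card_independent by metis
  then obtain m where m: "m \<noteq> 0" "\<And>v. v \<in> span {n, x, y} \<Longrightarrow> m \<odot> v = 0"
    using exists_normal[of "{n, x, y}"] by auto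
  have sp: "{v. m \<odot> v = 0} = span {n, x, y}"
    by (rule span_triple_eq_normal[OF ind m(1)]) (use m(2) in \<open>auto intro: span_base\<close>)
  have "m \<odot> (x + y) = 0" using m(2) by (intro m(2) span_add span_base) auto
  then have mm: "0 < m \<odot> m"
    using light_sum_timelike[OF x] m(1)
    by (intro orthogonal_to_timelike[of "x + y"]) (auto simp: time_like_def lorentz_commute)
  have n0: "0 < n \<odot> n" using n by simp
  have "ortho_face_plane (plane_of n) x y = plane_of m"
    unfolding ortho_face_plane_def
  proof (rule the_equality)
    show "is_plane (plane_of m) \<and> planes_orthogonal (plane_of m) (plane_of n) \<and>
        {x, y} \<subseteq> ideal_boundary (plane_of m)"
      using mm is_plane_iff x m(2) planes_orthogonal_iff[OF mm n0]
      by (auto simp: ideal_boundary_plane_of intro: span_base)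
    fix P assume P: "is_plane P \<and> planes_orthogonal P (plane_of n) \<and> {x, y} \<subseteq> ideal_boundary P"
    then obtain m' where m': "0 < m' \<odot> m'" "P = plane_of m'" using is_plane_iff by blast
    have "{v. m' \<odot> v = 0} = span {n, x, y}"
      by (rule span_triple_eq_normal[OF ind])
        (use P m' planes_orthogonal_iff[OF m'(1) n0] in \<open>auto simp: ideal_boundary_plane_of\<close>)
    then show "P = plane_of m" using m' sp unfolding plane_of_def by blast
  qed
  then show ?thesis using that mm sp by blast
qed

section \<open>Signed distances and arclength parametrizations\<close>

lemma dH_nonneg: "u \<in> H3 \<Longrightarrow> v \<in> H3 \<Longrightarrow> 0 \<le> dH u v"
  unfolding dH_def using lorentz_H3_le[of u v] by simp

lemma dH_le_iff:
  "u \<in> H3 \<Longrightarrow> v \<in> H3 \<Longrightarrow> u' \<in> H3 \<Longrightarrow> v' \<in> H3 \<Longrightarrow> dH u v \<le> dH u' v' \<longleftrightarrow> u' \<odot> v' \<le> u \<odot> v"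
  unfolding dH_def using lorentz_H3_le[of u v] lorentz_H3_le[of u' v']
  by (simp flip: not_less)

lemma dH_eq_abs: "- (u \<odot> v) = cosh r \<Longrightarrow> dH u v = \<bar>r\<bar>"
  unfolding dH_def using arcosh_cosh_real[of "\<bar>r\<bar>"] by (simp add: cosh_real_abs)

lemma INF_dH_horosphere:
  assumes v: "v \<in> H3" and x: "pos_light x"
  shows "(INF u \<in> horosphere x. dH v u) = \<bar>ln (- (v \<odot> x))\<bar>"
proof -
  define \<kappa> where "\<kappa> = - (v \<odot> x)"
  have k: "0 < \<kappa>" using lorentz_H3_light_neg[OF v x] by (simp add: \<kappa>_def)
  have xx: "x \<odot> x = 0" and vv: "v \<odot> v = - 1" and vx: "v \<odot> x = - \<kappa>" and xv: "x \<odot> v = - \<kappa>"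
    using pos_lightD[OF x] H3D[OF v] by (auto simp: \<kappa>_def lorentz_commute)
  \<comment> \<open>The vector of \<open>span {v, x}\<close> with \<open>u \<odot> x = - 1\<close>
    and \<open>u \<odot> u = - 1\<close>: the geodesic through v with ideal endpoint x crosses the
    horosphere there.\<close>
  define u where "u = (1 / \<kappa>) *\<^sub>R v + ((1 - 1 / \<kappa>\<^sup>2) / 2) *\<^sub>R x"
  have ux: "u \<odot> x = - 1" using xx vx k by (simp add: u_def)
  have uu: "u \<odot> u = - 1"
    using xx vv vx xv k by (simp add: u_def field_simps power2_eq_square)
  have u: "u \<in> horosphere x"
    using H3_if_lorentz_light_neg[OF uu x] ux by (simp add: horosphere_def)
  have vu: "- (v \<odot> u) = cosh (ln \<kappa>)"
    using vv vx k by (simp add: u_def cosh_ln_real field_simps power2_eq_square)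
  have le: "dH v u \<le> dH v u'" if "u' \<in> horosphere x" for u'
  proof -
    have u': "u' \<in> H3" "u' \<odot> x = - 1" using that by (auto simp: horosphere_def)
    \<comment> \<open>Both u' and v / \<kappa> pair to - 1 with x, so w is orthogonal to x and has
      nonnegative square. Multiplied by \<kappa> / 2, this is the bound
      \<open>cosh (ln \<kappa>) \<le> - (v \<odot> u')\<close>.\<close>
    define w where "w = u' - (1 / \<kappa>) *\<^sub>R v"
    have "0 \<le> w \<odot> w"
      by (rule orthogonal_to_causal[of x])
        (use xx pos_lightD(3)[OF x] u' xv k in \<open>auto simp: w_def lorentz_commute[of x u']\<close>)
    also have "w \<odot> w = - 1 - 1 / \<kappa>\<^sup>2 - 2 / \<kappa> * (v \<odot> u')"
      using H3D(2)[OF u'(1)] vv by (simp add: w_def lorentz_commute[of u' v] power2_eq_square diff_divide_distrib add_divide_distrib)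
    finally have "0 \<le> (- 1 - 1 / \<kappa>\<^sup>2 - 2 / \<kappa> * (v \<odot> u')) * (\<kappa> / 2)"
      using k by (intro mult_nonneg_nonneg) auto
    also have "\<dots> = - (v \<odot> u') - cosh (ln \<kappa>)"
      using k by (simp add: cosh_ln_real field_simps power2_eq_square)
    finally have "v \<odot> u' \<le> v \<odot> u" using vu by simp
    then show ?thesis
      using u'(1) u v by (simp add: dH_le_iff horosphere_def)
  qed
  have "(INF u \<in> horosphere x. dH v u) = dH v u"
    by (rule cInf_eq_minimum) (use u le in auto)
  then show ?thesis using dH_eq_abs[OF vu] by (simp add: \<kappa>_def)
qed

lemma signed_dist_point_eq:
  assumes "v \<in> H3" "pos_light x"
  shows "signed_dist_point v x = ln (- (v \<odot> x))"
proof -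
  have "0 < - (v \<odot> x)" using lorentz_H3_light_neg[OF assms] by simp
  then have "v \<in> horoball x \<longleftrightarrow> ln (- (v \<odot> x)) \<le> 0"
    using assms by (auto simp: horoball_def)
  then show ?thesis
    by (simp add: signed_dist_point_def INF_dH_horosphere[OF assms] Let_def)
qed

text \<open>For v in the plane, x may be replaced by its projection, which is n \<odot> x times the
  foot. By \<open>lorentz_H3_le\<close> the pairing is then smallest in absolute value at the foot
  itself.\<close>

lemma exp_signed_dist_plane:
  assumes n: "n \<odot> n = 1" and x: "pos_light x" "0 < n \<odot> x"
  shows "exp (signed_dist_plane (plane_of n) x) = n \<odot> x"
proof -
  note f = foot_props[OF assms]
  have fx: "foot n x \<odot> x = - (n \<odot> x)"
    using pos_lightD(2)[OF x(1)] by (simp add: foot_def)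
  have "signed_dist_plane (plane_of n) x = ln (n \<odot> x)"
    unfolding signed_dist_plane_def
  proof (rule Least_equality)
    show "\<exists>v\<in>plane_of n. ln (n \<odot> x) = signed_dist_point v x"
      using f fx signed_dist_point_eq[OF f(1) x(1)] by (auto simp: plane_of_def)
    fix h assume "\<exists>v\<in>plane_of n. h = signed_dist_point v x"
    then obtain v where v: "v \<in> H3" "n \<odot> v = 0" "h = ln (- (v \<odot> x))"
      using signed_dist_point_eq[OF _ x(1)] by (auto simp: plane_of_def)
    have "x = (n \<odot> x) *\<^sub>R (foot n x + n)" using x by (simp add: foot_def)
    then have "v \<odot> x = v \<odot> ((n \<odot> x) *\<^sub>R (foot n x + n))" by simp
    also have "\<dots> = (n \<odot> x) * (v \<odot> foot n x)"
      using v(2) by (simp only: lorentz_simps lorentz_commute[of v n]) simp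
    also have "\<dots> \<le> (n \<odot> x) * (- 1)"
      using lorentz_H3_le[OF v(1) f(1)] x by (intro mult_left_mono) auto
    finally show "ln (n \<odot> x) \<le> h" using x v(3) by simp
  qed
  then show ?thesis using x by simp
qed

lemma exp_signed_dist_horoballs:
  assumes x: "pos_light x" and y: "pos_light y" and xy: "x \<odot> y < 0"
  shows "exp (signed_dist_horoballs x y) = - (x \<odot> y) / 2"
proof -
  define M where "M = - (x \<odot> y)"
  have M: "0 < M" "x \<odot> y = - M" "y \<odot> x = - M" using xy by (auto simp: M_def lorentz_commute)
  have xx: "x \<odot> x = 0" "y \<odot> y = 0" using pos_lightD x y by auto
  \<comment> \<open>Where the geodesic joining the two ideal points crosses the horosphere of
    x.\<close>
  define u where "u = (1/2) *\<^sub>R x + (1 / M) *\<^sub>R y"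
  have u: "u \<odot> x = - 1" "u \<odot> u = - 1" "u \<odot> y = - (M / 2)"
    using M xx by (simp_all add: u_def)
  then have uH: "u \<in> H3" using H3_if_lorentz_light_neg[OF _ x] by simp
  have "signed_dist_horoballs x y = ln (M / 2)"
    unfolding signed_dist_horoballs_def
  proof (rule Least_equality)
    show "\<exists>v\<in>horosphere x. ln (M / 2) = signed_dist_point v y"
      using u uH signed_dist_point_eq[OF uH y] by (intro bexI[of _ u]) (auto simp: horosphere_def)
    fix h assume "\<exists>v\<in>horosphere x. h = signed_dist_point v y"
    then obtain v where v: "v \<in> H3" "v \<odot> x = - 1" "h = ln (- (v \<odot> y))"
      using signed_dist_point_eq[OF _ y] by (auto simp: horosphere_def)
    \<comment> \<open>The component of v orthogonal to x and y. Its square is nonnegative and equals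
      - 1 - 2 (v \<odot> y) / M, which is the bound sought.\<close>
    define w where "w = v + ((v \<odot> y) / M) *\<^sub>R x + ((v \<odot> x) / M) *\<^sub>R y"
    have w: "w \<odot> x = 0" using M xx by (simp add: w_def)
    have "0 \<le> w \<odot> w"
      by (rule orthogonal_to_causal[of x])
        (use w xx pos_lightD(3)[OF x] in \<open>auto simp: lorentz_commute\<close>)
    also have "w \<odot> w = w \<odot> v + ((v \<odot> x) / M) * (w \<odot> y)"
      using w by (subst (2) w_def) simp
    also have "\<dots> = - 1 - 2 * (v \<odot> y) / M"
      using H3D(2)[OF v(1)] v(2) M xx by (simp add: w_def lorentz_commute[of x v] lorentz_commute[of y v])
    finally have "M / 2 \<le> - (v \<odot> y)" using M(1) by (simp add: field_simps)
    then show "ln (M / 2) \<le> h" using M(1) v(3) by simp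
  qed
  then show ?thesis using M by simp
qed

section \<open>Geodesics parametrized by their null endpoints\<close>

definition line_param :: "real^4 \<Rightarrow> real^4 \<Rightarrow> real \<Rightarrow> real^4" where
  "line_param u w t = exp t *\<^sub>R u + exp (- t) *\<^sub>R w"

lemma lorentz_line_param:
  assumes "pos_light u" "pos_light w" "u \<odot> w = - 1 / 2"
  shows "line_param u w s \<odot> line_param u w t = - cosh (s - t)"
  using assms pos_lightD[of u] pos_lightD[of w]
  by (simp add: line_param_def lorentz_commute[of w u] cosh_field_def exp_diff exp_minus field_simps)

lemma line_param_H3:
  assumes "pos_light u" "pos_light w" "u \<odot> w = - 1 / 2"
  shows "line_param u w t \<in> H3"
proof (rule H3I)
  show "0 < line_param u w t $ 1"
    using assms pos_lightD(1) by (simp add: line_param_def add_pos_pos)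
  show "line_param u w t \<odot> line_param u w t = - 1"
    using lorentz_line_param[OF assms, of t t] by simp
qed

lemma range_line_param:
  assumes "pos_light u" "pos_light w" "u \<odot> w = - 1 / 2"
  shows "range (line_param u w) = span {u, w} \<inter> H3"
proof
  show "range (line_param u w) \<subseteq> span {u, w} \<inter> H3"
    using line_param_H3[OF assms] by (auto simp: line_param_def intro!: span_add span_scale intro: span_base)
  show "span {u, w} \<inter> H3 \<subseteq> range (line_param u w)"
  proof
    fix v assume v: "v \<in> span {u, w} \<inter> H3"
    then obtain \<alpha> \<beta> where ab: "v = \<alpha> *\<^sub>R u + \<beta> *\<^sub>R w" by (auto simp: span_pair_iff)
    have 0: "u \<odot> u = 0" "w \<odot> w = 0" using pos_lightD assms by auto
    have "v \<odot> w < 0" using v assms by (intro lorentz_H3_light_neg) auto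
    then have a: "0 < \<alpha>" using 0 assms(3) by (simp add: ab)
    have "v \<odot> v = - 1" using v H3D(2) by auto
    then have "\<alpha> * \<beta> = 1" using 0 assms(3) by (simp add: ab lorentz_commute[of w u])
    then have "\<beta> = 1 / \<alpha>" using a by (simp add: field_simps)
    then have "v = line_param u w (ln \<alpha>)" using a ab by (simp add: line_param_def exp_minus field_simps)
    then show "v \<in> range (line_param u w)" by blast
  qed
qed

text \<open>A real number is determined by its distances from two different points, here \<phi> 0
  and \<phi> 1.\<close>

lemma real_isometry:
  fixes \<phi> :: "real \<Rightarrow> real"
  assumes "\<And>s t. \<bar>\<phi> s - \<phi> t\<bar> = \<bar>s - t\<bar>"
  obtains c \<epsilon> where "\<epsilon> = 1 \<or> \<epsilon> = - 1" "\<And>s. \<phi> s = c + \<epsilon> * s"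
proof (rule that)
  show "\<phi> 1 - \<phi> 0 = 1 \<or> \<phi> 1 - \<phi> 0 = - 1" using assms[of 1 0] by linarith
  fix s
  show "\<phi> s = \<phi> 0 + (\<phi> 1 - \<phi> 0) * s"
  proof (cases "\<phi> 1 - \<phi> 0 = 1")
    case True
    then show ?thesis using assms[of s 0] assms[of s 1] by (simp; linarith)
  next
    case False
    then have "\<phi> 1 - \<phi> 0 = - 1" using assms[of 1 0] by linarith
    then show ?thesis using assms[of s 0] assms[of s 1] by (simp; linarith)
  qed
qed

text \<open>An arbitrary arclength parametrization differs from \<open>line_param\<close> only by a
  shift c and a direction \<epsilon>, so claims about it become claims about explicit
  exponentials.\<close>

lemma arclength_param_line:
  assumes uw: "pos_light u" "pos_light w" "u \<odot> w = - 1 / 2"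
    and \<gamma>: "arclength_param \<gamma> (span {u, w} \<inter> H3)"
  obtains c \<epsilon> where "\<epsilon> = 1 \<or> \<epsilon> = - 1" "\<And>s. \<gamma> s = line_param u w (c + \<epsilon> * s)"
proof -
  have "\<forall>s. \<exists>r. \<gamma> s = line_param u w r"
    using \<gamma> range_line_param[OF uw] unfolding arclength_param_def by (metis rangeE rangeI)
  then obtain \<phi> where \<phi>: "\<And>s. \<gamma> s = line_param u w (\<phi> s)" by metis
  have "\<bar>\<phi> s - \<phi> t\<bar> = \<bar>s - t\<bar>" for s t
  proof -
    have "dH (\<gamma> s) (\<gamma> t) = \<bar>\<phi> s - \<phi> t\<bar>"
      unfolding \<phi> by (rule dH_eq_abs) (simp add: lorentz_line_param[OF uw])
    then show ?thesis using \<gamma> by (simp add: arclength_param_def)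
  qed
  then obtain c \<epsilon> where "\<epsilon> = 1 \<or> \<epsilon> = - 1" "\<And>s. \<phi> s = c + \<epsilon> * s" by (rule real_isometry) blast
  then show ?thesis using that \<phi> by simp
qed

section \<open>Minimizing a positive sum of exponentials\<close>

lemma AM_GM_exp:
  fixes A E p :: real
  assumes "0 < A" "0 < E"
  shows "2 * sqrt (A * E) \<le> A * exp p + E * exp (- p)"
    "A * exp p = E * exp (- p) \<longleftrightarrow> p = ln (E / A) / 2"
    "A * exp (ln (E / A) / 2) + E * exp (- (ln (E / A) / 2)) = 2 * sqrt (A * E)"
proof -
  have "sqrt (A * E) = sqrt ((A * exp p) * (E * exp (- p)))" by (simp add: exp_minus)
  also have "\<dots> \<le> (A * exp p + E * exp (- p)) / 2"
    using assms by (intro arith_geo_mean_sqrt) auto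
  finally show "2 * sqrt (A * E) \<le> A * exp p + E * exp (- p)" by simp
  have iff: "A * exp p = E * exp (- p) \<longleftrightarrow> p = ln (E / A) / 2" for p
  proof -
    have "A * exp p = E * exp (- p) \<longleftrightarrow> exp p * exp p = E / A"
      using assms by (simp add: exp_minus field_simps)
    also have "\<dots> \<longleftrightarrow> exp (2 * p) = exp (ln (E / A))"
      using assms by (simp add: exp_add[symmetric])
    finally show ?thesis by auto
  qed
  show "A * exp p = E * exp (- p) \<longleftrightarrow> p = ln (E / A) / 2" by (rule iff)
  define p0 where "p0 = ln (E / A) / 2"
  have eq: "A * exp p0 = E * exp (- p0)" using iff p0_def by blast
  have "sqrt (A * E) = sqrt ((A * exp p0) * (E * exp (- p0)))"
    by (simp add: exp_minus)
  also have "\<dots> = sqrt ((A * exp p0) * (A * exp p0))" using eq by simp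
  also have "\<dots> = A * exp p0" using assms by simp
  finally show "A * exp (ln (E / A) / 2) + E * exp (- (ln (E / A) / 2)) = 2 * sqrt (A * E)"
    using eq by (simp add: p0_def)
qed

text \<open>Each pair of opposite exponentials is least where its two terms agree. The last
  conclusion locates the minimum on the first line; its sign later shows on which side of the plane
  the transversal ends.\<close>

lemma critical_point_exp_sum:
  fixes A B C E \<epsilon> \<delta> c d :: real
  assumes pos: "0 < A" "0 < B" "0 < C" "0 < E" and \<epsilon>: "\<epsilon> = 1 \<or> \<epsilon> = - 1" and \<delta>: "\<delta> = 1 \<or> \<delta> = - 1"
  defines "F \<equiv> \<lambda>s t. A * exp (s + t) + B * exp (s - t) + C * exp (- (s - t)) + E * exp (- (s + t))"
  defines "f \<equiv> \<lambda>(s, t). F (c + \<epsilon> * s) (d + \<delta> * t)"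
  obtains s t where "\<And>z. critical_point f z \<longleftrightarrow> z = (s, t)" "\<And>z. f (s, t) \<le> f z"
    "f (s, t) = 2 * sqrt (A * E) + 2 * sqrt (B * C)"
    "c + \<epsilon> * s = (ln (E / A) + ln (C / B)) / 4"
proof -
  define p where "p = ln (E / A) / 2"
  define q where "q = ln (C / B) / 2"
  \<comment> \<open>The solutions of \<open>c + \<epsilon> * s = (p + q) / 2\<close> and
    \<open>d + \<delta> * t = (p - q) / 2\<close>; a sign is its own inverse.\<close>
  define s where "s = \<epsilon> * ((p + q) / 2 - c)"
  define t where "t = \<delta> * ((p - q) / 2 - d)"
  have st: "c + \<epsilon> * s = (p + q) / 2" "d + \<delta> * t = (p - q) / 2"
    using \<epsilon> \<delta> by (auto simp: s_def t_def)
  have fst_st: "f (s, t) = 2 * sqrt (A * E) + 2 * sqrt (B * C)"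
  proof -
    have "f (s, t) = (A * exp p + E * exp (- p)) + (B * exp q + C * exp (- q))"
      unfolding f_def F_def prod.case st by (simp add: field_simps)
    then show ?thesis using AM_GM_exp(3) pos unfolding p_def q_def by simp
  qed
  have min: "f (s, t) \<le> f z" for z
  proof -
    obtain s' t' where z: "z = (s', t')" by force
    let ?p = "(c + \<epsilon> * s') + (d + \<delta> * t')" and ?q = "(c + \<epsilon> * s') - (d + \<delta> * t')"
    have "f z = (A * exp ?p + E * exp (- ?p)) + (B * exp ?q + C * exp (- ?q))"
      unfolding f_def F_def z prod.case by (simp only: ac_simps)
    then show ?thesis
      using AM_GM_exp(1)[OF pos(1,4), of ?p] AM_GM_exp(1)[OF pos(2,3), of ?q] fst_st by linarith
  qed
  have crit: "critical_point f z \<longleftrightarrow> z = (s, t)" for z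
  proof -
    obtain s' t' where z: "z = (s', t')" by force
    let ?p = "(c + \<epsilon> * s') + (d + \<delta> * t')" and ?q = "(c + \<epsilon> * s') - (d + \<delta> * t')"
    \<comment> \<open>The derivatives of the two one-variable sums. The partial derivatives of f are
      \<epsilon> (\<open>?P\<close> + \<open>?Q\<close>) and \<delta> (\<open>?P\<close> -
      \<open>?Q\<close>), so the gradient vanishes exactly when both \<open>?P\<close> and
      \<open>?Q\<close> do.\<close>
    let ?P = "A * exp ?p - E * exp (- ?p)" and ?Q = "B * exp ?q - C * exp (- ?q)"
    let ?D = "\<lambda>h :: real \<times> real. \<epsilon> * fst h * (?P + ?Q) + \<delta> * snd h * (?P - ?Q)"
    have e: "((\<lambda>z. K * exp (k + a * fst z + b * snd z)) has_derivative
        (\<lambda>h. K * exp (k + a * fst z + b * snd z) * (a * fst h + b * snd h))) (at z)"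
      for K k a b :: real
      by (auto intro!: derivative_eq_intros simp: algebra_simps)
    have f: "f = (\<lambda>z. A * exp (c + d + \<epsilon> * fst z + \<delta> * snd z)
        + B * exp (c - d + \<epsilon> * fst z + (- \<delta>) * snd z)
        + C * exp (d - c + (- \<epsilon>) * fst z + \<delta> * snd z)
        + E * exp (- c - d + (- \<epsilon>) * fst z + (- \<delta>) * snd z))"
      by (auto simp: f_def F_def algebra_simps)
    have p: "c + d + \<epsilon> * fst z + \<delta> * snd z = ?p" "- c - d + (- \<epsilon>) * fst z + (- \<delta>) * snd z = - ?p"
      and q: "c - d + \<epsilon> * fst z + (- \<delta>) * snd z = ?q" "d - c + (- \<epsilon>) * fst z + \<delta> * snd z = - ?q"
      by (simp_all add: z)
    have "(f has_derivative (\<lambda>h. A * exp ?p * (\<epsilon> * fst h + \<delta> * snd h) + B * exp ?q * (\<epsilon> * fst h + - \<delta> * snd h)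
        + C * exp (- ?q) * (- \<epsilon> * fst h + \<delta> * snd h) + E * exp (- ?p) * (- \<epsilon> * fst h + - \<delta> * snd h))) (at z)"
      unfolding f
      by (intro has_derivative_add e[of A "c + d" \<epsilon> \<delta>, unfolded p] e[of B "c - d" \<epsilon> "- \<delta>", unfolded q]
          e[of C "d - c" "- \<epsilon>" \<delta>, unfolded q] e[of E "- c - d" "- \<epsilon>" "- \<delta>", unfolded p])
    moreover have "A * P * (\<epsilon> * x + \<delta> * y) + B * Q * (\<epsilon> * x + - \<delta> * y) + C * Q' * (- \<epsilon> * x + \<delta> * y) +
        E * P' * (- \<epsilon> * x + - \<delta> * y) =
        \<epsilon> * x * ((A * P - E * P') + (B * Q - C * Q')) + \<delta> * y * ((A * P - E * P') - (B * Q - C * Q'))"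
      for P P' Q Q' x y :: real by (simp add: algebra_simps)
    ultimately have D: "(f has_derivative ?D) (at z)" by (simp only:)
    have "critical_point f z \<longleftrightarrow> ?D = (\<lambda>_. 0)"
    proof
      assume "critical_point f z"
      then show "?D = (\<lambda>_. 0)" unfolding critical_point_def by (rule has_derivative_unique[OF D])
    next
      assume "?D = (\<lambda>_. 0)"
      with D show "critical_point f z" unfolding critical_point_def by (rule subst[rotated])
    qed
    also have "\<dots> \<longleftrightarrow> ?P = 0 \<and> ?Q = 0"
    proof
      assume "?D = (\<lambda>_. 0)"
      then have "?D (1, 0) = 0" "?D (0, 1) = 0" by meson+
      then have "?P + ?Q = 0" "?P - ?Q = 0" using \<epsilon> \<delta> by auto
      then show "?P = 0 \<and> ?Q = 0" by linarith
    qed auto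
    also have "\<dots> \<longleftrightarrow> ?p = p \<and> ?q = q"
      using AM_GM_exp(2)[OF pos(1,4), of ?p] AM_GM_exp(2)[OF pos(2,3), of ?q]
      unfolding p_def q_def by auto
    also have "\<dots> \<longleftrightarrow> c + \<epsilon> * s' = c + \<epsilon> * s \<and> d + \<delta> * t' = d + \<delta> * t"
      unfolding st by auto
    also have "\<dots> \<longleftrightarrow> z = (s, t)" using \<epsilon> \<delta> z by auto
    finally show ?thesis .
  qed
  show ?thesis using that[OF crit min fst_st] st(1) by (simp add: p_def q_def)
qed

section \<open>Partially truncated tetrahedra\<close>

lemma perp_ray_eq:
  assumes "n \<odot> n = 1" "pos_light x" "0 < n \<odot> x"
  shows "perp_ray (plane_of n) x = geodesic_ray (foot n x) x"
  unfolding perp_ray_def perp_geodesic_eq[OF assms] plane_inter_perp[OF assms] by simp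

text \<open>As \<open>n \<odot> u = 1 / 2\<close>, the vector u - n is the mirror image of u in the
  plane, that is, the other ideal endpoint of the perpendicular. In this parametrization the foot
  has parameter 0.\<close>

lemma perp_geodesic_line:
  assumes n: "n \<odot> n = 1" and x: "pos_light x" "0 < n \<odot> x"
  defines "u \<equiv> (1 / (2 * (n \<odot> x))) *\<^sub>R x"
  shows "pos_light u" "pos_light (u - n)" "u \<odot> (u - n) = - 1 / 2"
    "perp_geodesic (plane_of n) x = span {u, u - n} \<inter> H3"
proof -
  have xx: "x \<odot> x = 0" and xn: "x \<odot> n = n \<odot> x" using pos_lightD x by (auto simp: lorentz_commute)
  show u: "pos_light u" using x pos_lightD(1)[OF x(1)] xx by (intro pos_lightI) (auto simp: u_def)
  show uw: "u \<odot> (u - n) = - 1 / 2" using x xx xn by (simp add: u_def)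
  have w: "(u - n) \<odot> (u - n) = 0" using n x xx xn by (simp add: u_def)
  have "foot n x \<odot> (u - n) = - 1 / 2"
    using n x xx xn by (simp add: foot_def u_def)
  then have "0 < (u - n)$1"
    by (intro positive_if_lorentz_neg[OF _ _ foot_props(1)[OF n x]]) (use w uw in \<open>auto simp only:\<close>, simp_all)
  then show "pos_light (u - n)" using w by (rule pos_lightI)
  have "u \<in> span {n, x}" unfolding u_def by (intro span_scale span_base) auto
  then have 1: "span {u, u - n} \<subseteq> span {n, x}"
    by (intro span_minimal subspace_span) (auto intro: span_diff span_base)
  have u': "u \<in> span {u, u - n}" and "u - n \<in> span {u, u - n}" by (auto intro: span_base)
  then have "u - (u - n) \<in> span {u, u - n}" by (rule span_diff)
  moreover have "x = (2 * (n \<odot> x)) *\<^sub>R u" using x by (simp add: u_def)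
  then have "x \<in> span {u, u - n}" using u' by (metis span_scale)
  ultimately have "span {n, x} \<subseteq> span {u, u - n}"
    by (intro span_minimal subspace_span) auto
  with 1 show "perp_geodesic (plane_of n) x = span {u, u - n} \<inter> H3"
    using perp_geodesic_eq[OF n x] by simp
qed

lemma geodesic_joining_line:
  assumes x: "pos_light x" "pos_light y" "x \<odot> y < 0"
  defines "r \<equiv> 1 / sqrt (- 2 * (x \<odot> y))"
  shows "0 < r" "pos_light (r *\<^sub>R x)" "pos_light (r *\<^sub>R y)" "(r *\<^sub>R x) \<odot> (r *\<^sub>R y) = - 1 / 2"
    "geodesic_joining x y = span {r *\<^sub>R x, r *\<^sub>R y} \<inter> H3"
proof -
  show r: "0 < r" using x by (simp add: r_def)
  show "pos_light (r *\<^sub>R x)" "pos_light (r *\<^sub>R y)"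
    using r x pos_lightD by (auto intro!: pos_lightI)
  have "r * r = 1 / (- 2 * (x \<odot> y))" using x by (simp add: r_def)
  then show "(r *\<^sub>R x) \<odot> (r *\<^sub>R y) = - 1 / 2"
    using x by (simp add: field_simps)
  have "span {r *\<^sub>R x, r *\<^sub>R y} = span {x, y}"
  proof
    show "span {r *\<^sub>R x, r *\<^sub>R y} \<subseteq> span {x, y}"
      by (intro span_minimal subspace_span) (auto intro!: span_scale intro: span_base)
    have "x = (1 / r) *\<^sub>R (r *\<^sub>R x)" "y = (1 / r) *\<^sub>R (r *\<^sub>R y)" using r by auto
    then have "x \<in> span {r *\<^sub>R x, r *\<^sub>R y}" "y \<in> span {r *\<^sub>R x, r *\<^sub>R y}"
      by (metis insertCI span_base span_scale)+
    then show "span {x, y} \<subseteq> span {r *\<^sub>R x, r *\<^sub>R y}"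
      by (intro span_minimal subspace_span) auto
  qed
  then show "geodesic_joining x y = span {r *\<^sub>R x, r *\<^sub>R y} \<inter> H3"
    using geodesic_joining_eq[OF x] by simp
qed

section \<open>Half-spaces bounding the nondegenerate tetrahedron\<close>

lemma half_space_eqI:
  assumes "0 < m \<odot> m" "Q {v \<in> H3. 0 \<le> m \<odot> v}" "\<not> Q {v \<in> H3. m \<odot> v \<le> 0}"
  shows "(THE H. is_half H3 (plane_of m) H \<and> Q H) = {v \<in> H3. 0 \<le> m \<odot> v}"
proof -
  obtain p where "linear_cut UNIV (\<lambda>v. m \<odot> v) p m" using linear_cut_normal[OF assms(1)] .
  from linear_cut.half_eqI[OF this, of Q] assms(2,3) show ?thesis
    by (simp add: plane_of_def)
qed

text \<open>A point of a perpendicular ray is a nonnegative combination of a foot and an ideal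
  vertex; the form m is 0 at the vertex and - (m \<odot> n) > 0 at the foot. The foot also rules out
  the opposite half.\<close>

lemma ideal_face_half_eq:
  assumes n: "n \<odot> n = 1" and x: "pos_light x" "pos_light y" "pos_light z"
    "0 < n \<odot> x" "0 < n \<odot> y" "0 < n \<odot> z"
    and m: "0 < m \<odot> m" "ideal_face_plane x y z = plane_of m" "m \<odot> x = 0" "m \<odot> y = 0" "m \<odot> z = 0"
      "m \<odot> n < 0"
  shows "ideal_face_half (plane_of n) x y z = {v \<in> H3. 0 \<le> m \<odot> v}"
  unfolding ideal_face_half_def m(2)
proof (rule half_space_eqI[OF m(1)])
  have "perp_ray (plane_of n) a \<subseteq> {v \<in> H3. 0 \<le> m \<odot> v}"
    if a: "pos_light a" "0 < n \<odot> a" "m \<odot> a = 0" for a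
    using a m(6) unfolding perp_ray_eq[OF n a(1,2)] geodesic_ray_def foot_def
    by (auto simp: mult_nonneg_nonpos)
  then show "perp_ray (plane_of n) x \<subseteq> {v \<in> H3. 0 \<le> m \<odot> v} \<and>
      perp_ray (plane_of n) y \<subseteq> {v \<in> H3. 0 \<le> m \<odot> v} \<and>
      perp_ray (plane_of n) z \<subseteq> {v \<in> H3. 0 \<le> m \<odot> v}"
    using x m by blast
  have "foot n x \<in> geodesic_ray (foot n x) x"
    unfolding geodesic_ray_def using foot_props(1)[OF n x(1,4)]
    by (intro CollectI conjI exI[of _ 1] exI[of _ 0]) auto
  moreover have "0 < m \<odot> foot n x" using m(3,6) by (simp add: foot_def)
  ultimately show "\<not> (perp_ray (plane_of n) x \<subseteq> {v \<in> H3. m \<odot> v \<le> 0} \<and>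
      perp_ray (plane_of n) y \<subseteq> {v \<in> H3. m \<odot> v \<le> 0} \<and>
      perp_ray (plane_of n) z \<subseteq> {v \<in> H3. m \<odot> v \<le> 0})"
    unfolding perp_ray_eq[OF n x(1,4)] by fastforce
qed

text \<open>Every point of the three geodesics is a combination in which x has a positive
  coefficient and the remaining vectors are killed by m.\<close>

lemma ortho_face_half_eq:
  assumes n: "n \<odot> n = 1" and x: "pos_light x" "pos_light y" "pos_light z"
    "0 < n \<odot> x" "x \<odot> y < 0" "x \<odot> z < 0"
    and m: "0 < m \<odot> m" "ortho_face_plane (plane_of n) y z = plane_of m" "m \<odot> n = 0" "m \<odot> y = 0"
      "m \<odot> z = 0" "0 < m \<odot> x"
  shows "ortho_face_half (plane_of n) x y z = {v \<in> H3. 0 \<le> m \<odot> v}"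
  unfolding ortho_face_half_def m(2)
proof (rule half_space_eqI[OF m(1)])
  note pl = perp_geodesic_line[OF n x(1,4)]
  have "perp_geodesic (plane_of n) x \<subseteq> {v \<in> H3. 0 \<le> m \<odot> v}"
    unfolding pl(4) range_line_param[OF pl(1-3), symmetric]
    using line_param_H3[OF pl(1-3)] m x by (auto simp: line_param_def)
  moreover have "geodesic_joining x a \<subseteq> {v \<in> H3. 0 \<le> m \<odot> v}"
    if a: "pos_light a" "x \<odot> a < 0" "m \<odot> a = 0" for a
  proof -
    note jl = geodesic_joining_line[OF x(1) a(1,2)]
    show ?thesis
      unfolding jl(5) range_line_param[OF jl(2-4), symmetric]
      using line_param_H3[OF jl(2-4)] jl(1) m x a by (auto simp: line_param_def)
  qed
  ultimately show "perp_geodesic (plane_of n) x \<subseteq> {v \<in> H3. 0 \<le> m \<odot> v} \<and>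
      geodesic_joining x y \<subseteq> {v \<in> H3. 0 \<le> m \<odot> v} \<and> geodesic_joining x z \<subseteq> {v \<in> H3. 0 \<le> m \<odot> v}"
    using x m by blast
  have "foot n x \<in> perp_geodesic (plane_of n) x"
    using foot_props[OF n x(1,4)] perp_geodesic_eq[OF n x(1,4)] by blast
  moreover have "0 < m \<odot> foot n x" using m x by (simp add: foot_def)
  ultimately show "\<not> (perp_geodesic (plane_of n) x \<subseteq> {v \<in> H3. m \<odot> v \<le> 0} \<and>
      geodesic_joining x y \<subseteq> {v \<in> H3. m \<odot> v \<le> 0} \<and> geodesic_joining x z \<subseteq> {v \<in> H3. m \<odot> v \<le> 0})"
    by fastforce
qed

text \<open>The form of this face kills y, z and n, so of the coefficients of v only \<alpha>
  counts. It cannot kill x too, for then n would lie in \<open>span {x, y, z}\<close>.\<close>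

lemma mem_ortho_face_half:
  assumes n: "n \<odot> n = 1" and x: "pos_light x" "pos_light y" "pos_light z"
    "0 < n \<odot> x" "x \<odot> y < 0" "x \<odot> z < 0" "y \<odot> z < 0"
    and nin: "n \<notin> span {x, y, z}"
    and v: "v \<in> H3" "v = \<alpha> *\<^sub>R x + \<beta> *\<^sub>R y + \<gamma> *\<^sub>R z - \<nu> *\<^sub>R n" "0 \<le> \<alpha>"
  shows "v \<in> ortho_face_half (plane_of n) x y z"
proof -
  have nin': "n \<notin> span {y, z}" using nin span_mono[of "{y, z}" "{x, y, z}"] by blast
  obtain m where m: "0 < m \<odot> m" "{v. m \<odot> v = 0} = span {n, y, z}"
    "ortho_face_plane (plane_of n) y z = plane_of m"
    using ortho_face_plane_eq[OF n x(2,3,7) nin'] .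
  have m0: "m \<odot> n = 0" "m \<odot> y = 0" "m \<odot> z = 0" using m(2) by (auto intro: span_base)
  have "m \<odot> x \<noteq> 0"
  proof
    assume "m \<odot> x = 0"
    then have "x \<in> span {n, y, z}" using m(2) by blast
    then obtain a b c where x': "x = a *\<^sub>R n + b *\<^sub>R y + c *\<^sub>R z" by (auto simp: span_triple_iff)
    have "a \<noteq> 0"
    proof
      assume "a = 0"
      then have "x \<in> span {y, z}" using x' by (auto simp: span_pair_iff)
      moreover have "x \<notin> {y, z}"
        using x(5,6) pos_lightD(2)[OF x(2)] pos_lightD(2)[OF x(3)] by auto
      then have "x \<notin> span {y, z}"
        using light_triple_independent(1)[OF x(1-3,5-7)] by (simp add: independent_insert)
      ultimately show False by blast
    qed
    then have "n = (1 / a) *\<^sub>R x + (- b / a) *\<^sub>R y + (- c / a) *\<^sub>R z"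
      by (simp add: x' scaleR_add_right)
    then have "n \<in> span {x, y, z}" unfolding span_triple_iff by blast
    then show False using nin by simp
  qed
  then consider "0 < m \<odot> x" | "0 < (- m) \<odot> x" by fastforce
  then obtain m' where m': "0 < m' \<odot> m'" "ortho_face_plane (plane_of n) y z = plane_of m'"
    "m' \<odot> n = 0" "m' \<odot> y = 0" "m' \<odot> z = 0" "0 < m' \<odot> x"
    using m m0 by cases (auto simp: plane_of_def intro: that[of m] that[of "- m"])
  have "0 \<le> m' \<odot> v" using m' v by simp
  then show ?thesis using ortho_face_half_eq[OF n x(1-6) m'] v(1) by simp
qed

text \<open>Null coordinates in the plane \<open>U\<close> of a degenerate tetrahedron: \<open>v = A u1 + B u2 + N n\<close> with
  \<open>v \<odot> v = N\<^sup>2 - A B\<close>. The ideal points on the side of \<open>n\<close> are the classes of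
  \<open>(A, B, N) = (\<rho>\<^sup>2, 1, \<rho>)\<close>, and their order along the boundary is that of \<open>\<rho> > 0\<close>.\<close>

locale null_coordinates =
  fixes n u1 u2 :: "real^4" and U :: "(real^4) set"
  assumes n: "n \<odot> n = 1" "n \<in> U" and u: "pos_light u1" "pos_light u2" "u1 \<odot> u2 = - 1 / 2"
    "n \<odot> u1 = 0" "n \<odot> u2 = 0" "u1 \<in> U" "u2 \<in> U"
    and U: "subspace U"
    and expand: "\<And>v. v \<in> U \<Longrightarrow> v = (- 2 * (u2 \<odot> v)) *\<^sub>R u1 + (- 2 * (u1 \<odot> v)) *\<^sub>R u2 + (n \<odot> v) *\<^sub>R n"
begin

definition A where "A v = - 2 * (u2 \<odot> v)"
definition B where "B v = - 2 * (u1 \<odot> v)"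
definition \<rho> where "\<rho> x = (n \<odot> x) / B x"

lemma expand': "v \<in> U \<Longrightarrow> v = A v *\<^sub>R u1 + B v *\<^sub>R u2 + (n \<odot> v) *\<^sub>R n"
  unfolding A_def B_def by (rule expand)

lemma lin: "A (v + w) = A v + A w" "A (r *\<^sub>R v) = r * A v" "B (v + w) = B v + B w" "B (r *\<^sub>R v) = r * B v"
  "A (v - w) = A v - A w" "B (v - w) = B v - B w"
  by (simp_all add: A_def B_def algebra_simps)

lemma base: "A u1 = 1" "A u2 = 0" "A n = 0" "B u1 = 0" "B u2 = 1" "B n = 0" "n \<odot> u1 = 0" "n \<odot> u2 = 0"
  using u pos_lightD(2)[OF u(1)] pos_lightD(2)[OF u(2)] by (auto simp: A_def B_def lorentz_commute)

lemma lorentz_coords: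
  assumes "v \<in> U" "w \<in> U"
  shows "v \<odot> w = (n \<odot> v) * (n \<odot> w) - (A v * B w + B v * A w) / 2"
proof -
  have "v \<odot> w = A v * (u1 \<odot> w) + B v * (u2 \<odot> w) + (n \<odot> v) * (n \<odot> w)"
    by (subst expand'[OF assms(1)]) simp
  then show ?thesis by (simp add: A_def B_def field_simps)
qed

lemma coords_H3:
  assumes "v \<in> U" "v \<in> H3" shows "0 < A v" "0 < B v"
  using lorentz_H3_light_neg[OF assms(2)] u(1,2) by (auto simp: A_def B_def lorentz_commute)

lemma coords_ideal:
  assumes "x \<in> U" "pos_light x" "0 < n \<odot> x"
  shows "0 < B x" "0 < \<rho> x" "A x = (\<rho> x)\<^sup>2 * B x" "n \<odot> x = \<rho> x * B x"
proof -
  have "0 \<le> B x" using lorentz_light_light_nonpos[OF u(1) assms(2)] by (simp add: B_def)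
  moreover have eq: "A x * B x = (n \<odot> x)\<^sup>2"
    using lorentz_coords[OF assms(1,1)] pos_lightD(2)[OF assms(2)] by (simp add: power2_eq_square)
  ultimately show b: "0 < B x" using assms(3) by (cases "B x = 0") auto
  then show "0 < \<rho> x" "n \<odot> x = \<rho> x * B x" using assms(3) by (auto simp: \<rho>_def)
  show "A x = (\<rho> x)\<^sup>2 * B x" using b eq by (simp add: \<rho>_def power2_eq_square field_simps)
qed

text \<open>For such ideal points the product x \<odot> y is - (1/2) B x B y times the square of
  \<rho> x - \<rho> y.\<close>

lemma \<rho>_distinct:
  assumes x: "x \<in> U" "pos_light x" "0 < n \<odot> x" and y: "y \<in> U" "pos_light y" "0 < n \<odot> y"
    and xy: "x \<odot> y < 0"
  shows "\<rho> x \<noteq> \<rho> y"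
proof
  assume "\<rho> x = \<rho> y"
  then have "x \<odot> y = 0"
    using lorentz_coords[OF x(1) y(1)] coords_ideal[OF x] coords_ideal[OF y]
    by (simp add: power2_eq_square)
  with xy show False by simp
qed

text \<open>The form that vanishes at n and x. At an ideal point y on the side of n it has the sign
  of \<rho> y - \<rho> x, since both parameters are positive.\<close>

definition perp_form where "perp_form x v = A v - (\<rho> x)\<^sup>2 * B v"
text \<open>The polynomial (T - \<rho> x) (T - \<rho> y) with T^2, T and 1 replaced by A v, n
  \<odot> v and B v; an ideal point on the side of n evaluates it at its own parameter, up to a
  positive factor.\<close>

definition joining_form where "joining_form x y v = A v - (\<rho> x + \<rho> y) * (n \<odot> v) + \<rho> x * \<rho> y * B v"

lemma perp_form_linear: "linear (perp_form x)"
  by (rule linearI) (simp_all add: perp_form_def lin algebra_simps)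

lemma joining_form_linear: "linear (joining_form x y)"
  by (rule linearI) (simp_all add: joining_form_def lin algebra_simps)

lemma perp_form_ideal:
  "y \<in> U \<Longrightarrow> pos_light y \<Longrightarrow> 0 < n \<odot> y \<Longrightarrow>
    perp_form x y = B y * (\<rho> y + \<rho> x) * (\<rho> y - \<rho> x)"
  using coords_ideal[of y] by (simp add: perp_form_def power2_eq_square algebra_simps)

lemma joining_form_ideal:
  "z \<in> U \<Longrightarrow> pos_light z \<Longrightarrow> 0 < n \<odot> z \<Longrightarrow>
    joining_form x y z = B z * (\<rho> z - \<rho> x) * (\<rho> z - \<rho> y)"
  using coords_ideal[of z] by (simp add: joining_form_def power2_eq_square algebra_simps)

lemma perp_geodesic_zero:
  assumes x: "x \<in> U" "pos_light x" "0 < n \<odot> x"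
  shows "perp_geodesic (plane_of n) x = {v \<in> U \<inter> H3. perp_form x v = 0}"
proof -
  note c = coords_ideal[OF x]
  have "v \<in> span {n, x}" if v: "v \<in> U" "perp_form x v = 0" for v
  proof -
    \<comment> \<open>The coefficients are dictated by the coordinates B v and n \<odot> v; the
      vanishing of the form is what makes the third coordinate \<open>A w\<close> vanish as
      well.\<close>
    define w where "w = v - ((n \<odot> v) - \<rho> x * B v) *\<^sub>R n - (B v / B x) *\<^sub>R x"
    have "A v = (\<rho> x)\<^sup>2 * B v" using v(2) by (simp add: perp_form_def)
    then have "A w = 0" "B w = 0" "n \<odot> w = 0"
      using c n by (simp_all add: w_def lin base)
    moreover have "w \<in> U" unfolding w_def using v x n U by (intro subspace_diff subspace_scale) auto
    ultimately have "w = 0" using expand'[of w] by simp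
    then have "v = ((n \<odot> v) - \<rho> x * B v) *\<^sub>R n + (B v / B x) *\<^sub>R x" by (simp add: w_def algebra_simps)
    then show ?thesis unfolding span_pair_iff by blast
  qed
  moreover have "v \<in> U \<and> perp_form x v = 0" if "v \<in> span {n, x}" for v
  proof -
    obtain \<alpha> \<beta> where "v = \<alpha> *\<^sub>R n + \<beta> *\<^sub>R x" using \<open>v \<in> span {n, x}\<close> by (auto simp: span_pair_iff)
    then show ?thesis
      using U n x c by (auto simp: perp_form_def lin base intro!: subspace_add subspace_scale)
  qed
  ultimately have "span {n, x} = {v \<in> U. perp_form x v = 0}" by blast
  then show ?thesis using perp_geodesic_eq[OF n(1) x(2,3)] by auto
qed

lemma geodesic_joining_zero:
  assumes x: "x \<in> U" "pos_light x" "0 < n \<odot> x" and y: "y \<in> U" "pos_light y" "0 < n \<odot> y"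
    and xy: "x \<odot> y < 0"
  shows "geodesic_joining x y = {v \<in> U \<inter> H3. joining_form x y v = 0}"
proof -
  note cx = coords_ideal[OF x] and cy = coords_ideal[OF y]
  note ne = \<rho>_distinct[OF assms]
  have "v \<in> span {x, y}" if v: "v \<in> U" "joining_form x y v = 0" for v
  proof -
    \<comment> \<open>Cramer's rule for a + b = B v and a \<rho> x + b \<rho> y = n \<odot> v. The
      vanishing of the form supplies the third equation, a (\<rho> x)^2 + b (\<rho> y)^2 = A
      v.\<close>
    define a where "a = ((n \<odot> v) - \<rho> y * B v) / (\<rho> x - \<rho> y)"
    define b where "b = ((n \<odot> v) - \<rho> x * B v) / (\<rho> y - \<rho> x)"
    define w where "w = v - (a / B x) *\<^sub>R x - (b / B y) *\<^sub>R y"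
    have d: "\<rho> x - \<rho> y \<noteq> 0" "\<rho> y - \<rho> x \<noteq> 0" using ne by auto
    have ab: "a * (\<rho> x - \<rho> y) = (n \<odot> v) - \<rho> y * B v" "b * (\<rho> x - \<rho> y) = \<rho> x * B v - (n \<odot> v)"
      using d by (auto simp: a_def b_def field_simps)
    have "(a + b) * (\<rho> x - \<rho> y) = B v * (\<rho> x - \<rho> y)"
      unfolding distrib_right ab by (simp add: algebra_simps)
    then have sum1: "a + b = B v" using d by simp
    then have Bw: "B w = 0" using cx(1) cy(1) by (simp add: w_def lin)
    have "(a * \<rho> x + b * \<rho> y) * (\<rho> x - \<rho> y) = \<rho> x * (a * (\<rho> x - \<rho> y)) + \<rho> y * (b * (\<rho> x - \<rho> y))"
      by (simp add: algebra_simps)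
    also have "\<dots> = (n \<odot> v) * (\<rho> x - \<rho> y)" unfolding ab by (simp add: algebra_simps)
    finally have sum2: "a * \<rho> x + b * \<rho> y = n \<odot> v" using d by simp
    then have Nw: "n \<odot> w = 0" using cx cy by (simp add: w_def)
    have "A v = (\<rho> x + \<rho> y) * (n \<odot> v) - \<rho> x * \<rho> y * B v" using v(2) by (simp add: joining_form_def)
    also have "\<dots> = (\<rho> x + \<rho> y) * (a * \<rho> x + b * \<rho> y) - \<rho> x * \<rho> y * (a + b)"
      unfolding sum1 sum2 by simp
    also have "\<dots> = a * (\<rho> x)\<^sup>2 + b * (\<rho> y)\<^sup>2" by (simp add: power2_eq_square algebra_simps)
    finally have Aw: "A w = 0" using cx cy by (simp add: w_def lin)
    have "w \<in> U" unfolding w_def using v x y U by (intro subspace_diff subspace_scale) auto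
    from expand'[OF this] have "w = 0" using Aw Bw Nw by simp
    then have "v = (a / B x) *\<^sub>R x + (b / B y) *\<^sub>R y" by (simp add: w_def algebra_simps)
    then show ?thesis unfolding span_pair_iff by blast
  qed
  moreover have "v \<in> U \<and> joining_form x y v = 0" if "v \<in> span {x, y}" for v
  proof -
    obtain \<alpha> \<beta> where v: "v = \<alpha> *\<^sub>R x + \<beta> *\<^sub>R y" using \<open>v \<in> span {x, y}\<close> by (auto simp: span_pair_iff)
    have "joining_form x y v = \<alpha> * joining_form x y x + \<beta> * joining_form x y y"
      unfolding v using joining_form_linear by (simp add: linear_add linear_cmul)
    then show ?thesis
      using U x y v by (simp add: joining_form_ideal subspace_add subspace_scale)
  qed
  ultimately have "span {x, y} = {v \<in> U. joining_form x y v = 0}" by blast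
  then show ?thesis using geodesic_joining_eq[OF x(2) y(2) xy] by auto
qed

text \<open>The sign \<sigma> selects the side, so that the half in question is always the
  nonnegative one; \<open>\<sigma> *\<^sub>R u1\<close> is a direction of growth because
  \<open>A u1 = 1\<close> and \<open>B u1 = 0\<close>.\<close>

lemma perp_cut:
  assumes x: "x \<in> U" "pos_light x" "0 < n \<odot> x" and \<sigma>: "\<sigma> = 1 \<or> \<sigma> = - 1"
  shows "linear_cut U (\<lambda>v. \<sigma> * perp_form x v) (foot n x) (\<sigma> *\<^sub>R u1)"
proof (rule linear_cut.intro)
  show "linear (\<lambda>v. \<sigma> * perp_form x v)"
    using linear_compose_scale_right[OF perp_form_linear, of \<sigma>] by simp
  show "foot n x \<in> U" unfolding foot_def using U n x by (intro subspace_diff subspace_scale) auto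
  show "foot n x \<in> H3" using foot_props[OF n(1) x(2,3)] by simp
  show "\<sigma> * perp_form x (foot n x) = 0"
    using coords_ideal[OF x] by (simp add: perp_form_def foot_def lin base)
  show "0 < \<sigma> * perp_form x (\<sigma> *\<^sub>R u1)" using \<sigma> by (auto simp: perp_form_def lin base)
qed (use U u in \<open>auto intro: subspace_scale\<close>)

lemma joining_cut:
  assumes x: "x \<in> U" "pos_light x" "0 < n \<odot> x" and y: "y \<in> U" "pos_light y" "0 < n \<odot> y"
    and xy: "x \<odot> y < 0"
  obtains p where "linear_cut U (joining_form x y) p u1"
proof -
  note jl = geodesic_joining_line[OF x(2) y(2) xy]
  obtain p where "p \<in> geodesic_joining x y"
    unfolding jl(5) range_line_param[OF jl(2-4), symmetric] by blast
  then have p: "p \<in> U" "p \<in> H3" "joining_form x y p = 0"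
    using geodesic_joining_zero[OF assms] by auto
  have "linear_cut U (joining_form x y) p u1"
    by (rule linear_cut.intro[OF U joining_form_linear p u(6)]) (simp add: joining_form_def base)
  then show ?thesis by (rule that)
qed

lemma perp_half_plane_eq:
  assumes x: "x \<in> U" "pos_light x" "0 < n \<odot> x" and y: "y \<in> U" "pos_light y" "0 < n \<odot> y"
    and z: "z \<in> U" "pos_light z" "0 < n \<odot> z"
    and \<sigma>: "\<sigma> = 1 \<or> \<sigma> = - 1" "0 < \<sigma> * (\<rho> y - \<rho> x)" "0 < \<sigma> * (\<rho> z - \<rho> x)"
  shows "perp_half_plane (U \<inter> H3) (plane_of n) x y z = {v \<in> U \<inter> H3. 0 \<le> \<sigma> * perp_form x v}"
proof -
  interpret cut: linear_cut U "\<lambda>v. \<sigma> * perp_form x v" "foot n x" "\<sigma> *\<^sub>R u1"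
    by (rule perp_cut[OF x \<sigma>(1)])
  have L: "perp_geodesic (plane_of n) x = {v \<in> U \<inter> H3. \<sigma> * perp_form x v = 0}"
    unfolding perp_geodesic_zero[OF x] using \<sigma>(1) by auto
  have pos: "0 < \<sigma> * perp_form x w" if w: "w \<in> U" "pos_light w" "0 < n \<odot> w" "0 < \<sigma> * (\<rho> w - \<rho> x)" for w
  proof -
    have "\<sigma> * perp_form x w = B w * (\<rho> w + \<rho> x) * (\<sigma> * (\<rho> w - \<rho> x))"
      unfolding perp_form_ideal[OF w(1-3)] by (simp only: ac_simps)
    moreover have "0 < B w * (\<rho> w + \<rho> x) * (\<sigma> * (\<rho> w - \<rho> x))"
      using coords_ideal[OF w(1-3)] coords_ideal[OF x] by (intro mult_pos_pos[OF _ w(4)]) simp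
    ultimately show ?thesis by (simp only:)
  qed
  show ?thesis
    unfolding perp_half_plane_def L
    by (rule cut.half_eqI)
      (use pos[OF y \<sigma>(2)] pos[OF z \<sigma>(3)] y z in
        \<open>auto simp only: cut.half_ideal_boundary_positive cut.half_ideal_boundary_negative
           mem_Collect_eq insert_subset not_le empty_subsetI simp_thms less_imp_le\<close>)
qed

lemma joining_half_plane_eq:
  assumes x: "x \<in> U" "pos_light x" "0 < n \<odot> x" and y: "y \<in> U" "pos_light y" "0 < n \<odot> y"
    and xy: "x \<odot> y < 0" and z: "z \<in> U" "pos_light z" "0 < n \<odot> z"
    and \<rho>: "0 < (\<rho> z - \<rho> x) * (\<rho> z - \<rho> y)"
  shows "joining_half_plane (U \<inter> H3) (plane_of n) x y z = {v \<in> U \<inter> H3. 0 \<le> joining_form x y v}"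
proof -
  obtain p where "linear_cut U (joining_form x y) p u1" using joining_cut[OF x y xy] .
  then interpret cut: linear_cut U "joining_form x y" p u1 .
  have pos: "0 < joining_form x y z"
    using coords_ideal(1)[OF z] \<rho> unfolding joining_form_ideal[OF z] by (simp add: mult.assoc)
  \<comment> \<open>On \<open>plane_of n\<close> the middle term is 0, while A v, B v and both
    parameters are positive.\<close>
  have "0 \<le> joining_form x y v" if "v \<in> plane_of n \<inter> (U \<inter> H3)" for v
    using that coords_H3[of v] coords_ideal(2)[OF x] coords_ideal(2)[OF y]
    by (simp add: joining_form_def plane_of_def)
  then have sub: "plane_of n \<inter> (U \<inter> H3) \<subseteq> {v \<in> U \<inter> H3. 0 \<le> joining_form x y v}" by blast
  show ?thesis
    unfolding joining_half_plane_def geodesic_joining_zero[OF x y xy]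
    by (rule cut.half_eqI)
      (use pos z sub in
        \<open>auto simp only: cut.half_ideal_boundary_positive cut.half_ideal_boundary_negative
           mem_Collect_eq not_le simp_thms less_imp_le\<close>)
qed

text \<open>At ideal points \<open>perp_form x\<close> has the sign of a difference of parameters,
  so separation means that \<rho> x lies strictly between \<rho> y and \<rho> z.\<close>

lemma separates_perp_iff:
  assumes x: "x \<in> U" "pos_light x" "0 < n \<odot> x" and y: "y \<in> U" "pos_light y" "0 < n \<odot> y"
    and z: "z \<in> U" "pos_light z" "0 < n \<odot> z"
  shows "separates (U \<inter> H3) (perp_geodesic (plane_of n) x) y z \<longleftrightarrow> (\<rho> y - \<rho> x) * (\<rho> z - \<rho> x) < 0"
proof -
  interpret cut: linear_cut U "\<lambda>v. 1 * perp_form x v" "foot n x" "1 *\<^sub>R u1"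
    by (rule perp_cut[OF x]) simp
  have "separates (U \<inter> H3) (perp_geodesic (plane_of n) x) y z \<longleftrightarrow> perp_form x y * perp_form x z < 0"
    using cut.separates_iff[OF y(2,1) z(2,1)] unfolding perp_geodesic_zero[OF x] by simp
  also have "perp_form x y * perp_form x z =
      (B y * (\<rho> y + \<rho> x) * (B z * (\<rho> z + \<rho> x))) * ((\<rho> y - \<rho> x) * (\<rho> z - \<rho> x))"
    unfolding perp_form_ideal[OF y] perp_form_ideal[OF z] by (simp add: ac_simps)
  also have "\<dots> < 0 \<longleftrightarrow> (\<rho> y - \<rho> x) * (\<rho> z - \<rho> x) < 0"
  proof -
    have "0 < B y * (\<rho> y + \<rho> x) * (B z * (\<rho> z + \<rho> x))"
      using coords_ideal[OF x] coords_ideal[OF y] coords_ideal[OF z] by (intro mult_pos_pos) auto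
    from mult_less_cancel_left_pos[OF this, of _ 0] show ?thesis by (simp only: mult_zero_right)
  qed
  finally show ?thesis .
qed

lemma mem_degenerate_tetrahedron:
  assumes x: "x \<in> U" "pos_light x" "0 < n \<odot> x" and y: "y \<in> U" "pos_light y" "0 < n \<odot> y"
    and z: "z \<in> U" "pos_light z" "0 < n \<odot> z"
    and neg: "x \<odot> y < 0" "y \<odot> z < 0"
    and mid: "(\<rho> x - \<rho> y) * (\<rho> z - \<rho> y) < 0"
    and P: "ideal_face_plane x y z = U \<inter> H3"
    and v: "v \<in> H3" "v \<in> H1" "v = \<alpha> *\<^sub>R x + \<beta> *\<^sub>R y + \<gamma> *\<^sub>R z - \<nu> *\<^sub>R n"
      "0 \<le> \<alpha>" "0 \<le> \<beta>" "0 \<le> \<gamma>" "0 \<le> \<nu>"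
  shows "v \<in> degenerate_tetrahedron (plane_of n) H1 x y z"
proof -
  note cx = coords_ideal[OF x] and cy = coords_ideal[OF y] and cz = coords_ideal[OF z]
  have vU: "v \<in> U" unfolding v(3) using U x y z n
    by (intro subspace_diff subspace_add subspace_scale) auto
  \<comment> \<open>By \<open>mid\<close>, \<rho> y lies between the other two; \<sigma> is 1 if
    \<rho> x < \<rho> y < \<rho> z and - 1 for the reverse order.\<close>
  obtain \<sigma> :: real where \<sigma>: "\<sigma> = 1 \<or> \<sigma> = - 1" "0 < \<sigma> * (\<rho> y - \<rho> x)" "0 < \<sigma> * (\<rho> z - \<rho> y)"
    using that[of 1] that[of "- 1"] mid by (auto simp: mult_less_0_iff)
  have \<sigma>zx: "0 < \<sigma> * (\<rho> z - \<rho> x)" using \<sigma>(2,3) by (simp add: algebra_simps)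
  have half1: "perp_half_plane (U \<inter> H3) (plane_of n) x y z = {v \<in> U \<inter> H3. 0 \<le> \<sigma> * perp_form x v}"
    by (rule perp_half_plane_eq[OF x y z \<sigma>(1,2) \<sigma>zx])
  have half4: "perp_half_plane (U \<inter> H3) (plane_of n) z x y = {v \<in> U \<inter> H3. 0 \<le> - \<sigma> * perp_form z v}"
    by (rule perp_half_plane_eq[OF z x y]) (use \<sigma> \<sigma>zx in \<open>auto simp: algebra_simps\<close>)
  have half2: "joining_half_plane (U \<inter> H3) (plane_of n) x y z = {v \<in> U \<inter> H3. 0 \<le> joining_form x y v}"
    by (rule joining_half_plane_eq[OF x y neg(1) z]) (use \<sigma> \<sigma>zx in \<open>auto simp: zero_less_mult_iff\<close>)
  have half3: "joining_half_plane (U \<inter> H3) (plane_of n) y z x = {v \<in> U \<inter> H3. 0 \<le> joining_form y z v}"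
    by (rule joining_half_plane_eq[OF y z neg(2) x]) (use \<sigma> \<sigma>zx in \<open>auto simp: zero_less_mult_iff\<close>)
  \<comment> \<open>It suffices to be nonnegative at the vertices and nonpositive at n. At n,
    \<open>perp_form\<close> is 0 and \<open>joining_form\<close> is minus a sum of two positive
    parameters.\<close>
  have nonneg: "0 \<le> g v"
    if g: "linear g" "0 \<le> g x" "0 \<le> g y" "0 \<le> g z" "g n \<le> 0" for g :: "real^4 \<Rightarrow> real"
  proof -
    have "g v = \<alpha> * g x + \<beta> * g y + \<gamma> * g z - \<nu> * g n"
      unfolding v(3) by (simp add: linear_add[OF g(1)] linear_diff[OF g(1)] linear_cmul[OF g(1)])
    moreover have "\<nu> * g n \<le> 0" using g v(7) by (simp add: mult_nonneg_nonpos)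
    moreover have "0 \<le> \<alpha> * g x" "0 \<le> \<beta> * g y" "0 \<le> \<gamma> * g z" using g v(4-6) by auto
    ultimately show ?thesis by linarith
  qed
  have pf: "0 \<le> s * perp_form w v"
    if w: "w \<in> U" "pos_light w" "0 < n \<odot> w" and s: "\<And>a. a \<in> {x, y, z} \<Longrightarrow> 0 \<le> s * (\<rho> a - \<rho> w)" for s w
  proof (rule nonneg)
    show "linear (\<lambda>v. s * perp_form w v)"
      using linear_compose_scale_right[OF perp_form_linear, of s] by simp
    have "0 \<le> s * perp_form w a" if a: "a \<in> {x, y, z}" for a
    proof -
      have aU: "a \<in> U" "pos_light a" "0 < n \<odot> a" using a x y z by auto
      have "s * perp_form w a = B a * (\<rho> a + \<rho> w) * (s * (\<rho> a - \<rho> w))"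
        unfolding perp_form_ideal[OF aU] by (simp only: ac_simps)
      moreover have "0 \<le> B a * (\<rho> a + \<rho> w) * (s * (\<rho> a - \<rho> w))"
        using coords_ideal[OF aU] coords_ideal[OF w] by (intro mult_nonneg_nonneg[OF _ s[OF a]]) simp
      ultimately show ?thesis by (simp only:)
    qed
    then show "0 \<le> s * perp_form w x" "0 \<le> s * perp_form w y" "0 \<le> s * perp_form w z" by auto
    show "s * perp_form w n \<le> 0" by (simp add: perp_form_def base)
  qed
  have jf: "0 \<le> joining_form a b v"
    if a: "a \<in> U" "pos_light a" "0 < n \<odot> a" and b: "b \<in> U" "pos_light b" "0 < n \<odot> b"
      and ab: "\<And>c. c \<in> {x, y, z} \<Longrightarrow> 0 \<le> (\<rho> c - \<rho> a) * (\<rho> c - \<rho> b)" for a b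
  proof (rule nonneg[OF joining_form_linear])
    have "0 \<le> joining_form a b c" if c: "c \<in> {x, y, z}" for c
    proof -
      have cU: "c \<in> U" "pos_light c" "0 < n \<odot> c" using c x y z by auto
      show ?thesis unfolding joining_form_ideal[OF cU]
        using coords_ideal(1)[OF cU] ab[OF c] by (simp add: mult.assoc)
    qed
    then show "0 \<le> joining_form a b x" "0 \<le> joining_form a b y" "0 \<le> joining_form a b z" by auto
    show "joining_form a b n \<le> 0"
      using coords_ideal(2)[OF a] coords_ideal(2)[OF b] n by (simp add: joining_form_def base)
  qed
  have "0 \<le> \<sigma> * perp_form x v" "0 \<le> - \<sigma> * perp_form z v"
    by (rule pf; use x z \<sigma> \<sigma>zx in \<open>auto simp: algebra_simps\<close>)+
  moreover have "0 \<le> joining_form x y v"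
    by (rule jf[OF x y]) (use \<sigma> \<sigma>zx in \<open>auto simp: zero_le_mult_iff\<close>)
  moreover have "0 \<le> joining_form y z v"
    by (rule jf[OF y z]) (use \<sigma> \<sigma>zx in \<open>auto simp: zero_le_mult_iff\<close>)
  ultimately show ?thesis
    unfolding degenerate_tetrahedron_def Let_def P half1 half2 half3 half4
    using v(1,2) vU by simp
qed

end

section \<open>Membership in the tetrahedron in both cases\<close>

lemma ideal_face_plane_perm:
  "ideal_face_plane y x z = ideal_face_plane x y z" "ideal_face_plane x z y = ideal_face_plane x y z"
  by (simp_all add: ideal_face_plane_def insert_commute)

text \<open>A foot e and the normal n are completed to an orthonormal frame e, f, n of U; the null
  vectors are (e + f) / 2 and (e - f) / 2.\<close>

lemma null_coordinates_exist:
  assumes n: "n \<odot> n = 1" and x: "pos_light x" "pos_light y" "0 < n \<odot> x" "0 < n \<odot> y" "x \<odot> y < 0"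
    and U: "subspace U" "dim U = 3" "n \<in> U" "x \<in> U" "y \<in> U"
  obtains u1 u2 where "null_coordinates n u1 u2 U"
proof -
  define e where "e = foot n x"
  have e: "e \<in> H3" "n \<odot> e = 0" "e \<odot> n = 0" "e \<odot> e = - 1"
    using foot_props[OF n x(1,3)] H3D(2) by (auto simp: e_def lorentz_commute)
  have eU: "e \<in> U" unfolding e_def foot_def using U by (intro subspace_diff subspace_scale) auto
  define f0 where "f0 = y + (y \<odot> e) *\<^sub>R e - (n \<odot> y) *\<^sub>R n"
  have f0: "n \<odot> f0 = 0" "e \<odot> f0 = 0"
    using n e by (simp_all add: f0_def lorentz_commute[of e y])
  have f0U: "f0 \<in> U" unfolding f0_def using U eU by (intro subspace_diff subspace_add subspace_scale) auto
  \<comment> \<open>Otherwise y would be a null vector in \<open>span {n, e}\<close> on the positive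
    side of n, hence a multiple of n + e and so of x, contrary to
    \<open>x \<odot> y < 0\<close>.\<close>
  have "f0 \<noteq> 0"
  proof
    assume "f0 = 0"
    then have y: "y = (n \<odot> y) *\<^sub>R n - (y \<odot> e) *\<^sub>R e" by (simp add: f0_def algebra_simps)
    have neg: "y \<odot> e < 0" using lorentz_H3_light_neg[OF e(1) x(2)] by (simp add: lorentz_commute)
    have "y \<odot> y = (n \<odot> y) * (n \<odot> y) - (y \<odot> e) * (e \<odot> y)"
      by (subst (1) y) simp
    then have "(n \<odot> y)\<^sup>2 = (- (y \<odot> e))\<^sup>2"
      using pos_lightD(2)[OF x(2)] by (simp add: power2_eq_square lorentz_commute)
    then have "n \<odot> y = - (y \<odot> e)" using neg x(4) by (simp add: power2_eq_iff)
    then have "y = (n \<odot> y) *\<^sub>R (n + e)" using y by (simp add: scaleR_add_right)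
    also have "n + e = (1 / (n \<odot> x)) *\<^sub>R x" by (simp add: e_def foot_def)
    finally have "x \<odot> y = 0" using pos_lightD(2)[OF x(1)] by (metis lorentz_simps(6) mult_zero_right)
    then show False using x by simp
  qed
  then have f0f0: "0 < f0 \<odot> f0" using orthogonal_to_timelike[of e f0] e f0 by simp
  define f where "f = (1 / sqrt (f0 \<odot> f0)) *\<^sub>R f0"
  have f: "f \<odot> f = 1" "n \<odot> f = 0" "e \<odot> f = 0" "f \<odot> e = 0"
    using f0f0 f0 by (auto simp: f_def lorentz_commute[of f0 e])
  have fU: "f \<in> U" unfolding f_def using f0U U by (simp add: subspace_scale)
  define u1 u2 where "u1 = (1/2) *\<^sub>R (e + f)" and "u2 = (1/2) *\<^sub>R (e - f)"
  have uu: "u1 \<odot> u1 = 0" "u2 \<odot> u2 = 0" "u1 \<odot> u2 = - 1 / 2" "n \<odot> u1 = 0" "n \<odot> u2 = 0"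
    "e \<odot> u1 = - 1 / 2" "e \<odot> u2 = - 1 / 2"
    using e f by (simp_all add: u1_def u2_def)
  then have "u1 \<noteq> 0" "u2 \<noteq> 0" by auto
  then have pl: "pos_light u1" "pos_light u2"
    using positive_if_lorentz_neg[OF _ _ e(1)] uu by (auto intro!: pos_lightI)
  have uU: "u1 \<in> U" "u2 \<in> U" unfolding u1_def u2_def
    using U eU fU by (auto intro!: subspace_scale subspace_add subspace_diff)
  have un: "u1 \<odot> n = 0" "u2 \<odot> n = 0" "u2 \<odot> u1 = - 1 / 2" using uu by (auto simp: lorentz_commute)
  have ind: "independent {u1, u2, n}" "card {u1, u2, n} = 3"
  proof -
    have 1: "n \<noteq> 0" using n by auto
    have 2: "u2 \<noteq> r *\<^sub>R n" for r using uu n un by auto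
    have 3: "u1 \<noteq> r *\<^sub>R u2 + s *\<^sub>R n" for r s
    proof
      assume "u1 = r *\<^sub>R u2 + s *\<^sub>R n"
      then have "u2 \<odot> u1 = u2 \<odot> (r *\<^sub>R u2 + s *\<^sub>R n)" by simp
      then show False using uu un by simp
    qed
    show "independent {u1, u2, n}" "card {u1, u2, n} = 3" using independent_triple[OF 1 2 3] by auto
  qed
  have Us: "U = span {u1, u2, n}"
    by (rule subspace_eq_span) (use U uU ind in auto)
  have "null_coordinates n u1 u2 U"
  proof (rule null_coordinates.intro)
    fix v assume "v \<in> U"
    then obtain a b c where v: "v = a *\<^sub>R u1 + b *\<^sub>R u2 + c *\<^sub>R n" unfolding Us span_triple_iff by blast
    have "u2 \<odot> v = - a / 2" "u1 \<odot> v = - b / 2" "n \<odot> v = c"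
      using uu un n by (simp_all add: v)
    then show "v = (- 2 * (u2 \<odot> v)) *\<^sub>R u1 + (- 2 * (u1 \<odot> v)) *\<^sub>R u2 + (n \<odot> v) *\<^sub>R n"
      using v by simp
  qed (use n U uu pl uU in auto)
  then show ?thesis by (rule that)
qed

lemma mem_truncated_tetrahedron:
  assumes n: "n \<odot> n = 1" and x: "pos_light x" "pos_light y" "pos_light z"
    "0 < n \<odot> x" "0 < n \<odot> y" "0 < n \<odot> z" "x \<odot> y < 0" "x \<odot> z < 0" "y \<odot> z < 0"
    and v: "v \<in> H3" "v \<in> H1" "v = \<alpha> *\<^sub>R x + \<beta> *\<^sub>R y + \<gamma> *\<^sub>R z - \<nu> *\<^sub>R n"
      "0 \<le> \<alpha>" "0 \<le> \<beta>" "0 \<le> \<gamma>" "0 \<le> \<nu>"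
  shows "v \<in> truncated_tetrahedron (plane_of n) H1 x y z"
proof -
  have sym: "y \<odot> x < 0" "z \<odot> x < 0" "z \<odot> y < 0" using x by (auto simp: lorentz_commute)
  obtain m where m: "0 < m \<odot> m" "{v. m \<odot> v = 0} = span {x, y, z}" "ideal_face_plane x y z = plane_of m"
    using ideal_face_plane_eq[OF x(1-3,7-9)] .
  have m0: "m \<odot> x = 0" "m \<odot> y = 0" "m \<odot> z = 0" using m(2) by (auto intro: span_base)
  have n0: "0 < n \<odot> n" using n by simp
  show ?thesis
  proof (cases "m \<odot> n = 0")
    case False
    \<comment> \<open>The normal of the ideal face is oriented so that - n lies on its positive
      side.\<close>
    then consider "m \<odot> n < 0" | "(- m) \<odot> n < 0" by fastforce
    then obtain m' where m': "0 < m' \<odot> m'" "ideal_face_plane x y z = plane_of m'"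
      "m' \<odot> x = 0" "m' \<odot> y = 0" "m' \<odot> z = 0" "m' \<odot> n < 0"
      using m m0 by cases (auto simp: plane_of_def intro: that[of m] that[of "- m"])
    have "0 \<le> m' \<odot> v" using m' v(7) by (simp add: v(3) mult_nonneg_nonpos)
    then have 1: "v \<in> ideal_face_half (plane_of n) x y z"
      using ideal_face_half_eq[OF n x(1-6) m'] v(1) by simp
    have nin: "n \<notin> span {x, y, z}" using False m(2) by blast
    have 2: "v \<in> ortho_face_half (plane_of n) x y z"
      by (rule mem_ortho_face_half[OF n x(1-4,7-9) nin v(1,3,4)])
    have 3: "v \<in> ortho_face_half (plane_of n) y x z"
      by (rule mem_ortho_face_half[OF n x(2,1,3,5) sym(1) x(9,8) _ v(1), of \<beta> \<alpha> \<gamma> \<nu>])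
        (use nin v in \<open>auto simp: insert_commute\<close>)
    have 4: "v \<in> ortho_face_half (plane_of n) z x y"
      by (rule mem_ortho_face_half[OF n x(3,1,2,6) sym(2,3) x(7) _ v(1), of \<gamma> \<alpha> \<beta> \<nu>])
        (use nin v in \<open>auto simp: insert_commute\<close>)
    have "\<not> planes_orthogonal (ideal_face_plane x y z) (plane_of n)"
      using False m planes_orthogonal_iff[OF m(1) n0] by simp
    then show ?thesis unfolding truncated_tetrahedron_def Let_def using 1 2 3 4 v(2) by simp
  next
    case True
    define U where "U = {v. m \<odot> v = 0}"
    have P: "ideal_face_plane x y z = U \<inter> H3" using m(3) by (auto simp: plane_of_def U_def)
    have mne: "m \<noteq> 0" using m(1) by auto
    have Us: "subspace U" "dim U = 3" "n \<in> U" "x \<in> U" "y \<in> U" "z \<in> U"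
      using True m0 subspace_normal dim_normal[OF mne] by (auto simp: U_def)
    obtain u1 u2 where "null_coordinates n u1 u2 U"
      using null_coordinates_exist[OF n x(1,2,4,5,7) Us(1-5)] .
    then interpret null_coordinates n u1 u2 U .
    have xU: "x \<in> U" "pos_light x" "0 < n \<odot> x" and yU: "y \<in> U" "pos_light y" "0 < n \<odot> y"
      and zU: "z \<in> U" "pos_light z" "0 < n \<odot> z" using x Us by auto
    have orth: "planes_orthogonal (ideal_face_plane x y z) (plane_of n)"
      using True m planes_orthogonal_iff[OF m(1) n0] by simp
    note s1 = separates_perp_iff[OF yU xU zU] and s2 = separates_perp_iff[OF xU yU zU]
    have d: "\<rho> x \<noteq> \<rho> y" "\<rho> x \<noteq> \<rho> z" "\<rho> y \<noteq> \<rho> z"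
      using \<rho>_distinct xU yU zU x by blast+
    show ?thesis
    proof (cases "(\<rho> x - \<rho> y) * (\<rho> z - \<rho> y) < 0")
      case True
      then show ?thesis
        using mem_degenerate_tetrahedron[OF xU yU zU x(7,9) True P v] orth s1
        by (simp add: truncated_tetrahedron_def Let_def P)
    next
      case f1: False
      show ?thesis
      proof (cases "(\<rho> y - \<rho> x) * (\<rho> z - \<rho> x) < 0")
        case True
        have "v \<in> degenerate_tetrahedron (plane_of n) H1 y x z"
          by (rule mem_degenerate_tetrahedron[OF yU xU zU sym(1) x(8) True _ v(1,2), of \<beta> \<alpha> \<gamma> \<nu>])
            (use P v ideal_face_plane_perm in auto)
        then show ?thesis
          using f1 True orth s1 s2 by (simp add: truncated_tetrahedron_def Let_def P)
      next
        case f2: False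
        \<comment> \<open>One of three distinct parameters is the middle one, and y and x have been
          excluded in the order in which the definition tests them.\<close>
        have mid: "(\<rho> x - \<rho> z) * (\<rho> y - \<rho> z) < 0"
          using f1 f2 d by (auto simp: mult_less_0_iff not_less zero_le_mult_iff)
        have "v \<in> degenerate_tetrahedron (plane_of n) H1 x z y"
          by (rule mem_degenerate_tetrahedron[OF xU zU yU x(8) sym(3) mid _ v(1,2), of \<alpha> \<gamma> \<beta> \<nu>])
            (use P v ideal_face_plane_perm in auto)
        then show ?thesis
          using f1 f2 orth s1 s2 by (simp add: truncated_tetrahedron_def Let_def P)
      qed
    qed
  qed
qed

section \<open>The transversal\<close>

text \<open>The normal is scaled to unit length, and its sign is chosen according to the side on
  which \<open>H1\<close> lies. The ideal vertices lie in the closed side but off the plane, hence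
  strictly on it.\<close>

lemma truncated_dataE:
  assumes "truncated_data P1 H1 x2 x3 x4"
  obtains n where "n \<odot> n = 1" "P1 = plane_of n" "H1 = {v \<in> H3. 0 \<le> n \<odot> v}"
    "pos_light x2" "pos_light x3" "pos_light x4" "0 < n \<odot> x2" "0 < n \<odot> x3" "0 < n \<odot> x4"
    "x2 \<odot> x3 < 0" "x2 \<odot> x4 < 0" "x3 \<odot> x4 < 0"
proof -
  obtain m where m: "0 < m \<odot> m" "P1 = plane_of m"
    using assms is_plane_iff by (auto simp: truncated_data_def)
  define n0 where "n0 = (1 / sqrt (m \<odot> m)) *\<^sub>R m"
  have n0: "n0 \<odot> n0 = 1" "P1 = plane_of n0" using m by (auto simp: n0_def plane_of_def)
  obtain p where "linear_cut UNIV (\<lambda>v. n0 \<odot> v) p n0" using linear_cut_normal[of n0] n0 by auto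
  then interpret cut: linear_cut UNIV "\<lambda>v. n0 \<odot> v" p n0 .
  have P1: "P1 = {v \<in> UNIV \<inter> H3. n0 \<odot> v = 0}" using n0 by (simp add: plane_of_def)
  have "H1 = {v \<in> UNIV \<inter> H3. 0 \<le> n0 \<odot> v} \<or> H1 = {v \<in> UNIV \<inter> H3. n0 \<odot> v \<le> 0}"
    using assms cut.is_half_iff[of H1] P1 by (simp add: truncated_data_def)
  then obtain n where n: "n \<odot> n = 1" "P1 = plane_of n" "H1 = {v \<in> H3. 0 \<le> n \<odot> v}"
    and pos: "half_ideal_boundary H3 P1 H1 - ideal_boundary P1 \<subseteq> {x. 0 < n \<odot> x}"
  proof
    assume H: "H1 = {v \<in> UNIV \<inter> H3. 0 \<le> n0 \<odot> v}"
    show ?thesis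
      by (rule that[of n0])
        (use n0 H cut.half_ideal_boundary_positive cut.ideal_boundary_zero in \<open>auto simp: plane_of_def less_le\<close>)
  next
    assume H: "H1 = {v \<in> UNIV \<inter> H3. n0 \<odot> v \<le> 0}"
    show ?thesis
      by (rule that[of "- n0"])
        (use n0 H cut.half_ideal_boundary_negative cut.ideal_boundary_zero in \<open>auto simp: plane_of_def less_le\<close>)
  qed
  show ?thesis
    by (rule that[OF n]) (use assms pos lorentz_light_light_neg in \<open>auto simp: truncated_data_def\<close>)
qed

definition cosh_transversal :: "real \<Rightarrow> real \<Rightarrow> real \<Rightarrow> real \<Rightarrow> real \<Rightarrow> real \<Rightarrow> real" where
  "cosh_transversal x y a b c d = 1 / sqrt (x * y) * (sqrt (c * (d / x + b)) + sqrt (d * (c / x + a)))"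

lemma transversal_between_edges:
  assumes n: "n \<odot> n = 1" and x: "pos_light x2" "pos_light x3" "pos_light x4"
    "0 < n \<odot> x2" "0 < n \<odot> x3" "0 < n \<odot> x4" "x2 \<odot> x3 < 0" "x2 \<odot> x4 < 0" "x3 \<odot> x4 < 0"
    and \<gamma>: "arclength_param \<gamma>12 (perp_geodesic (plane_of n) x2)"
      "arclength_param \<gamma>34 (geodesic_joining x3 x4)"
  defines "H1 \<equiv> {v \<in> H3. 0 \<le> n \<odot> v}"
  obtains s0 t0 where "\<And>z. critical_point (dist_cosh \<gamma>12 \<gamma>34) z \<longleftrightarrow> z = (s0, t0)"
    "\<And>z. dist_cosh \<gamma>12 \<gamma>34 (s0, t0) \<le> dist_cosh \<gamma>12 \<gamma>34 z"
    "dist_cosh \<gamma>12 \<gamma>34 (s0, t0) = cosh_transversal (n \<odot> x2) (- (x3 \<odot> x4) / 2) (n \<odot> x3) (n \<odot> x4)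
      (- (x2 \<odot> x3) / 2) (- (x2 \<odot> x4) / 2)"
    "\<gamma>12 s0 \<in> truncated_tetrahedron (plane_of n) H1 x2 x3 x4"
    "\<gamma>34 t0 \<in> truncated_tetrahedron (plane_of n) H1 x2 x3 x4"
    "\<gamma>12 s0 \<in> perp_ray (plane_of n) x2"
proof -
  define k where "k = n \<odot> x2"
  define r where "r = 1 / sqrt (- 2 * (x3 \<odot> x4))"
  define u where "u = (1 / (2 * k)) *\<^sub>R x2"
  define w where "w = u - n"
  note pl = perp_geodesic_line[OF n x(1,4), folded k_def, folded u_def, folded w_def]
  note jl = geodesic_joining_line[OF x(2,3,9), folded r_def]
  have k: "0 < k" and r: "0 < r" using x(4) jl(1) by (auto simp: k_def)
  obtain c \<epsilon> where c: "\<epsilon> = 1 \<or> \<epsilon> = - 1" "\<And>s. \<gamma>12 s = line_param u w (c + \<epsilon> * s)"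
    by (rule arclength_param_line[OF pl(1-3) \<gamma>(1)[unfolded pl(4)]], rule that)
  obtain d \<delta> where d: "\<delta> = 1 \<or> \<delta> = - 1" "\<And>s. \<gamma>34 s = line_param (r *\<^sub>R x3) (r *\<^sub>R x4) (d + \<delta> * s)"
    by (rule arclength_param_line[OF jl(2-4) \<gamma>(2)[unfolded jl(5)]], rule that)
  define C where "C = - (x2 \<odot> x3) / 2"
  define D where "D = - (x2 \<odot> x4) / 2"
  \<comment> \<open>Minus the pairings of the endpoints u and w of the perpendicular with the scaled
    x3 and x4. As w = u - n, passing from u to w adds r (n \<odot> x3) or r (n \<odot> x4).\<close>
  define A1 A2 A3 A4 where "A1 = r * (C / k)" and "A2 = r * (D / k)" and
    "A3 = r * (C / k + (n \<odot> x3))" and "A4 = r * (D / k + (n \<odot> x4))"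
  have CD: "0 < C" "0 < D" using x by (auto simp: C_def D_def)
  have pos: "0 < A1" "0 < A2" "0 < A3" "0 < A4"
    using r k CD x by (auto simp: A1_def A2_def A3_def A4_def intro!: mult_pos_pos add_pos_pos)
  have coeff: "u \<odot> (r *\<^sub>R x3) = - A1" "u \<odot> (r *\<^sub>R x4) = - A2" "w \<odot> (r *\<^sub>R x3) = - A3" "w \<odot> (r *\<^sub>R x4) = - A4"
    by (simp_all add: u_def w_def A1_def A2_def A3_def A4_def C_def D_def algebra_simps)
  have H: "\<gamma>12 s \<in> H3" "\<gamma>34 t \<in> H3" for s t
    unfolding c(2) d(2) using line_param_H3[OF pl(1-3)] line_param_H3[OF jl(2-4)] by auto
  have f: "dist_cosh \<gamma>12 \<gamma>34 = (\<lambda>(s, t). A1 * exp ((c + \<epsilon> * s) + (d + \<delta> * t))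
      + A2 * exp ((c + \<epsilon> * s) - (d + \<delta> * t)) + A3 * exp (- ((c + \<epsilon> * s) - (d + \<delta> * t)))
      + A4 * exp (- ((c + \<epsilon> * s) + (d + \<delta> * t))))"
  proof (intro ext, clarify)
    fix s t
    have "line_param u w s' \<odot> line_param (r *\<^sub>R x3) (r *\<^sub>R x4) t' = - (A1 * exp (s' + t') + A2 * exp (s' - t')
        + A3 * exp (- (s' - t')) + A4 * exp (- (s' + t')))" for s' t'
    proof -
      have "line_param u w s' \<odot> line_param (r *\<^sub>R x3) (r *\<^sub>R x4) t' =
          exp s' * (exp t' * (u \<odot> (r *\<^sub>R x3))) + exp s' * (exp (- t') * (u \<odot> (r *\<^sub>R x4)))
          + exp (- s') * (exp t' * (w \<odot> (r *\<^sub>R x3))) + exp (- s') * (exp (- t') * (w \<odot> (r *\<^sub>R x4)))"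
        unfolding line_param_def lorentz_simps(1,2) lorentz_simps(5,6) by (simp add: algebra_simps)
      also have "\<dots> = - (A1 * (exp s' * exp t') + A2 * (exp s' * exp (- t'))
          + A3 * (exp (- s') * exp t') + A4 * (exp (- s') * exp (- t')))"
        unfolding coeff by (simp add: algebra_simps)
      finally show ?thesis by (simp only: exp_add[symmetric]) (simp add: algebra_simps)
    qed
    then show "dist_cosh \<gamma>12 \<gamma>34 (s, t) = A1 * exp ((c + \<epsilon> * s) + (d + \<delta> * t))
      + A2 * exp ((c + \<epsilon> * s) - (d + \<delta> * t)) + A3 * exp (- ((c + \<epsilon> * s) - (d + \<delta> * t)))
      + A4 * exp (- ((c + \<epsilon> * s) + (d + \<delta> * t)))"
      unfolding dist_cosh_def prod.case cosh_dH[OF H] unfolding c(2) d(2) by (simp only: minus_minus)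
  qed
  obtain s0 t0 where crit: "\<And>z. critical_point (dist_cosh \<gamma>12 \<gamma>34) z \<longleftrightarrow> z = (s0, t0)"
    and min: "\<And>z. dist_cosh \<gamma>12 \<gamma>34 (s0, t0) \<le> dist_cosh \<gamma>12 \<gamma>34 z"
    and val: "dist_cosh \<gamma>12 \<gamma>34 (s0, t0) = 2 * sqrt (A1 * A4) + 2 * sqrt (A2 * A3)"
    and s0: "c + \<epsilon> * s0 = (ln (A4 / A1) + ln (A3 / A2)) / 4"
    by (rule critical_point_exp_sum[OF pos c(1) d(1), of c d, folded f], rule that)
  \<comment> \<open>The signed distance of \<open>\<gamma>12 s0\<close> from the plane, positive
    towards x2. It is positive because w pairs more negatively with x3 and x4 than u does.\<close>
  define \<tau> where "\<tau> = c + \<epsilon> * s0"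
  have "A1 < A3" "A2 < A4" using r x by (simp_all add: A1_def A2_def A3_def A4_def distrib_left)
  then have "0 < (ln A3 - ln A1) + (ln A4 - ln A2)" using pos by (intro add_pos_pos) auto
  also have "\<dots> = ln (A4 / A1) + ln (A3 / A2)" using pos by (simp add: ln_div)
  finally have \<tau>: "0 < \<tau>" unfolding \<tau>_def s0 by (rule divide_pos_pos) simp
  have g12: "\<gamma>12 s0 = (exp \<tau> / (2 * k) + exp (- \<tau>) / (2 * k)) *\<^sub>R x2 + 0 *\<^sub>R x3 + 0 *\<^sub>R x4 - exp (- \<tau>) *\<^sub>R n"
    by (simp add: c(2) \<tau>_def[symmetric] line_param_def w_def u_def algebra_simps)
  define \<sigma> where "\<sigma> = d + \<delta> * t0"
  have g34: "\<gamma>34 t0 = 0 *\<^sub>R x2 + (exp \<sigma> * r) *\<^sub>R x3 + (exp (- \<sigma>) * r) *\<^sub>R x4 - 0 *\<^sub>R n"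
    by (simp add: d(2) \<sigma>_def[symmetric] line_param_def)
  have n12: "n \<odot> \<gamma>12 s0 = (exp \<tau> - exp (- \<tau>)) / 2"
    using k n by (simp add: g12 k_def[symmetric] field_simps)
  have "0 \<le> n \<odot> \<gamma>12 s0" unfolding n12 using \<tau> by simp
  then have H12: "\<gamma>12 s0 \<in> H1" using H by (simp add: H1_def)
  have "0 \<le> n \<odot> \<gamma>34 t0" unfolding g34 using r x by simp
  then have H34: "\<gamma>34 t0 \<in> H1" using H by (simp add: H1_def)
  have T12: "\<gamma>12 s0 \<in> truncated_tetrahedron (plane_of n) H1 x2 x3 x4"
    by (rule mem_truncated_tetrahedron[OF n x H(1) H12 g12]) (use k in auto)
  have T34: "\<gamma>34 t0 \<in> truncated_tetrahedron (plane_of n) H1 x2 x3 x4"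
    by (rule mem_truncated_tetrahedron[OF n x H(2) H34 g34]) (use r in auto)
  \<comment> \<open>Splitting off exp (- \<tau>) times the foot leaves x2 with coefficient sinh
    \<tau> / k; it is nonnegative since \<tau> > 0, which puts the point on the ray.\<close>
  have coeff12: "exp \<tau> / (2 * k) + exp (- \<tau>) / (2 * k) = exp (- \<tau>) / k + (exp \<tau> - exp (- \<tau>)) / (2 * k)"
    using k by (simp add: field_simps)
  have "\<gamma>12 s0 = exp (- \<tau>) *\<^sub>R foot n x2 + ((exp \<tau> - exp (- \<tau>)) / (2 * k)) *\<^sub>R x2"
    unfolding g12 coeff12 foot_def k_def[symmetric] by (simp add: scaleR_add_left scaleR_diff_right)
  moreover have "0 \<le> (exp \<tau> - exp (- \<tau>)) / (2 * k)" using \<tau> k by simp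
  moreover have "0 \<le> exp (- \<tau>)" by simp
  ultimately have ray: "\<gamma>12 s0 \<in> perp_ray (plane_of n) x2"
    unfolding perp_ray_eq[OF n x(1,4)] geodesic_ray_def using H(1) by blast
  define y where "y = - (x3 \<odot> x4) / 2"
  have y: "0 < y" using x by (simp add: y_def)
  have ry: "r = 1 / (2 * sqrt y)"
  proof -
    have "- 2 * (x3 \<odot> x4) = 2\<^sup>2 * y" by (simp add: y_def)
    then show ?thesis unfolding r_def by (simp only: real_sqrt_mult real_sqrt_power[symmetric]) simp
  qed
  \<comment> \<open>Taking r = 1 / (2 sqrt y) and k out of the root gives the common factor of the
    formula, where k is the parameter belonging to x2.\<close>
  have root: "2 * sqrt ((r * (p / k)) * (r * q)) = 1 / sqrt (k * y) * sqrt (p * q)" if "0 \<le> p" "0 \<le> q" for p q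
  proof -
    have "(r * (p / k)) * (r * q) = r\<^sup>2 * (p * q / k)" by (simp add: power2_eq_square)
    then have "sqrt ((r * (p / k)) * (r * q)) = r * (sqrt (p * q) / sqrt k)"
      using r by (simp add: real_sqrt_mult real_sqrt_divide)
    then show ?thesis using ry by (simp add: real_sqrt_mult)
  qed
  have "dist_cosh \<gamma>12 \<gamma>34 (s0, t0) = cosh_transversal k y (n \<odot> x3) (n \<odot> x4) C D"
    unfolding val A1_def A2_def A3_def A4_def cosh_transversal_def
    using root[of C "D / k + (n \<odot> x4)"] root[of D "C / k + (n \<odot> x3)"] CD k x
    by (simp add: distrib_left)
  then have val': "dist_cosh \<gamma>12 \<gamma>34 (s0, t0) = cosh_transversal (n \<odot> x2) (- (x3 \<odot> x4) / 2) (n \<odot> x3) (n \<odot> x4)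
      (- (x2 \<odot> x3) / 2) (- (x2 \<odot> x4) / 2)"
    by (simp add: k_def y_def C_def D_def)
  show ?thesis by (rule that[OF crit min val' T12 T34 ray])
qed

section \<open>The parameters and the closed formula\<close>

lemma arclength_param_line_param:
  assumes "pos_light u" "pos_light w" "u \<odot> w = - 1 / 2"
  shows "arclength_param (line_param u w) (span {u, w} \<inter> H3)"
  unfolding arclength_param_def
  using range_line_param[OF assms] dH_eq_abs lorentz_line_param[OF assms] by simp

lemma has_params_iff:
  assumes "n \<odot> n = 1" "pos_light x2" "pos_light x3" "pos_light x4"
    "0 < n \<odot> x2" "0 < n \<odot> x3" "0 < n \<odot> x4" "x2 \<odot> x3 < 0" "x2 \<odot> x4 < 0" "x3 \<odot> x4 < 0"
  shows "has_params (plane_of n) x2 x3 x4 x y a b c d \<longleftrightarrow>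
    x = n \<odot> x2 \<and> y = - (x3 \<odot> x4) / 2 \<and> a = n \<odot> x3 \<and> b = n \<odot> x4 \<and>
    c = - (x2 \<odot> x3) / 2 \<and> d = - (x2 \<odot> x4) / 2"
  using assms by (simp add: has_params_def exp_signed_dist_plane exp_signed_dist_horoballs)

lemma realizable_positive:
  "realizable x y a b c d \<Longrightarrow> 0 < x \<and> 0 < y \<and> 0 < a \<and> 0 < b \<and> 0 < c \<and> 0 < d"
  by (auto simp: realizable_def has_params_def)

text \<open>A configuration realizing the tuple, with explicit parametrizations of its two
  geodesics, exhibits the value as a hyperbolic cosine. This is what allows \<open>arcosh\<close> to
  be inverted and compared.\<close>

lemma realizable_cosh_transversal:
  assumes "realizable x y a b c d" shows "1 \<le> cosh_transversal x y a b c d"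
proof -
  obtain P1 H1 x2 x3 x4 where data: "truncated_data P1 H1 x2 x3 x4"
    and params: "has_params P1 x2 x3 x4 x y a b c d"
    using assms by (auto simp: realizable_def)
  obtain n where n: "n \<odot> n = 1" "P1 = plane_of n" and H1: "H1 = {v \<in> H3. 0 \<le> n \<odot> v}"
    and x: "pos_light x2" "pos_light x3" "pos_light x4" "0 < n \<odot> x2" "0 < n \<odot> x3" "0 < n \<odot> x4"
    "x2 \<odot> x3 < 0" "x2 \<odot> x4 < 0" "x3 \<odot> x4 < 0"
    using truncated_dataE[OF data] .
  define u where "u = (1 / (2 * (n \<odot> x2))) *\<^sub>R x2"
  define r where "r = 1 / sqrt (- 2 * (x3 \<odot> x4))"
  note pl = perp_geodesic_line[OF n(1) x(1,4), folded u_def]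
    and jl = geodesic_joining_line[OF x(2,3,9), folded r_def]
  note \<gamma>12 = arclength_param_line_param[OF pl(1-3), folded pl(4)]
    and \<gamma>34 = arclength_param_line_param[OF jl(2-4), folded jl(5)]
  obtain s t where "dist_cosh (line_param u (u - n)) (line_param (r *\<^sub>R x3) (r *\<^sub>R x4)) (s, t) =
      cosh_transversal x y a b c d"
    by (rule transversal_between_edges[OF n(1) x \<gamma>12 \<gamma>34])
      (use params in \<open>simp add: n(2) has_params_iff[OF n(1) x]\<close>)
  then show ?thesis unfolding dist_cosh_def prod.case by (metis cosh_real_ge_1)
qed

text \<open>The involution is the renumbering that exchanges x3 with x4.\<close>

lemma realizable_swap:
  assumes "realizable x y a b c d" shows "realizable x y b a d c"
proof -
  obtain P1 H1 x2 x3 x4 where data: "truncated_data P1 H1 x2 x3 x4"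
    and params: "has_params P1 x2 x3 x4 x y a b c d"
    using assms by (auto simp: realizable_def)
  obtain n where n: "n \<odot> n = 1" "P1 = plane_of n" and H1: "H1 = {v \<in> H3. 0 \<le> n \<odot> v}"
    and x: "pos_light x2" "pos_light x3" "pos_light x4" "0 < n \<odot> x2" "0 < n \<odot> x3" "0 < n \<odot> x4"
    "x2 \<odot> x3 < 0" "x2 \<odot> x4 < 0" "x3 \<odot> x4 < 0"
    using truncated_dataE[OF data] .
  have sym: "x4 \<odot> x3 < 0" using x(9) by (simp add: lorentz_commute)
  have "truncated_data P1 H1 x2 x4 x3"
    using data by (auto simp: truncated_data_def lin_indep_pair_def insert_commute)
  moreover have "has_params P1 x2 x4 x3 x y b a d c"
    using params unfolding n(2) has_params_iff[OF n(1) x]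
      has_params_iff[OF n(1) x(1,3,2,4,6,5,8,7) sym] by (simp add: lorentz_commute)
  ultimately show ?thesis unfolding realizable_def by blast
qed

lemma cosh_transversal_swap: "cosh_transversal x y b a d c = cosh_transversal x y a b c d"
  by (simp add: cosh_transversal_def add.commute)

text \<open>The parameter a occurs in the second root only, c in both. The claims for b and d are
  later obtained from these by the involution.\<close>

lemma cosh_transversal_strict_mono:
  assumes "0 < x" "0 < y" "0 < a" "0 < b" "0 < c" "0 < d"
  shows "a < a' \<Longrightarrow> cosh_transversal x y a b c d < cosh_transversal x y a' b c d"
    "c < c' \<Longrightarrow> cosh_transversal x y a b c d < cosh_transversal x y a b c' d"
proof -
  show "cosh_transversal x y a b c d < cosh_transversal x y a' b c d" if "a < a'"
    unfolding cosh_transversal_def using assms that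
    by (intro mult_strict_left_mono add_strict_left_mono real_sqrt_less_mono) auto
  assume "c < c'"
  then have "c * (d / x + b) < c' * (d / x + b)" "d * (c / x + a) < d * (c' / x + a)"
    using assms by (auto intro!: mult_strict_right_mono add_pos_pos simp: divide_strict_right_mono)
  from add_strict_mono[OF this[THEN real_sqrt_less_mono]]
  show "cosh_transversal x y a b c d < cosh_transversal x y a b c' d"
    unfolding cosh_transversal_def using assms by (intro mult_strict_left_mono) auto
qed

theorem proposition4p7:
  "\<exists>T3 :: real \<Rightarrow> real \<Rightarrow> real \<Rightarrow> real \<Rightarrow> real \<Rightarrow> real \<Rightarrow> real.
     (\<forall>P1 H1 x2 x3 x4 \<gamma>12 \<gamma>34 x y a b c d.
        truncated_data P1 H1 x2 x3 x4 \<longrightarrow>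
        arclength_param \<gamma>12 (perp_geodesic P1 x2) \<longrightarrow>
        arclength_param \<gamma>34 (geodesic_joining x3 x4) \<longrightarrow>
        has_params P1 x2 x3 x4 x y a b c d \<longrightarrow>
        (\<exists>s0 t0.
           (\<forall>z. critical_point (dist_cosh \<gamma>12 \<gamma>34) z \<longleftrightarrow> z = (s0, t0)) \<and>
           (\<forall>z. dist_cosh \<gamma>12 \<gamma>34 (s0, t0) \<le> dist_cosh \<gamma>12 \<gamma>34 z) \<and>
           dist_cosh \<gamma>12 \<gamma>34 (s0, t0) = cosh (T3 x y a b c d) \<and>
           \<gamma>12 s0 \<in> truncated_tetrahedron P1 H1 x2 x3 x4 \<and>
           \<gamma>34 t0 \<in> truncated_tetrahedron P1 H1 x2 x3 x4 \<and>
           is_transversal (perp_ray P1 x2) (geodesic_joining x3 x4) (\<gamma>12 s0) (\<gamma>34 t0) \<and>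
           transversal_length (perp_ray P1 x2) (geodesic_joining x3 x4) = T3 x y a b c d)) \<and>
     (\<forall>x y a b c d a'. realizable x y a b c d \<longrightarrow> realizable x y a' b c d \<longrightarrow> a < a' \<longrightarrow>
        T3 x y a b c d < T3 x y a' b c d) \<and>
     (\<forall>x y a b c d b'. realizable x y a b c d \<longrightarrow> realizable x y a b' c d \<longrightarrow> b < b' \<longrightarrow>
        T3 x y a b c d < T3 x y a b' c d) \<and>
     (\<forall>x y a b c d c'. realizable x y a b c d \<longrightarrow> realizable x y a b c' d \<longrightarrow> c < c' \<longrightarrow>
        T3 x y a b c d < T3 x y a b c' d) \<and>
     (\<forall>x y a b c d d'. realizable x y a b c d \<longrightarrow> realizable x y a b c d' \<longrightarrow> d < d' \<longrightarrow>
        T3 x y a b c d < T3 x y a b c d') \<and>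
     (\<forall>x y a b c d. realizable x y a b c d \<longrightarrow>
        realizable x y b a d c \<and> T3 x y b a d c = T3 x y a b c d) \<and>
     (\<forall>x y a b c d. realizable x y a b c d \<longrightarrow>
        cosh (T3 x y a b c d) =
          1 / sqrt (x * y) * (sqrt (c * (d / x + b)) + sqrt (d * (c / x + a))))"
proof -
  \<comment> \<open>Fixing the function before any configuration is what expresses that the minimum
    depends only on the six signed distances.\<close>
  define T3 where "T3 x y a b c d = arcosh (cosh_transversal x y a b c d)" for x y a b c d
  have edges: "\<exists>s0 t0.
      (\<forall>z. critical_point (dist_cosh \<gamma>12 \<gamma>34) z \<longleftrightarrow> z = (s0, t0)) \<and>
      (\<forall>z. dist_cosh \<gamma>12 \<gamma>34 (s0, t0) \<le> dist_cosh \<gamma>12 \<gamma>34 z) \<and>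
      dist_cosh \<gamma>12 \<gamma>34 (s0, t0) = cosh (T3 x y a b c d) \<and>
      \<gamma>12 s0 \<in> truncated_tetrahedron P1 H1 x2 x3 x4 \<and>
      \<gamma>34 t0 \<in> truncated_tetrahedron P1 H1 x2 x3 x4 \<and>
      is_transversal (perp_ray P1 x2) (geodesic_joining x3 x4) (\<gamma>12 s0) (\<gamma>34 t0) \<and>
      transversal_length (perp_ray P1 x2) (geodesic_joining x3 x4) = T3 x y a b c d"
    if data: "truncated_data P1 H1 x2 x3 x4"
      and \<gamma>: "arclength_param \<gamma>12 (perp_geodesic P1 x2)" "arclength_param \<gamma>34 (geodesic_joining x3 x4)"
      and params: "has_params P1 x2 x3 x4 x y a b c d"
    for P1 H1 x2 x3 x4 \<gamma>12 \<gamma>34 x y a b c d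
  proof -
    let ?E = "perp_ray P1 x2" and ?F = "geodesic_joining x3 x4"
    obtain n where n: "n \<odot> n = 1" "P1 = plane_of n" and H1: "H1 = {v \<in> H3. 0 \<le> n \<odot> v}"
      and x: "pos_light x2" "pos_light x3" "pos_light x4" "0 < n \<odot> x2" "0 < n \<odot> x3" "0 < n \<odot> x4"
      "x2 \<odot> x3 < 0" "x2 \<odot> x4 < 0" "x3 \<odot> x4 < 0"
      using truncated_dataE[OF data] .
    have p: "x = n \<odot> x2" "y = - (x3 \<odot> x4) / 2" "a = n \<odot> x3" "b = n \<odot> x4"
      "c = - (x2 \<odot> x3) / 2" "d = - (x2 \<odot> x4) / 2"
      using params unfolding n(2) has_params_iff[OF n(1) x] by blast+
    obtain s0 t0 where crit: "\<And>z. critical_point (dist_cosh \<gamma>12 \<gamma>34) z \<longleftrightarrow> z = (s0, t0)"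
      and min: "\<And>z. dist_cosh \<gamma>12 \<gamma>34 (s0, t0) \<le> dist_cosh \<gamma>12 \<gamma>34 z"
      and val: "dist_cosh \<gamma>12 \<gamma>34 (s0, t0) = cosh_transversal x y a b c d"
      and mem: "\<gamma>12 s0 \<in> truncated_tetrahedron P1 H1 x2 x3 x4" "\<gamma>34 t0 \<in> truncated_tetrahedron P1 H1 x2 x3 x4"
      and ray: "\<gamma>12 s0 \<in> ?E"
      by (rule transversal_between_edges[OF n(1) x \<gamma>[unfolded n(2)], folded H1 p n(2)], rule that)
    have L: "range \<gamma>12 = span {n, x2} \<inter> H3" "range \<gamma>34 = span {x3, x4} \<inter> H3"
      using \<gamma> perp_geodesic_eq[OF n(1) x(1,4)] geodesic_joining_eq[OF x(2,3,9)] n(2)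
      by (auto simp: arclength_param_def)
    then have H: "\<gamma>12 s \<in> H3" "\<gamma>34 t \<in> H3" for s t by blast+
    have "foot n x2 \<in> span {n, x2}" "x2 \<in> span {n, x2}"
      using foot_props[OF n(1) x(1,4)] by (auto intro: span_base)
    \<comment> \<open>The edge is only a ray of the perpendicular. As the minimizing point lies on
      it, the minimum over both full geodesics is also the minimum over the two edges.\<close>
    then have E: "?E \<subseteq> range \<gamma>12"
      unfolding L n(2) perp_ray_eq[OF n(1) x(1,4)] geodesic_ray_def by (auto intro!: span_add span_scale)
    have F: "?F = range \<gamma>34" using \<gamma>(2) by (simp add: arclength_param_def)
    have T: "dH (\<gamma>12 s0) (\<gamma>34 t0) = T3 x y a b c d"
      using val dH_nonneg[OF H, of s0 t0] unfolding T3_def dist_cosh_def prod.case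
      by (metis arcosh_cosh_real)
    have le: "dH (\<gamma>12 s0) (\<gamma>34 t0) \<le> dH (\<gamma>12 s) (\<gamma>34 t)" for s t
      using min[of "(s, t)"] dH_nonneg[OF H] unfolding dist_cosh_def prod.case
      by (simp add: cosh_real_nonneg_le_iff)
    have tr: "is_transversal ?E ?F (\<gamma>12 s0) (\<gamma>34 t0)"
      unfolding is_transversal_def F using ray E le by blast
    have "transversal_length ?E ?F = dH (\<gamma>12 s0) (\<gamma>34 t0)"
      unfolding transversal_length_def
    proof (rule the_equality)
      show "\<exists>p q. is_transversal ?E ?F p q \<and> dH (\<gamma>12 s0) (\<gamma>34 t0) = dH p q" using tr by blast
      fix l assume "\<exists>p q. is_transversal ?E ?F p q \<and> l = dH p q"
      then show "l = dH (\<gamma>12 s0) (\<gamma>34 t0)"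
        using tr unfolding is_transversal_def by (metis order_antisym)
    qed
    moreover have "dist_cosh \<gamma>12 \<gamma>34 (s0, t0) = cosh (T3 x y a b c d)"
      unfolding dist_cosh_def prod.case T ..
    ultimately show ?thesis using crit min mem tr T by (intro exI[of _ s0] exI[of _ t0]) simp
  qed
  have T3_less: "T3 x y a b c d < T3 x' y' a' b' c' d'"
    if "realizable x y a b c d" "realizable x' y' a' b' c' d'"
      "cosh_transversal x y a b c d < cosh_transversal x' y' a' b' c' d'" for x y a b c d x' y' a' b' c' d'
    unfolding T3_def using that realizable_cosh_transversal by simp
  have T3_swap: "T3 x y b a d c = T3 x y a b c d" for x y a b c d
    by (simp only: T3_def cosh_transversal_swap)
  have mono_a: "T3 x y a b c d < T3 x y a' b c d"
    if "realizable x y a b c d" "realizable x y a' b c d" "a < a'" for x y a b c d a'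
    using that realizable_positive[OF that(1)] by (intro T3_less cosh_transversal_strict_mono) auto
  have mono_c: "T3 x y a b c d < T3 x y a b c' d"
    if "realizable x y a b c d" "realizable x y a b c' d" "c < c'" for x y a b c d c'
    using that realizable_positive[OF that(1)] by (intro T3_less cosh_transversal_strict_mono) auto
  \<comment> \<open>Exchanging x3 with x4 turns b into a and d into c.\<close>
  have mono_b: "T3 x y a b c d < T3 x y a b' c d"
    if "realizable x y a b c d" "realizable x y a b' c d" "b < b'" for x y a b c d b'
    using mono_a[OF realizable_swap[OF that(1)] realizable_swap[OF that(2)] that(3)] by (simp only: T3_swap)
  have mono_d: "T3 x y a b c d < T3 x y a b c d'"
    if "realizable x y a b c d" "realizable x y a b c d'" "d < d'" for x y a b c d d'
    using mono_c[OF realizable_swap[OF that(1)] realizable_swap[OF that(2)] that(3)] by (simp only: T3_swap)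
  have formula: "cosh (T3 x y a b c d) = 1 / sqrt (x * y) * (sqrt (c * (d / x + b)) + sqrt (d * (c / x + a)))"
    if "realizable x y a b c d" for x y a b c d
    using realizable_cosh_transversal[OF that] by (simp only: T3_def cosh_arcosh_real cosh_transversal_def)
  show ?thesis
    by (intro exI[of _ T3] conjI allI impI)
      (fact edges mono_a mono_b mono_c mono_d realizable_swap formula | rule T3_swap)+
qed

end
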